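(* Fix $m\ge1$. (a) There are constants $0<c_m\le C_m$ such that for every $N\in\mathbb N$ and every $f\in H^1_{m\,\mathrm{last}}(\mathbb T^N)$ (with $\Omega=\mathbb T$), $$c_m\|f\|_{H^1[\mathcal T_m]}\le\|f\|_{L^1(\mathbb T^N)}\le C_m\|f\|_{H^1[\mathcal T_m]}.$$ (b) Let $(\Omega,\mathcal F,\mu)$ be a probability space that is not a single atom (i.e. $L^2(\Omega)$ contains a non-constant function), and let $m'\in\mathbb N$. The following are equivalent: (i) $m'\le m$; (ii) $P_{m'}$ is bounded on $H^1[\mathcal T_m]$ over $\Omega$, i.e. $\sup_N\sup_{f\in L^1(\Omega^N),f\neq0}\|P_{m'}f\|_{H^1[\mathcal T_m]}/\|f\|_{H^1[\mathcal T_m]}<\infty$; (iii) $P_{m'}$ is bounded on $H^1_{m\,\mathrm{last}}(\mathbb T^N)$ uniformly in $N$ (with the $L^1$ norm).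
   Context: $\Omega^N$ carries the product probability measure; for $A\subseteq[1,N]$, $\mathbb E_A$ is conditional expectation onto the $\sigma$-algebra of coordinates in $A$, $P_A=(\mathrm{id}-\mathbb E)^{\otimes A}\otimes\mathbb E^{\otimes([1,N]\setminus A)}=\sum_{B\subseteq A}(-1)^{|A\setminus B|}\mathbb E_B$, $P_k=\sum_{|A|=k}P_A$. For $A\subseteq[1,N]$ with $|A|\le m$ define $\Delta^{(m)}_A=P_A$ if $|A|<m$, and if $|A|=m$, $\Delta^{(m)}_A=(\mathrm{id}-\mathbb E)^{\otimes A}\otimes\mathrm{id}^{\otimes[1,\min A-1]}\otimes\mathbb E^{\otimes([1,N]\setminus([1,\min A-1]\cup A))}$ (equivalently $\Delta^{(m)}_A=\sum_{B\subseteq[1,\min A-1]}P_{A\cup B}$). The norm is $\|f\|_{H^1[\mathcal T_m]}=\mathbb E\big(\sum_{A\subseteq[1,N],|A|\le m}|\Delta^{(m)}_Af|^2\big)^{1/2}$. $\mathbb T=[0,2\pi)$ with normalized Lebesgue measure. $H^1_{m\,\mathrm{last}}(\mathbb T^N)$ is the closed span in $L^1(\mathbb T^N)$ of the characters $e^{i\langle n,t\rangle}$ such that either $|\operatorname{supp}n|\ge m$ and the $m$ nonzero entries $n_i$ with largest indices $i$ are all positive, or $|\operatorname{supp}n|<m$ and $n_j\ge0$ for all $j$. On $\mathbb T^N$, $P_k$ keeps exactly the characters with $|\operatorname{supp}n|=k$. *)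

theory Defs
  imports "HOL-Probability.Probability"
begin

definition prodM :: "'a measure \<Rightarrow> nat \<Rightarrow> (nat \<Rightarrow> 'a) measure" where
  "prodM M N = PiM {1..N} (\<lambda>_. M)"

text \<open>E_A = id on coordinates in A, tensor expectation on the other coordinates
  (conditional expectation onto the sigma-algebra of the coordinates in A).\<close>
definition coordE :: "'a measure \<Rightarrow> nat \<Rightarrow> nat set \<Rightarrow> ((nat \<Rightarrow> 'a) \<Rightarrow> complex) \<Rightarrow> (nat \<Rightarrow> 'a) \<Rightarrow> complex" where
  "coordE M N A f x = (\<integral>y. f (merge A ({1..N} - A) (x, y)) \<partial>(PiM ({1..N} - A) (\<lambda>_. M)))"

definition projP :: "'a measure \<Rightarrow> nat \<Rightarrow> nat set \<Rightarrow> ((nat \<Rightarrow> 'a) \<Rightarrow> complex) \<Rightarrow> (nat \<Rightarrow> 'a) \<Rightarrow> complex" where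
  "projP M N A f x = (\<Sum>B\<in>Pow A. (-1) ^ card (A - B) * coordE M N B f x)"

definition projPk :: "'a measure \<Rightarrow> nat \<Rightarrow> nat \<Rightarrow> ((nat \<Rightarrow> 'a) \<Rightarrow> complex) \<Rightarrow> (nat \<Rightarrow> 'a) \<Rightarrow> complex" where
  "projPk M N k f x = (\<Sum>A\<in>{A. A \<subseteq> {1..N} \<and> card A = k}. projP M N A f x)"

text \<open>Delta^(m)_A: P_A if |A| < m; if |A| = m it is
  (id-E)^{tensor A} tensor id^{[1,min A - 1]} tensor E^{rest}, expanded as
  sum over B subset A of (-1)^|A-B| E_{B union [1, min A - 1]}.\<close>
definition Delta :: "'a measure \<Rightarrow> nat \<Rightarrow> nat \<Rightarrow> nat set \<Rightarrow> ((nat \<Rightarrow> 'a) \<Rightarrow> complex) \<Rightarrow> (nat \<Rightarrow> 'a) \<Rightarrow> complex" where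
  "Delta M N m A f x =
     (if card A < m then projP M N A f x
      else (\<Sum>B\<in>Pow A. (-1) ^ card (A - B) * coordE M N (B \<union> {1..<Min A}) f x))"

definition H1norm :: "'a measure \<Rightarrow> nat \<Rightarrow> nat \<Rightarrow> ((nat \<Rightarrow> 'a) \<Rightarrow> complex) \<Rightarrow> ennreal" where
  "H1norm M N m f =
     (\<integral>\<^sup>+ x. ennreal (sqrt (\<Sum>A\<in>{A. A \<subseteq> {1..N} \<and> card A \<le> m}. (cmod (Delta M N m A f x))\<^sup>2)) \<partial>prodM M N)"

definition L1norm :: "'a measure \<Rightarrow> nat \<Rightarrow> ((nat \<Rightarrow> 'a) \<Rightarrow> complex) \<Rightarrow> ennreal" where
  "L1norm M N f = (\<integral>\<^sup>+ x. ennreal (cmod (f x)) \<partial>prodM M N)"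

definition torus :: "real measure" where
  "torus = uniform_measure lborel {0..<2*pi}"

definition torus_char :: "nat \<Rightarrow> (nat \<Rightarrow> int) \<Rightarrow> (nat \<Rightarrow> real) \<Rightarrow> complex" where
  "torus_char N n t = exp (\<i> * complex_of_real (\<Sum>j\<in>{1..N}. real_of_int (n j) * t j))"

definition admissible :: "nat \<Rightarrow> nat \<Rightarrow> (nat \<Rightarrow> int) \<Rightarrow> bool" where
  "admissible m N n \<longleftrightarrow>
     (\<forall>j. j \<notin> {1..N} \<longrightarrow> n j = 0) \<and>
     (let S = {j\<in>{1..N}. n j \<noteq> 0} in
       (card S \<ge> m \<longrightarrow> (\<forall>i\<in>S. card {j\<in>S. i < j} < m \<longrightarrow> n i > 0)) \<and>
       (card S < m \<longrightarrow> (\<forall>j. n j \<ge> 0)))"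

definition H1last :: "nat \<Rightarrow> nat \<Rightarrow> ((nat \<Rightarrow> real) \<Rightarrow> complex) set" where
  "H1last m N = {f. integrable (prodM torus N) f \<and>
     (\<forall>\<epsilon>>0. \<exists>S c. finite S \<and> S \<subseteq> {n. admissible m N n} \<and>
        L1norm torus N (\<lambda>t. f t - (\<Sum>n\<in>S. c n * torus_char N n t)) < ennreal \<epsilon>)}"

end

theory Submission
  imports Defs "HOL-Complex_Analysis.Complex_Analysis"
begin

text \<open>
  All comparisons are proved by induction on \<open>m\<close> for finite families of bounded functions, measured in
  the \<open>\<ell>\<^sup>2\<close> norm of the family. A decoupling inequality allows one to replace, in the martingale
  difference \<open>D\<^sub>n f\<close> (last active coordinate \<open>n\<close>), the coordinate \<open>x\<^sub>n\<close> by an independent copy \<open>y\<^sub>n\<close>.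
  For fixed \<open>y\<close> the functions \<open>x \<mapsto> D\<^sub>n f(x\<^sub>1, \<dots>, x\<^bsub>n-1\<^esub>, y\<^sub>n)\<close> form a new family to which the case
  \<open>m - 1\<close> applies. The case \<open>m = 1\<close> compares the \<open>L\<^sup>1\<close> norm of a martingale with that of its square
  function: \<open>sqrt (|x|\<^sup>2 + s) - 4 sqrt s\<close> gives a supermartingale in general, and
  \<open>15 |x| - sqrt (|x|\<^sup>2 + s)\<close> a submartingale for Hardy martingales, the latter because
  \<open>|F|\<^bsup>1/2\<^esup>\<close> is subharmonic for analytic \<open>F\<close>. Boundedness of \<open>P\<^sub>m\<close> follows in the same way from the
  trivial estimate \<open>|E f| \<le> E |f|\<close>; for larger orders a Riesz product gives a counterexample.
\<close>

text \<open>No constant may depend on \<open>N\<close>, so no step may lose a factor per coordinate.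
  The recursion peels off the largest element of \<open>A\<close>, although \<open>Delta\<close> is
  governed by \<open>Min A\<close>: freezing the largest coordinate leaves an operator of the same
  type with one index fewer, and the chain ends at order 0 with \<open>A = {}\<close>, where every
  coordinate is free. The L^1 norm is thus order 0 of the same scale. Families are forced: for a
  fixed decoupled copy, one function becomes the sequence of its differences, which enter through
  the root of a sum of squares and cannot be treated one at a time. For general martingales L^1 does
  not control the square function; this is the obstacle in the lower bound. The half-power
  inequality supplies the missing gain: if the norm jumps from \<open>a\<close> to \<open>R\<close>,
  the mean of \<open>(sqrt R - sqrt a)^2\<close> is at most the mean of \<open>R - a\<close>.
  Constants multiply along one round: 64 = 4 * 4 * 4, 240 = 4 * 4 * 15, 16 = 4 * 4. Each decoupling
  costs 4, and the martingale estimates cost 4 and 15.\<close>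

section \<open>Elementary inequalities for square roots\<close>

text \<open>The increment equals \<open>t / (sqrt (s + t) + sqrt s)\<close>, whose denominator lies
  between \<open>sqrt (s + t)\<close> and twice that. The two resulting bounds, here and in the next
  lemma, telescope into the estimates behind decoupling.\<close>

lemma sqrt_increment_le_quotient:
  fixes s t :: real
  assumes "0 \<le> s" "0 \<le> t"
  shows "sqrt (s + t) - sqrt s \<le> t / sqrt (s + t)"
proof (cases "s + t = 0")
  case False
  then have p: "sqrt (s + t) > 0" using assms by auto
  have "(sqrt (s + t) - sqrt s) * sqrt (s + t) = s + t - sqrt s * sqrt (s + t)"
    using assms by (simp add: algebra_simps)
  also have "\<dots> \<le> s + t - sqrt s * sqrt s"
    using assms by (intro diff_left_mono mult_left_mono) auto
  also have "\<dots> = t" using assms by simp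
  finally show ?thesis using p by (simp add: pos_le_divide_eq)
qed (use assms in auto)

lemma quotient_le_sqrt_increment:
  fixes s t :: real
  assumes "0 \<le> s" "0 \<le> t"
  shows "t / sqrt (s + t) \<le> 2 * (sqrt (s + t) - sqrt s)"
proof (cases "s + t = 0")
  case False
  then have p: "sqrt (s + t) > 0" using assms by auto
  have "0 \<le> (sqrt (s + t) - sqrt s)\<^sup>2" by simp
  then have "t \<le> 2 * (sqrt (s + t) - sqrt s) * sqrt (s + t)"
    using assms by (simp add: power2_eq_square algebra_simps)
  then show ?thesis using p by (simp add: pos_divide_le_eq)
qed (use assms in auto)

text \<open>Here \<open>a\<close> is the length of the current vector, \<open>t\<close> that of the
  increment and \<open>p\<close> their real inner product. The bound is the tangent line of the
  square root at \<open>A^2\<close>; the linear term \<open>p / A\<close> is kept exact because it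
  will have mean zero. Effective for small \<open>t\<close>.\<close>

lemma sqrt_plus_increment_quadratic:
  fixes a s t p :: real
  assumes "0 \<le> s" "\<bar>p\<bar> \<le> a * t" "0 < s + a\<^sup>2"
  defines "A \<equiv> sqrt (s + a\<^sup>2)"
  shows "sqrt (s + t\<^sup>2 + (a\<^sup>2 + 2 * p + t\<^sup>2)) \<le> A + p / A + t\<^sup>2 / A"
proof -
  have A: "A > 0" "A\<^sup>2 = s + a\<^sup>2" using assms by auto
  have nn: "0 \<le> A + p / A + t\<^sup>2 / A"
  proof -
    have "0 \<le> A\<^sup>2 + p + t\<^sup>2"
    proof -
      have "a * t \<le> a\<^sup>2 + t\<^sup>2" using sum_squares_bound[of a t] zero_le_power2[of a] zero_le_power2[of t]
        by linarith
      then show ?thesis using assms A by linarith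
    qed
    then have "0 \<le> (A\<^sup>2 + p + t\<^sup>2) / A" using A by simp
    also have "\<dots> = A + p / A + t\<^sup>2 / A" using A by (simp add: field_simps power2_eq_square)
    finally show ?thesis .
  qed
  have "(A + p / A + t\<^sup>2 / A)\<^sup>2 = (A + (p + t\<^sup>2) / A)\<^sup>2"
    by (simp add: add_divide_distrib add.assoc)
  also have "\<dots> = A\<^sup>2 + 2 * (p + t\<^sup>2) + ((p + t\<^sup>2) / A)\<^sup>2"
    using A(1) by (simp add: power2_sum)
  also have "\<dots> \<ge> s + t\<^sup>2 + (a\<^sup>2 + 2 * p + t\<^sup>2)"
    using A by simp
  finally show ?thesis using nn by (simp add: real_le_lsqrt)
qed

text \<open>The counterpart for large \<open>t\<close>. Rounding \<open>2 * t^2\<close> up to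
  \<open>9/4 * t^2\<close> completes a square, so the root is at most \<open>A + 3/2 * t\<close>;
  keeping the mean-zero term \<open>p / A\<close>, which can be as low as \<open>- t\<close>, costs
  one more \<open>t\<close>. Hence 5/2.\<close>

lemma sqrt_plus_increment_linear:
  fixes a s t p :: real
  assumes "0 \<le> s" "0 \<le> a" "0 \<le> t" "\<bar>p\<bar> \<le> a * t" "0 < s + a\<^sup>2"
  defines "A \<equiv> sqrt (s + a\<^sup>2)"
  shows "sqrt (s + t\<^sup>2 + (a\<^sup>2 + 2 * p + t\<^sup>2)) \<le> A + p / A + 5 / 2 * t"
proof -
  have A: "A > 0" "A\<^sup>2 = s + a\<^sup>2" using assms by auto
  have "a \<le> A" unfolding A_def using assms by (simp add: real_le_rsqrt)
  then have "a * t \<le> A * t" using assms by (simp add: mult_right_mono)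
  then have pt: "\<bar>p\<bar> \<le> A * t" using assms by linarith
  have "s + t\<^sup>2 + (a\<^sup>2 + 2 * p + t\<^sup>2) = A\<^sup>2 + 2 * p + 2 * t\<^sup>2" using A by simp
  also have "\<dots> \<le> A\<^sup>2 + 2 * (A * t) + 9/4 * t\<^sup>2" using pt zero_le_power2[of t] by linarith
  also have "\<dots> \<le> (A + 3/2 * t)\<^sup>2" using A assms by (simp add: power2_eq_square algebra_simps)
  finally have le: "s + t\<^sup>2 + (a\<^sup>2 + 2 * p + t\<^sup>2) \<le> (A + 3/2 * t)\<^sup>2" .
  have "0 \<le> A + 3/2 * t" using A(1) assms(3) by linarith
  then have "sqrt (s + t\<^sup>2 + (a\<^sup>2 + 2 * p + t\<^sup>2)) \<le> A + 3/2 * t"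
    using le by (rule real_le_lsqrt)
  moreover have "- t \<le> p / A" using pt A by (simp add: pos_le_divide_eq algebra_simps)
  ultimately show ?thesis by linarith
qed

text \<open>The error of either expansion is paid by the growth of \<open>4 * sqrt s\<close>. At the
  threshold \<open>t^2 = 8 * s\<close> the root \<open>sqrt (s + t^2)\<close> reaches
  \<open>3 * sqrt s\<close>, which gives the factor \<open>3 + 1\<close> in the first case. In the
  second, \<open>sqrt s\<close> is at most \<open>3/8 * t\<close>, and
  \<open>4 * (1 - 3/8) = 5/2\<close>.\<close>

lemma min_increment_le_sqrt_increment:
  fixes s t :: real
  assumes "0 \<le> s" "0 \<le> t"
  shows "t\<^sup>2 \<le> 8 * s \<Longrightarrow> t\<^sup>2 \<le> 4 * sqrt s * (sqrt (s + t\<^sup>2) - sqrt s)"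
    and "8 * s \<le> t\<^sup>2 \<Longrightarrow> 5 / 2 * t \<le> 4 * (sqrt (s + t\<^sup>2) - sqrt s)"
proof -
  define b where "b = sqrt s"
  define q where "q = sqrt (s + t\<^sup>2)"
  have b: "b \<ge> 0" "b\<^sup>2 = s" using assms by (auto simp: b_def)
  have q: "q \<ge> b" "q\<^sup>2 = s + t\<^sup>2" using assms by (auto simp: b_def q_def)
  show "t\<^sup>2 \<le> 4 * sqrt s * (sqrt (s + t\<^sup>2) - sqrt s)" if "t\<^sup>2 \<le> 8 * s"
  proof -
    have "q\<^sup>2 \<le> (3 * b)\<^sup>2" using that b q by (simp add: power_mult_distrib)
    then have "q \<le> 3 * b" by (rule power2_le_imp_le) (use b(1) in simp)
    then have "(q - b) * (q + b) \<le> (q - b) * (4 * b)" using q by (intro mult_left_mono) auto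
    moreover have "(q - b) * (q + b) = t\<^sup>2" using b q by (simp add: algebra_simps power2_eq_square)
    ultimately show ?thesis unfolding b_def[symmetric] q_def[symmetric] by (simp add: algebra_simps)
  qed
  show "5 / 2 * t \<le> 4 * (sqrt (s + t\<^sup>2) - sqrt s)" if "8 * s \<le> t\<^sup>2"
  proof -
    have "(8/3 * b)\<^sup>2 = 64/9 * s" using b by (simp add: power_mult_distrib power2_eq_square)
    also have "\<dots> \<le> t\<^sup>2" using that assms(1) by linarith
    finally have "8/3 * b \<le> t" using assms(2) by (rule power2_le_imp_le)
    then have "b \<le> 3/8 * t" by simp
    moreover have "t \<le> q" using q b assms by (simp add: q_def real_le_rsqrt)
    ultimately have "5 / 2 * t \<le> 4 * (q - b)" by (simp add: algebra_simps)
    then show ?thesis by (simp add: b_def q_def)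
  qed
qed

lemma sqrt_supermartingale_step:
  fixes a s t p :: real
  assumes "0 \<le> s" "0 \<le> a" "0 \<le> t" "\<bar>p\<bar> \<le> a * t" "0 < s + a\<^sup>2"
  shows "sqrt (s + t\<^sup>2 + (a\<^sup>2 + 2 * p + t\<^sup>2)) - 4 * sqrt (s + t\<^sup>2)
    \<le> sqrt (s + a\<^sup>2) - 4 * sqrt s + p / sqrt (s + a\<^sup>2)"
proof (cases "t\<^sup>2 \<le> 8 * s")
  case True
  define A where "A = sqrt (s + a\<^sup>2)"
  have A: "A > 0" "sqrt s \<le> A" using assms by (auto simp: A_def)
  have "t\<^sup>2 \<le> 4 * sqrt s * (sqrt (s + t\<^sup>2) - sqrt s)"
    using min_increment_le_sqrt_increment(1) True assms by auto
  also have "\<dots> \<le> 4 * A * (sqrt (s + t\<^sup>2) - sqrt s)"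
    using A assms by (intro mult_right_mono) auto
  finally have "t\<^sup>2 / A \<le> 4 * (sqrt (s + t\<^sup>2) - sqrt s)"
    unfolding pos_divide_le_eq[OF A(1)] by (simp only: mult_ac)
  then show ?thesis
    using sqrt_plus_increment_quadratic[OF assms(1,4,5)] unfolding A_def right_diff_distrib by linarith
next
  case False
  then show ?thesis
    using sqrt_plus_increment_linear[OF assms] min_increment_le_sqrt_increment(2)[OF assms(1,3)]
    unfolding right_diff_distrib by linarith
qed

text \<open>Meant for \<open>R\<close> the length of the vector after the step and
  \<open>\<eta>\<close> the defect of \<open>R\<close> against its projection on the old direction.
  If \<open>R\<close> is at most \<open>4 * a\<close>, then \<open>sqrt R + sqrt a\<close> is at
  most \<open>3 * sqrt a\<close>, which bounds \<open>(R - a)^2 / a\<close> by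
  \<open>9 * (sqrt R - sqrt a)^2\<close>. Otherwise \<open>R / 4\<close> is at most
  \<open>(sqrt R - sqrt a)^2\<close> and \<open>t\<close> at most \<open>5/4 * R\<close>; the
  equality \<open>5/2 * 5/4 = 25/2 * 1/4\<close> fixes the constant.\<close>

lemma sqrt_deviation_bound:
  fixes a R t \<eta> :: real
  assumes "0 \<le> R" "0 < a" "0 \<le> t" "0 \<le> \<eta>" "t\<^sup>2 = (R - a)\<^sup>2 + 2 * a * \<eta>" "t \<le> R + a"
  shows "t\<^sup>2 / a \<le> 25 / 2 * (sqrt R - sqrt a)\<^sup>2 + 2 * \<eta> \<or>
         5 / 2 * t \<le> 25 / 2 * (sqrt R - sqrt a)\<^sup>2 + 2 * \<eta>"
proof -
  define r b where "r = sqrt R" and "b = sqrt a"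
  have rb: "r \<ge> 0" "b > 0" "r\<^sup>2 = R" "b\<^sup>2 = a" using assms by (auto simp: r_def b_def)
  show ?thesis
  proof (cases "R \<le> 4 * a")
    case True
    then have "r\<^sup>2 \<le> (2 * b)\<^sup>2" using rb by (simp add: power_mult_distrib)
    then have "r \<le> 2 * b" by (rule power2_le_imp_le) (use rb(2) in simp)
    then have "(r + b)\<^sup>2 \<le> (3 * b)\<^sup>2" using rb by (intro power_mono) auto
    then have "(r - b)\<^sup>2 * (r + b)\<^sup>2 \<le> (r - b)\<^sup>2 * (9 * a)" using rb
      by (intro mult_left_mono) (auto simp: power_mult_distrib)
    moreover have "(R - a)\<^sup>2 = (r - b)\<^sup>2 * (r + b)\<^sup>2"
      unfolding rb(3,4)[symmetric] power_mult_distrib[symmetric] by (simp add: power2_eq_square algebra_simps)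
    ultimately have "t\<^sup>2 \<le> (9 * (r - b)\<^sup>2 + 2 * \<eta>) * a" using assms by (simp add: algebra_simps)
    then have "t\<^sup>2 / a \<le> 9 * (r - b)\<^sup>2 + 2 * \<eta>" using assms by (simp add: pos_divide_le_eq)
    then show ?thesis unfolding r_def b_def using zero_le_power2[of "sqrt R - sqrt a"] by linarith
  next
    case False
    then have "(2 * b)\<^sup>2 \<le> r\<^sup>2" using rb by (simp add: power_mult_distrib)
    then have "2 * b \<le> r" using rb(1) by (rule power2_le_imp_le)
    then have "(r / 2)\<^sup>2 \<le> (r - b)\<^sup>2" using rb by (intro power_mono) auto
    then have "R / 4 \<le> (r - b)\<^sup>2" using rb by (simp add: power_divide)
    then show ?thesis unfolding r_def b_def using assms False by linarith
  qed
qed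

section \<open>Resampling coordinates of a product space\<close>

text \<open>In contrast to \<open>merge\<close>, the second argument is a full point. Conditional
  expectations then become integrals over one fixed measure \<open>\<mu>\<close>, whatever the set
  \<open>A\<close>, and composing them reduces to an identity between mixes.\<close>

definition mix :: "nat set \<Rightarrow> (nat \<Rightarrow> 'a) \<Rightarrow> (nat \<Rightarrow> 'a) \<Rightarrow> nat \<Rightarrow> 'a" where
  "mix A x y = (\<lambda>i. if i \<in> A then x i else y i)"

text \<open>Otherwise \<open>{1..N}\<close> is rewritten to \<open>{Suc 0..N}\<close> and facts about \<open>{1..N}\<close> no longer match.\<close>

declare One_nat_def [simp del]

locale coordinate_space = prob_space M for M :: "'a measure" +
  fixes N :: nat
begin

abbreviation \<mu> :: "(nat \<Rightarrow> 'a) measure" where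
  "\<mu> \<equiv> Pi\<^sub>M {1..N} (\<lambda>_. M)"

sublocale PS: product_prob_space "\<lambda>_. M" "{1..N}"
  by unfold_locales

sublocale PP: pair_prob_space \<mu> \<mu> ..

lemma mix_in_space: "x \<in> space \<mu> \<Longrightarrow> y \<in> space \<mu> \<Longrightarrow> mix A x y \<in> space \<mu>"
  by (auto simp: mix_def space_PiM PiE_def Pi_def extensional_def)

lemma upd_in_space: "x \<in> space \<mu> \<Longrightarrow> c \<in> space M \<Longrightarrow> n \<in> {1..N} \<Longrightarrow> x(n := c) \<in> space \<mu>"
  by (auto simp: space_PiM PiE_def Pi_def extensional_def)

lemma coord_in_space: "y \<in> space \<mu> \<Longrightarrow> n \<in> {1..N} \<Longrightarrow> y n \<in> space M"
  by (auto simp: space_PiM)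

lemma upd_coord_in_space: "x \<in> space \<mu> \<Longrightarrow> y \<in> space \<mu> \<Longrightarrow> x(n := y n) \<in> space \<mu>"
  by (auto simp: space_PiM PiE_def Pi_def extensional_def)

text \<open>Index 0 lies outside \<open>{1..N}\<close>, so both points are \<open>undefined\<close>
  there. This lets the mean, stored at index 0, follow the same update formula as the martingale
  differences.\<close>

lemma upd_zero: "x \<in> space \<mu> \<Longrightarrow> y \<in> space \<mu> \<Longrightarrow> x(0 := y 0) = x"
  by (auto simp: space_PiM PiE_def Pi_def extensional_def)

lemma measurable_mix: "(\<lambda>(x, y). mix A x y) \<in> measurable (\<mu> \<Otimes>\<^sub>M \<mu>) \<mu>"
proof (rule measurable_PiM_single')
  show "(\<lambda>z. (case z of (x, y) \<Rightarrow> mix A x y) i) \<in> measurable (\<mu> \<Otimes>\<^sub>M \<mu>) M" if "i \<in> {1..N}" for i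
    using that by (cases "i \<in> A") (auto simp: mix_def case_prod_beta intro!: measurable_compose[OF measurable_fst] measurable_compose[OF measurable_snd])
qed (auto simp: space_pair_measure space_PiM mix_def PiE_def Pi_def extensional_def)

lemma measurable_upd: "n \<in> {1..N} \<Longrightarrow> (\<lambda>(x, c). x(n := c)) \<in> measurable (\<mu> \<Otimes>\<^sub>M M) \<mu>"
proof (rule measurable_PiM_single')
  fix i assume n: "n \<in> {1..N}" "i \<in> {1..N}"
  show "(\<lambda>z. (case z of (x, y) \<Rightarrow> x(n := y)) i) \<in> measurable (\<mu> \<Otimes>\<^sub>M M) M"
    using n by (cases "i = n") (auto simp: case_prod_beta intro!: measurable_compose[OF measurable_fst])
qed (auto simp: space_pair_measure space_PiM PiE_def Pi_def extensional_def)

lemma measurable_upd_coord: "(\<lambda>(x, y). x(n := y n)) \<in> measurable (\<mu> \<Otimes>\<^sub>M \<mu>) \<mu>"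
proof (rule measurable_PiM_single')
  fix i assume n: "i \<in> {1..N}"
  show "(\<lambda>z. (case z of (x, y) \<Rightarrow> x(n := y n)) i) \<in> measurable (\<mu> \<Otimes>\<^sub>M \<mu>) M"
    using n by (cases "i = n") (auto simp: case_prod_beta intro!: measurable_compose[OF measurable_fst] measurable_compose[OF measurable_snd])
qed (auto simp: space_pair_measure space_PiM PiE_def Pi_def extensional_def)

text \<open>The preimage of a box is a product of two boxes in which every coordinate is constrained
  exactly once, so the two measures agree on boxes.\<close>

lemma distr_mix: "distr (\<mu> \<Otimes>\<^sub>M \<mu>) \<mu> (\<lambda>(x, y). mix A x y) = \<mu>"
proof (rule PS.PiM_eqI)
  fix S assume S: "\<And>i. i \<in> {1..N} \<Longrightarrow> S i \<in> sets M"
  define S1 where "S1 i = (if i \<in> A then S i else space M)" for i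
  define S2 where "S2 i = (if i \<in> A then space M else S i)" for i
  have S12: "S1 i \<in> sets M" "S2 i \<in> sets M" if "i \<in> {1..N}" for i
    using S that by (auto simp: S1_def S2_def)
  have sub: "i \<in> {1..N} \<Longrightarrow> z \<in> S i \<Longrightarrow> z \<in> space M" for i z
    using S sets.sets_into_space by blast
  have "emeasure (distr (\<mu> \<Otimes>\<^sub>M \<mu>) \<mu> (\<lambda>(x, y). mix A x y)) (Pi\<^sub>E {1..N} S)
     = emeasure (\<mu> \<Otimes>\<^sub>M \<mu>) ((\<lambda>(x, y). mix A x y) -` (Pi\<^sub>E {1..N} S) \<inter> space (\<mu> \<Otimes>\<^sub>M \<mu>))"
    by (intro emeasure_distr measurable_mix sets_PiM_I_finite) (auto simp: S)
  also have "(\<lambda>(x, y). mix A x y) -` (Pi\<^sub>E {1..N} S) \<inter> space (\<mu> \<Otimes>\<^sub>M \<mu>)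
     = Pi\<^sub>E {1..N} S1 \<times> Pi\<^sub>E {1..N} S2"
    by (auto simp: space_pair_measure space_PiM mix_def S1_def S2_def PiE_def Pi_def extensional_def sub
          split: if_splits)
  also have "emeasure (\<mu> \<Otimes>\<^sub>M \<mu>) \<dots> = emeasure \<mu> (Pi\<^sub>E {1..N} S1) * emeasure \<mu> (Pi\<^sub>E {1..N} S2)"
    using S12 by (intro PS.P.emeasure_pair_measure_Times sets_PiM_I_finite) auto
  also have "\<dots> = (\<Prod>i\<in>{1..N}. emeasure M (S1 i)) * (\<Prod>i\<in>{1..N}. emeasure M (S2 i))"
    using S12 by (subst PS.emeasure_PiM; blast?)+
  also have "\<dots> = (\<Prod>i\<in>{1..N}. emeasure M (S i))"
    unfolding prod.distrib[symmetric]
    by (intro prod.cong) (auto simp: S1_def S2_def emeasure_space_1)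
  finally show "emeasure (distr (\<mu> \<Otimes>\<^sub>M \<mu>) \<mu> (\<lambda>(x, y). mix A x y)) (Pi\<^sub>E {1..N} S)
     = (\<Prod>i\<in>{1..N}. emeasure M (S i))" .
qed auto

lemma distr_upd: 
  assumes n: "n \<in> {1..N}"
  shows "distr (\<mu> \<Otimes>\<^sub>M M) \<mu> (\<lambda>(x, c). x(n := c)) = \<mu>"
proof (rule PS.PiM_eqI)
  fix S assume S: "\<And>i. i \<in> {1..N} \<Longrightarrow> S i \<in> sets M"
  define S1 where "S1 i = (if i = n then space M else S i)" for i
  have S12: "S1 i \<in> sets M" if "i \<in> {1..N}" for i
    using S that by (auto simp: S1_def)
  have sub: "i \<in> {1..N} \<Longrightarrow> z \<in> S i \<Longrightarrow> z \<in> space M" for i z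
    using S sets.sets_into_space by blast
  have "emeasure (distr (\<mu> \<Otimes>\<^sub>M M) \<mu> (\<lambda>(x, c). x(n := c))) (Pi\<^sub>E {1..N} S)
     = emeasure (\<mu> \<Otimes>\<^sub>M M) ((\<lambda>(x, c). x(n := c)) -` (Pi\<^sub>E {1..N} S) \<inter> space (\<mu> \<Otimes>\<^sub>M M))"
    by (intro emeasure_distr measurable_upd n sets_PiM_I_finite) (auto simp: S)
  also have "(\<lambda>(x, c). x(n := c)) -` (Pi\<^sub>E {1..N} S) \<inter> space (\<mu> \<Otimes>\<^sub>M M)
     = Pi\<^sub>E {1..N} S1 \<times> S n"
    using n by (auto simp: space_pair_measure space_PiM S1_def PiE_def Pi_def extensional_def sub
          split: if_splits)
  also have "emeasure (\<mu> \<Otimes>\<^sub>M M) \<dots> = emeasure \<mu> (Pi\<^sub>E {1..N} S1) * emeasure M (S n)"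
    using S12 n S by (intro emeasure_pair_measure_Times sets_PiM_I_finite) auto
  also have "\<dots> = (\<Prod>i\<in>{1..N}. emeasure M (S1 i)) * emeasure M (S n)"
    using S12 by (subst PS.emeasure_PiM; blast?)+
  also have "(\<Prod>i\<in>{1..N}. emeasure M (S1 i)) = (\<Prod>i\<in>{1..N}-{n}. emeasure M (S i))"
    by (subst prod.remove[OF _ n]) (auto simp: S1_def emeasure_space_1 intro!: prod.cong)
  also have "\<dots> * emeasure M (S n) = (\<Prod>i\<in>{1..N}. emeasure M (S i))"
    using n by (subst prod.remove[OF _ n, of "\<lambda>i. emeasure M (S i)"]) (auto simp: mult.commute)
  finally show "emeasure (distr (\<mu> \<Otimes>\<^sub>M M) \<mu> (\<lambda>(x, c). x(n := c))) (Pi\<^sub>E {1..N} S)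
     = (\<Prod>i\<in>{1..N}. emeasure M (S i))" .
qed auto

end

subsection \<open>Bounded measurable functions and coordinate expectations\<close>

text \<open>Boundedness is required everywhere on the space, not almost everywhere: every section is
  then bounded and integrable, and the operator identities hold at every point.\<close>

definition bounded_meas :: "'b measure \<Rightarrow> ('b \<Rightarrow> 'c::real_normed_vector) \<Rightarrow> bool" where
  "bounded_meas P f \<longleftrightarrow> f \<in> borel_measurable P \<and> (\<exists>K. \<forall>x\<in>space P. norm (f x) \<le> K)"

lemma bm_measurable: "bounded_meas P f \<Longrightarrow> f \<in> borel_measurable P"
  by (simp add: bounded_meas_def)

lemma bm_const: "bounded_meas P (\<lambda>_. c)"
  by (auto simp: bounded_meas_def)

lemma bm_add:
  fixes f g :: "'b \<Rightarrow> 'c::{real_normed_vector, second_countable_topology}"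
  shows "bounded_meas P f \<Longrightarrow> bounded_meas P g \<Longrightarrow> bounded_meas P (\<lambda>x. f x + g x)"
  unfolding bounded_meas_def by (auto, meson add_mono norm_triangle_le)

lemma bm_mult:
  fixes f g :: "'b \<Rightarrow> 'c::{real_normed_div_algebra, second_countable_topology}"
  assumes "bounded_meas P f" "bounded_meas P g"
  shows "bounded_meas P (\<lambda>x. f x * g x)"
proof -
  obtain K L where KL: "\<forall>x\<in>space P. norm (f x) \<le> K" "\<forall>x\<in>space P. norm (g x) \<le> L"
    using assms by (auto simp: bounded_meas_def)
  have "norm (f x * g x) \<le> \<bar>K\<bar> * \<bar>L\<bar>" if "x \<in> space P" for x
    unfolding norm_mult using that KL by (intro mult_mono) force+
  then show ?thesis using assms by (auto simp: bounded_meas_def)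
qed

lemma bm_cmult:
  fixes f :: "'b \<Rightarrow> 'c::{real_normed_div_algebra, second_countable_topology}"
  shows "bounded_meas P f \<Longrightarrow> bounded_meas P (\<lambda>x. c * f x)"
  by (intro bm_mult bm_const)

lemma bm_diff:
  fixes f g :: "'b \<Rightarrow> 'c::{real_normed_vector, second_countable_topology}"
  shows "bounded_meas P f \<Longrightarrow> bounded_meas P g \<Longrightarrow> bounded_meas P (\<lambda>x. f x - g x)"
  unfolding bounded_meas_def by (auto, meson add_mono norm_triangle_le_diff)

lemma bm_sum:
  fixes f :: "'i \<Rightarrow> 'b \<Rightarrow> 'c::{real_normed_vector, second_countable_topology}"
  shows "(\<And>i. i \<in> S \<Longrightarrow> bounded_meas P (f i)) \<Longrightarrow> bounded_meas P (\<lambda>x. \<Sum>i\<in>S. f i x)"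
  by (induction S rule: infinite_finite_induct) (auto simp: bm_const bm_add)

lemma bm_prod:
  fixes f :: "'i \<Rightarrow> 'b \<Rightarrow> 'c::{real_normed_field, second_countable_topology}"
  shows "(\<And>i. i \<in> S \<Longrightarrow> bounded_meas P (f i)) \<Longrightarrow> bounded_meas P (\<lambda>x. \<Prod>i\<in>S. f i x)"
  by (induction S rule: infinite_finite_induct) (auto simp: bm_const bm_mult)

lemma bm_norm: "bounded_meas P f \<Longrightarrow> bounded_meas P (\<lambda>x. norm (f x))"
  by (auto simp: bounded_meas_def)

lemma bm_sqrt:
  assumes "bounded_meas P f"
  shows "bounded_meas P (\<lambda>x. sqrt (f x))"
proof -
  obtain K where K: "\<forall>x\<in>space P. \<bar>f x\<bar> \<le> K" using assms by (auto simp: bounded_meas_def)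
  then have "\<bar>sqrt (f x)\<bar> \<le> sqrt K" if "x \<in> space P" for x
    using that by (metis real_sqrt_abs' real_sqrt_le_mono)
  then show ?thesis using assms by (auto simp: bounded_meas_def)
qed

lemma bm_compose:
  "bounded_meas Q f \<Longrightarrow> g \<in> measurable P Q \<Longrightarrow> bounded_meas P (\<lambda>x. f (g x))"
  unfolding bounded_meas_def by (auto dest: measurable_space)

lemma (in prob_space) integrable_bounded_meas:
  fixes f :: "'a \<Rightarrow> 'b::{banach, second_countable_topology}"
  shows "bounded_meas M f \<Longrightarrow> integrable M f"
  unfolding bounded_meas_def by (force intro!: integrable_const_bound AE_I2)

context coordinate_space
begin

lemma nn_integral_mix:
  assumes [measurable]: "g \<in> borel_measurable \<mu>"
  shows "(\<integral>\<^sup>+x. \<integral>\<^sup>+y. g (mix A x y) \<partial>\<mu> \<partial>\<mu>) = (\<integral>\<^sup>+x. g x \<partial>\<mu>)"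
proof -
  note [measurable] = measurable_mix[of A]
  have "(\<integral>\<^sup>+x. g x \<partial>\<mu>) = (\<integral>\<^sup>+z. g (case z of (x, y) \<Rightarrow> mix A x y) \<partial>(\<mu> \<Otimes>\<^sub>M \<mu>))"
    by (subst distr_mix[of A, symmetric], subst nn_integral_distr) auto
  also have "\<dots> = (\<integral>\<^sup>+x. \<integral>\<^sup>+y. g (mix A x y) \<partial>\<mu> \<partial>\<mu>)"
    by (subst PS.P.nn_integral_fst[symmetric]) auto
  finally show ?thesis ..
qed

lemma integrable_mix:
  fixes g :: "(nat \<Rightarrow> 'a) \<Rightarrow> 'b::{banach, second_countable_topology}"
  assumes "integrable \<mu> g"
  shows "integrable (\<mu> \<Otimes>\<^sub>M \<mu>) (\<lambda>(x, y). g (mix A x y))"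
proof -
  have "integrable (distr (\<mu> \<Otimes>\<^sub>M \<mu>) \<mu> (\<lambda>(x, y). mix A x y)) g"
    using assms by (simp only: distr_mix)
  then have "integrable (\<mu> \<Otimes>\<^sub>M \<mu>) (\<lambda>z. g ((\<lambda>(x, y). mix A x y) z))"
    by (subst (asm) integrable_distr_eq[OF measurable_mix]) (use assms in auto)
  then show ?thesis by (simp add: case_prod_beta')
qed

lemma integral_mix:
  fixes g :: "(nat \<Rightarrow> 'a) \<Rightarrow> 'b::{banach, second_countable_topology}"
  assumes "integrable \<mu> g"
  shows "(\<integral>x. \<integral>y. g (mix A x y) \<partial>\<mu> \<partial>\<mu>) = (\<integral>x. g x \<partial>\<mu>)"
proof -
  have "(\<integral>x. g x \<partial>\<mu>) = (\<integral>x. g x \<partial>(distr (\<mu> \<Otimes>\<^sub>M \<mu>) \<mu> (\<lambda>(x, y). mix A x y)))"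
    by (simp only: distr_mix)
  also have "\<dots> = (\<integral>z. g (case z of (x, y) \<Rightarrow> mix A x y) \<partial>(\<mu> \<Otimes>\<^sub>M \<mu>))"
    using assms by (intro integral_distr measurable_mix) auto
  also have "\<dots> = (\<integral>x. \<integral>y. g (mix A x y) \<partial>\<mu> \<partial>\<mu>)"
    using PP.integral_fst[OF integrable_mix[OF assms, of A]] by (simp add: case_prod_beta')
  finally show ?thesis ..
qed

lemma nn_integral_upd:
  assumes [measurable]: "g \<in> borel_measurable \<mu>" and n: "n \<in> {1..N}"
  shows "(\<integral>\<^sup>+x. \<integral>\<^sup>+c. g (x(n := c)) \<partial>M \<partial>\<mu>) = (\<integral>\<^sup>+x. g x \<partial>\<mu>)"
proof -
  note [measurable] = measurable_upd[OF n]
  have "(\<integral>\<^sup>+x. g x \<partial>\<mu>) = (\<integral>\<^sup>+z. g (case z of (x, y) \<Rightarrow> x(n := y)) \<partial>(\<mu> \<Otimes>\<^sub>M M))"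
    by (subst distr_upd[OF n, symmetric], subst nn_integral_distr) auto
  also have "\<dots> = (\<integral>\<^sup>+x. \<integral>\<^sup>+c. g (x(n := c)) \<partial>M \<partial>\<mu>)"
    by (subst nn_integral_fst[symmetric]) auto
  finally show ?thesis ..
qed

lemma integral_upd:
  fixes g :: "(nat \<Rightarrow> 'a) \<Rightarrow> 'b::{banach, second_countable_topology}"
  assumes g: "integrable \<mu> g" and n: "n \<in> {1..N}"
  shows "integrable (\<mu> \<Otimes>\<^sub>M M) (\<lambda>(x, c). g (x(n := c)))"
    and "(\<integral>x. \<integral>c. g (x(n := c)) \<partial>M \<partial>\<mu>) = (\<integral>x. g x \<partial>\<mu>)"
    and "(\<integral>c. \<integral>x. g (x(n := c)) \<partial>\<mu> \<partial>M) = (\<integral>x. g x \<partial>\<mu>)"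
proof -
  interpret Q: pair_prob_space \<mu> M ..
  have "integrable (distr (\<mu> \<Otimes>\<^sub>M M) \<mu> (\<lambda>(x, c). x(n := c))) g"
    using g by (simp only: distr_upd[OF n])
  then have "integrable (\<mu> \<Otimes>\<^sub>M M) (\<lambda>z. g ((\<lambda>(x, c). x(n := c)) z))"
    by (subst (asm) integrable_distr_eq[OF measurable_upd[OF n]]) (use assms in auto)
  then show int: "integrable (\<mu> \<Otimes>\<^sub>M M) (\<lambda>(x, c). g (x(n := c)))" by (simp add: case_prod_beta')
  have "(\<integral>x. g x \<partial>\<mu>) = (\<integral>x. g x \<partial>(distr (\<mu> \<Otimes>\<^sub>M M) \<mu> (\<lambda>(x, c). x(n := c))))"
    by (simp only: distr_upd[OF n])
  also have "\<dots> = (\<integral>z. g (case z of (x, y) \<Rightarrow> x(n := y)) \<partial>(\<mu> \<Otimes>\<^sub>M M))"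
    using g by (intro integral_distr measurable_upd n) auto
  also have "\<dots> = (\<integral>x. \<integral>y. g (x(n := y)) \<partial>M \<partial>\<mu>)"
    using Q.integral_fst[OF int] by (simp add: case_prod_beta')
  finally show eq: "(\<integral>x. \<integral>c. g (x(n := c)) \<partial>M \<partial>\<mu>) = (\<integral>x. g x \<partial>\<mu>)" ..
  show "(\<integral>c. \<integral>x. g (x(n := c)) \<partial>\<mu> \<partial>M) = (\<integral>x. g x \<partial>\<mu>)"
    using Q.Fubini_integral[OF int] eq by simp
qed

lemma measurable_mix_section: "x \<in> space \<mu> \<Longrightarrow> mix A x \<in> measurable \<mu> \<mu>"
  using measurable_compose[OF measurable_Pair1' measurable_mix] by auto

lemma measurable_upd_section:
  "n \<in> {1..N} \<Longrightarrow> x \<in> space \<mu> \<Longrightarrow> (\<lambda>c. x(n := c)) \<in> measurable M \<mu>"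
  using measurable_compose[OF measurable_Pair1' measurable_upd] by auto

lemma measurable_upd_fixed:
  "n \<in> {1..N} \<Longrightarrow> c \<in> space M \<Longrightarrow> (\<lambda>x. x(n := c)) \<in> measurable \<mu> \<mu>"
  using measurable_compose[OF measurable_Pair2' measurable_upd] by auto

text \<open>The coordinates of \<open>y\<close> in \<open>A\<close> are not read by
  \<open>mix A x y\<close>, so integrating over them as well changes nothing.\<close>

lemma coordE_mix:
  assumes A: "A \<subseteq> {1..N}" and x: "x \<in> space \<mu>" and f[measurable]: "f \<in> borel_measurable \<mu>"
  shows "coordE M N A f x = (\<integral>y. f (mix A x y) \<partial>\<mu>)"
proof -
  let ?J = "{1..N} - A"
  have eq: "merge A ?J (x, y) = mix A x y" if "y \<in> space (Pi\<^sub>M ?J (\<lambda>_. M))" for y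
    using that by (auto simp: merge_def mix_def space_PiM PiE_def extensional_def fun_eq_iff)
  have r: "restrict y ?J \<in> space (Pi\<^sub>M ?J (\<lambda>_. M))" if "y \<in> space \<mu>" for y
    using that by (auto simp: space_PiM)
  have eq': "mix A x (restrict y ?J) = mix A x y" if "y \<in> space \<mu>" for y
    using that by (auto simp: mix_def space_PiM PiE_def extensional_def fun_eq_iff)
  have meas: "mix A x \<in> measurable (Pi\<^sub>M ?J (\<lambda>_. M)) \<mu>"
  proof (rule measurable_PiM_single')
    show "(\<lambda>y. mix A x y i) \<in> measurable (Pi\<^sub>M ?J (\<lambda>_. M)) M" if "i \<in> {1..N}" for i
      using that coord_in_space[OF x that] by (cases "i \<in> A") (auto simp: mix_def)
    show "mix A x \<in> space (Pi\<^sub>M ?J (\<lambda>_. M)) \<rightarrow> {1..N} \<rightarrow>\<^sub>E space M"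
      using x A by (auto simp: mix_def space_PiM PiE_def Pi_def extensional_def)
  qed
  have "coordE M N A f x = (\<integral>y. f (mix A x y) \<partial>(Pi\<^sub>M ?J (\<lambda>_. M)))"
    unfolding coordE_def by (intro Bochner_Integration.integral_cong refl) (simp add: eq)
  also have "\<dots> = (\<integral>y. f (mix A x y) \<partial>(distr \<mu> (Pi\<^sub>M ?J (\<lambda>_. M)) (\<lambda>y. restrict y ?J)))"
    using PS.distr_restrict[of ?J "{1..N}"] by simp
  also have "\<dots> = (\<integral>y. f (mix A x (restrict y ?J)) \<partial>\<mu>)"
    by (intro integral_distr measurable_restrict_subset measurable_compose[OF meas] f) auto
  also have "\<dots> = (\<integral>y. f (mix A x y) \<partial>\<mu>)"
    by (intro Bochner_Integration.integral_cong refl) (simp add: eq')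
  finally show ?thesis .
qed

lemma borel_measurable_coordE:
  assumes A: "A \<subseteq> {1..N}" and f[measurable]: "f \<in> borel_measurable \<mu>"
  shows "coordE M N A f \<in> borel_measurable \<mu>"
proof -
  note [measurable] = measurable_mix[of A]
  have "(\<lambda>(x, y). f (mix A x y)) = (\<lambda>z. f ((\<lambda>(x, y). mix A x y) z))" by auto
  then have "(\<lambda>(x, y). f (mix A x y)) \<in> borel_measurable (\<mu> \<Otimes>\<^sub>M \<mu>)" by simp
  then have "(\<lambda>x. \<integral>y. f (mix A x y) \<partial>\<mu>) \<in> borel_measurable \<mu>"
    by (intro PS.P.borel_measurable_lebesgue_integral)
  then show ?thesis by (subst measurable_cong[OF coordE_mix[OF A _ f]])
qed

lemma coordE_cong:
  assumes "A \<subseteq> {1..N}" "x \<in> space \<mu>" "x' \<in> space \<mu>" "\<And>i. i \<in> A \<Longrightarrow> x i = x' i"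
    "\<And>z. z \<in> space \<mu> \<Longrightarrow> f z = g z" "f \<in> borel_measurable \<mu>" "g \<in> borel_measurable \<mu>"
  shows "coordE M N A f x = coordE M N A g x'"
proof -
  have "mix A x y = mix A x' y" for y using assms by (auto simp: mix_def)
  then show ?thesis using assms
    by (simp add: coordE_mix mix_in_space cong: Bochner_Integration.integral_cong)
qed

abbreviation bm :: "((nat \<Rightarrow> 'a) \<Rightarrow> 'b::real_normed_vector) \<Rightarrow> bool" where
  "bm \<equiv> bounded_meas \<mu>"

lemma bm_upd: "bm f \<Longrightarrow> n \<in> {1..N} \<Longrightarrow> c \<in> space M \<Longrightarrow> bm (\<lambda>x. f (x(n := c)))"
  by (rule bm_compose[OF _ measurable_upd_fixed])

lemma integrable_bm:
  fixes f :: "(nat \<Rightarrow> 'a) \<Rightarrow> 'b::{banach, second_countable_topology}"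
  shows "bm f \<Longrightarrow> integrable \<mu> f"
  by (rule PS.P.integrable_bounded_meas)

lemma integrable_bm_mix:
  fixes f :: "(nat \<Rightarrow> 'a) \<Rightarrow> 'b::{banach, second_countable_topology}"
  shows "bm f \<Longrightarrow> x \<in> space \<mu> \<Longrightarrow> integrable \<mu> (\<lambda>y. f (mix A x y))"
  by (rule PS.P.integrable_bounded_meas[OF bm_compose[OF _ measurable_mix_section]])

lemma bm_upd_section:
  "bm f \<Longrightarrow> n \<in> {1..N} \<Longrightarrow> x \<in> space \<mu> \<Longrightarrow> bounded_meas M (\<lambda>c. f (x(n := c)))"
  by (rule bm_compose[OF _ measurable_upd_section])

lemma bm_coordE:
  assumes A: "A \<subseteq> {1..N}" and f: "bm f"
  shows "bm (coordE M N A f)"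
proof -
  obtain K where K: "\<And>x. x \<in> space \<mu> \<Longrightarrow> cmod (f x) \<le> K" using f by (auto simp: bounded_meas_def)
  have "cmod (coordE M N A f x) \<le> K" if x: "x \<in> space \<mu>" for x
  proof -
    have "cmod (coordE M N A f x) \<le> (\<integral>y. cmod (f (mix A x y)) \<partial>\<mu>)"
      unfolding coordE_mix[OF A x bm_measurable[OF f]] by (rule integral_norm_bound)
    also have "\<dots> \<le> (\<integral>y. K \<partial>\<mu>)"
      using integrable_bm_mix[OF f x] by (intro integral_mono) (auto simp: K mix_in_space x)
    finally show ?thesis by (simp add: PS.P.prob_space)
  qed
  then show ?thesis using borel_measurable_coordE[OF A bm_measurable[OF f]] by (auto simp: bounded_meas_def)
qed

lemma coordE_diff:
  "A \<subseteq> {1..N} \<Longrightarrow> bm f \<Longrightarrow> bm g \<Longrightarrow> x \<in> space \<mu> \<Longrightarrow>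
    coordE M N A (\<lambda>x. f x - g x) x = coordE M N A f x - coordE M N A g x"
  by (simp add: coordE_mix bm_measurable bm_diff integrable_bm_mix)

lemma coordE_cmult:
  "A \<subseteq> {1..N} \<Longrightarrow> bm f \<Longrightarrow> x \<in> space \<mu> \<Longrightarrow>
    coordE M N A (\<lambda>x. c * f x) x = c * coordE M N A f x"
  by (simp add: coordE_mix bm_measurable bm_cmult)

lemma coordE_sum:
  "A \<subseteq> {1..N} \<Longrightarrow> (\<And>i. i \<in> S \<Longrightarrow> bm (f i)) \<Longrightarrow> x \<in> space \<mu> \<Longrightarrow>
    coordE M N A (\<lambda>x. \<Sum>i\<in>S. f i x) x = (\<Sum>i\<in>S. coordE M N A (f i) x)"
  by (subst coordE_mix, simp_all add: coordE_mix bm_measurable bm_sum integrable_bm_mix)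

lemma coordE_full:
  assumes "bm f" "x \<in> space \<mu>" "{1..N} \<subseteq> A" "A \<subseteq> {1..N}"
  shows "coordE M N A f x = f x"
proof -
  have "mix A x y = x" if "y \<in> space \<mu>" for y
    using assms that by (force simp: mix_def space_PiM PiE_def extensional_def fun_eq_iff)
  then have "(\<integral>y. f (mix A x y) \<partial>\<mu>) = (\<integral>y. f x \<partial>\<mu>)"
    by (intro Bochner_Integration.integral_cong) auto
  then have "coordE M N A f x = (\<integral>y. f x \<partial>\<mu>)"
    using assms by (simp only: coordE_mix bm_measurable)
  then show ?thesis by (simp add: PS.P.prob_space)
qed

text \<open>Mixing twice is one mix along \<open>A \<inter> B\<close> whose second point is itself a
  mix of independent points, hence again distributed by \<open>\<mu>\<close>.\<close>

lemma coordE_coordE: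
  assumes AB: "A \<subseteq> {1..N}" "B \<subseteq> {1..N}" and f: "bm f" and x: "x \<in> space \<mu>"
  shows "coordE M N A (coordE M N B f) x = coordE M N (A \<inter> B) f x"
proof -
  have mm: "mix B (mix A x y) z = mix (A \<inter> B) x (mix B y z)" for y z
    by (auto simp: mix_def)
  have "coordE M N A (coordE M N B f) x = (\<integral>y. coordE M N B f (mix A x y) \<partial>\<mu>)"
    by (intro coordE_mix AB x bm_measurable bm_coordE f)
  also have "\<dots> = (\<integral>y. \<integral>z. f (mix (A \<inter> B) x (mix B y z)) \<partial>\<mu> \<partial>\<mu>)"
    using AB f x by (intro Bochner_Integration.integral_cong refl)
      (simp add: coordE_mix bm_measurable mix_in_space mm)
  also have "\<dots> = (\<integral>y. f (mix (A \<inter> B) x y) \<partial>\<mu>)"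
    by (rule integral_mix) (rule integrable_bm_mix[OF f x])
  also have "\<dots> = coordE M N (A \<inter> B) f x"
    using AB x f by (subst coordE_mix) (auto simp: bm_measurable)
  finally show ?thesis .
qed

text \<open>A frozen coordinate counts as known, whether or not it lies in \<open>A\<close>. In this
  way operators applied to a decoupled difference become operators applied to
  \<open>f\<close>.\<close>

lemma coordE_upd:
  assumes A: "A \<subseteq> {1..N}" and n: "n \<in> {1..N}" and c: "c \<in> space M" and f: "bm f"
    and x: "x \<in> space \<mu>"
  shows "coordE M N A (\<lambda>x. f (x(n := c))) x = coordE M N (insert n A) f (x(n := c))"
proof -
  have mm: "(mix A x y)(n := c) = mix (insert n A) (x(n := c)) y" for y
    by (auto simp: mix_def)
  show ?thesis using assms
    by (simp add: coordE_mix bm_measurable[OF bm_upd] bm_measurable upd_in_space mm del: fun_upd_apply)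
qed

lemma integral_coordE_upd:
  assumes n: "n \<in> {1..N}" and f: "bm f" and x: "x \<in> space \<mu>"
  shows "(\<integral>c. coordE M N {1..n} f (x(n := c)) \<partial>M) = coordE M N {1..<n} f x"
proof -
  have mm: "mix {1..n} (x(n := c)) y = mix {1..<n} x (y(n := c))" for y c
    using n by (auto simp: mix_def)
  have "(\<integral>c. coordE M N {1..n} f (x(n := c)) \<partial>M) = (\<integral>c. \<integral>y. f (mix {1..<n} x (y(n := c))) \<partial>\<mu> \<partial>M)"
    using n f x by (intro Bochner_Integration.integral_cong refl)
      (subst coordE_mix; simp add: bm_measurable upd_in_space mm del: fun_upd_apply)
  also have "\<dots> = (\<integral>y. f (mix {1..<n} x y) \<partial>\<mu>)"
    by (rule integral_upd[OF integrable_bm_mix[OF f x] n])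
  also have "\<dots> = coordE M N {1..<n} f x"
    using n x f by (subst coordE_mix) (auto simp: bm_measurable)
  finally show ?thesis .
qed

end

subsection \<open>Decoupling\<close>

lemma sqrt_sum_le_sum_quotients:
  fixes t :: "nat \<Rightarrow> real"
  assumes "\<And>n. 0 \<le> t n"
  shows "sqrt (\<Sum>k\<le>N. t k) \<le> (\<Sum>n\<le>N. t n / sqrt (\<Sum>k\<le>n. t k))"
proof (induction N)
  case 0
  then show ?case using sqrt_increment_le_quotient[of 0 "t 0"] assms by simp
next
  case (Suc N)
  show ?case
    using Suc sqrt_increment_le_quotient[of "\<Sum>k\<le>N. t k" "t (Suc N)"] assms
    by (simp add: sum_nonneg)
qed

lemma sum_quotients_le_sqrt_sum:
  fixes t :: "nat \<Rightarrow> real"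
  assumes "\<And>n. 0 \<le> t n"
  shows "(\<Sum>n\<le>N. t n / sqrt (\<Sum>k\<le>n. t k)) \<le> 2 * sqrt (\<Sum>k\<le>N. t k)"
proof (induction N)
  case 0
  then show ?case using quotient_le_sqrt_increment[of 0 "t 0"] assms by simp
next
  case (Suc N)
  show ?case
    using Suc quotient_le_sqrt_increment[of "\<Sum>k\<le>N. t k" "t (Suc N)"] assms
    by (simp add: sum_nonneg algebra_simps)
qed

text \<open>Exchangeable increments: weighting by the inverse root of the common partial sums
  makes both processes contribute equally.\<close>

lemma nn_integral_sqrt_sum_exchange:
  fixes a b :: "nat \<Rightarrow> 'b \<Rightarrow> real"
  assumes meas[measurable]: "\<And>n. n \<le> N \<Longrightarrow> a n \<in> borel_measurable P" "\<And>n. n \<le> N \<Longrightarrow> b n \<in> borel_measurable P"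
    and nn: "\<And>n z. 0 \<le> a n z" "\<And>n z. 0 \<le> b n z"
    and ex: "\<And>n. n \<le> N \<Longrightarrow>
      (\<integral>\<^sup>+z. ennreal (a n z / sqrt (\<Sum>k\<le>n. a k z + b k z)) \<partial>P) =
      (\<integral>\<^sup>+z. ennreal (b n z / sqrt (\<Sum>k\<le>n. a k z + b k z)) \<partial>P)"
  shows "(\<integral>\<^sup>+z. ennreal (sqrt (\<Sum>k\<le>N. a k z)) \<partial>P) \<le> 4 * (\<integral>\<^sup>+z. ennreal (sqrt (\<Sum>k\<le>N. b k z)) \<partial>P)"
proof -
  define T where "T n z = sqrt (\<Sum>k\<le>n. a k z + b k z)" for n z
  have T0: "0 \<le> T n z" for n z unfolding T_def by (simp add: sum_nonneg nn)
  have Tm[measurable]: "T n \<in> borel_measurable P" if "n \<le> N" for n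
    unfolding T_def using that
    by (intro measurable_compose[OF _ borel_measurable_sqrt] borel_measurable_sum borel_measurable_add meas) auto
  have "sqrt (\<Sum>k\<le>N. a k z) \<le> (\<Sum>n\<le>N. a n z / T n z) + (\<Sum>n\<le>N. b n z / T n z)" for z
  proof -
    have "sqrt (\<Sum>k\<le>N. a k z) \<le> T N z" unfolding T_def
      by (intro real_sqrt_le_mono sum_mono) (simp add: nn)
    also have "\<dots> \<le> (\<Sum>n\<le>N. (a n z + b n z) / T n z)"
      unfolding T_def by (intro sqrt_sum_le_sum_quotients add_nonneg_nonneg nn)
    finally show ?thesis by (simp add: add_divide_distrib sum.distrib)
  qed
  then have "(\<integral>\<^sup>+z. ennreal (sqrt (\<Sum>k\<le>N. a k z)) \<partial>P)
     \<le> (\<integral>\<^sup>+z. (\<Sum>n\<le>N. ennreal (a n z / T n z)) + (\<Sum>n\<le>N. ennreal (b n z / T n z)) \<partial>P)"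
    by (intro nn_integral_mono)
       (simp add: sum_ennreal ennreal_plus[symmetric] sum_nonneg nn T0 ennreal_leI del: ennreal_plus)
  also have "\<dots> = (\<Sum>n\<le>N. \<integral>\<^sup>+z. ennreal (a n z / T n z) \<partial>P) + (\<Sum>n\<le>N. \<integral>\<^sup>+z. ennreal (b n z / T n z) \<partial>P)"
    by (subst nn_integral_add; (subst nn_integral_sum)?; (subst nn_integral_sum)?) (auto intro!: borel_measurable_sum)
  \<comment> \<open>The hypothesis trades the sum over \<open>a\<close> for a second copy of the sum
    over \<open>b\<close>. This factor 2 and the factor 2 of
    \<open>sum_quotients_le_sqrt_sum\<close> make the constant 4.\<close>
  also have "\<dots> = 2 * (\<Sum>n\<le>N. \<integral>\<^sup>+z. ennreal (b n z / T n z) \<partial>P)"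
    using ex by (simp add: T_def mult_2)
  also have "\<dots> = 2 * (\<integral>\<^sup>+z. ennreal (\<Sum>n\<le>N. b n z / T n z) \<partial>P)"
    by (subst nn_integral_sum[symmetric]) (auto simp: sum_ennreal nn T0)
  also have "\<dots> \<le> 2 * (\<integral>\<^sup>+z. ennreal (2 * sqrt (\<Sum>k\<le>N. b k z)) \<partial>P)"
  proof (intro mult_left_mono nn_integral_mono ennreal_leI)
    fix z
    \<comment> \<open>Dropping the \<open>a\<close> part shrinks the denominator; what remains
      involves \<open>b\<close> alone and telescopes.\<close>
    have "(\<Sum>n\<le>N. b n z / T n z) \<le> (\<Sum>n\<le>N. b n z / sqrt (\<Sum>k\<le>n. b k z))"
    proof (intro sum_mono)
      fix n
      show "b n z / T n z \<le> b n z / sqrt (\<Sum>k\<le>n. b k z)"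
      proof (cases "b n z = 0")
        case False
        then have "0 < b n z" using nn(2)[of n z] by linarith
        also have "\<dots> \<le> (\<Sum>k\<le>n. b k z)" by (intro member_le_sum) (auto simp: nn)
        finally have p: "0 < sqrt (\<Sum>k\<le>n. b k z)" by simp
        have "sqrt (\<Sum>k\<le>n. b k z) \<le> T n z" unfolding T_def
          by (intro real_sqrt_le_mono sum_mono) (simp add: nn)
        then show ?thesis using nn p less_le_trans[OF p \<open>sqrt (\<Sum>k\<le>n. b k z) \<le> T n z\<close>]
            by (intro divide_left_mono mult_pos_pos)
      qed simp
    qed
    also have "\<dots> \<le> 2 * sqrt (\<Sum>k\<le>N. b k z)" by (rule sum_quotients_le_sqrt_sum) (rule nn)
    finally show "(\<Sum>n\<le>N. b n z / T n z) \<le> 2 * sqrt (\<Sum>k\<le>N. b k z)" .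
  qed auto
  also have "\<dots> = 2 * (2 * (\<integral>\<^sup>+z. ennreal (sqrt (\<Sum>k\<le>N. b k z)) \<partial>P))"
    by (subst nn_integral_cmult[symmetric]) (auto simp: ennreal_mult' )
  finally show ?thesis by (simp add: mult.assoc[symmetric])
qed

context coordinate_space
begin

text \<open>Replacing the \<open>n\<close>-th coordinates of both points by fresh variables moves
  them innermost, where Fubini can interchange them.\<close>

lemma nn_integral_resample_pair:
  assumes F[measurable]: "F \<in> borel_measurable (\<mu> \<Otimes>\<^sub>M \<mu>)" and n: "n \<in> {1..N}"
  shows "(\<integral>\<^sup>+y. \<integral>\<^sup>+x. F (y, x) \<partial>\<mu> \<partial>\<mu>) =
    (\<integral>\<^sup>+y. \<integral>\<^sup>+x. \<integral>\<^sup>+d. \<integral>\<^sup>+c. F (y(n := d), x(n := c)) \<partial>M \<partial>M \<partial>\<mu> \<partial>\<mu>)"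
proof -
  interpret Q: pair_prob_space \<mu> M ..
  note [measurable] = measurable_upd[OF n]
  have upd[measurable (raw)]: "(\<lambda>z. (p z)(n := q z)) \<in> measurable R \<mu>"
    if "p \<in> measurable R \<mu>" "q \<in> measurable R M" for p q and R :: "'c measure"
    using measurable_compose[OF measurable_Pair[OF that] measurable_upd[OF n]] by simp
  have "(\<integral>\<^sup>+y. \<integral>\<^sup>+x. F (y, x) \<partial>\<mu> \<partial>\<mu>) = (\<integral>\<^sup>+y. \<integral>\<^sup>+d. \<integral>\<^sup>+x. F (y(n := d), x) \<partial>\<mu> \<partial>M \<partial>\<mu>)"
    by (rule nn_integral_upd[OF _ n, symmetric]) measurable
  also have "\<dots> = (\<integral>\<^sup>+y. \<integral>\<^sup>+d. \<integral>\<^sup>+x. \<integral>\<^sup>+c. F (y(n := d), x(n := c)) \<partial>M \<partial>\<mu> \<partial>M \<partial>\<mu>)"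
    by (intro nn_integral_cong nn_integral_upd[OF _ n, symmetric] measurable_Pair_compose_split[of "curry F", simplified]
         measurable_compose[OF measurable_Pair1' F] upd_in_space n)
  also have "\<dots> = (\<integral>\<^sup>+y. \<integral>\<^sup>+x. \<integral>\<^sup>+d. \<integral>\<^sup>+c. F (y(n := d), x(n := c)) \<partial>M \<partial>M \<partial>\<mu> \<partial>\<mu>)"
    by (intro nn_integral_cong Q.Fubini') measurable
  finally show ?thesis .
qed

lemma nn_integral_swap_coordinate:
  assumes F[measurable]: "F \<in> borel_measurable (\<mu> \<Otimes>\<^sub>M \<mu>)" and n: "n \<in> {1..N}"
  shows "(\<integral>\<^sup>+y. \<integral>\<^sup>+x. F (y(n := x n), x(n := y n)) \<partial>\<mu> \<partial>\<mu>) = (\<integral>\<^sup>+y. \<integral>\<^sup>+x. F (y, x) \<partial>\<mu> \<partial>\<mu>)"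
proof -
  interpret Q: pair_prob_space M M ..
  have upd[measurable (raw)]: "(\<lambda>z. (p z)(n := q z)) \<in> measurable R \<mu>"
    if "p \<in> measurable R \<mu>" "q \<in> measurable R M" for p q and R :: "'c measure"
    using measurable_compose[OF measurable_Pair[OF that] measurable_upd[OF n]] by simp
  have [measurable]: "(\<lambda>x. x n) \<in> measurable \<mu> M" using n by simp
  have "(\<lambda>(y, x). F (y(n := x n), x(n := y n))) \<in> borel_measurable (\<mu> \<Otimes>\<^sub>M \<mu>)" by measurable
  from nn_integral_resample_pair[OF this n]
  have "(\<integral>\<^sup>+y. \<integral>\<^sup>+x. F (y(n := x n), x(n := y n)) \<partial>\<mu> \<partial>\<mu>)
     = (\<integral>\<^sup>+y. \<integral>\<^sup>+x. \<integral>\<^sup>+d. \<integral>\<^sup>+c. F (y(n := c), x(n := d)) \<partial>M \<partial>M \<partial>\<mu> \<partial>\<mu>)" by simp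
  also have "\<dots> = (\<integral>\<^sup>+y. \<integral>\<^sup>+x. \<integral>\<^sup>+c. \<integral>\<^sup>+d. F (y(n := c), x(n := d)) \<partial>M \<partial>M \<partial>\<mu> \<partial>\<mu>)"
    by (intro nn_integral_cong Q.Fubini') measurable
  also have "\<dots> = (\<integral>\<^sup>+y. \<integral>\<^sup>+x. F (y, x) \<partial>\<mu> \<partial>\<mu>)"
    by (rule nn_integral_resample_pair[OF F n, symmetric])
  finally show ?thesis .
qed

text \<open>Exchanging \<open>x n\<close> and \<open>y n\<close> preserves the joint law and
  interchanges the \<open>n\<close>-th terms of the two sums. The earlier terms read only
  coordinates below \<open>n\<close> of either point, so the common partial sum up to
  \<open>n\<close> is invariant. This is the exchangeability that the comparison asks for, and by
  symmetry it works in both directions.\<close>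

lemma decoupling:
  fixes v :: "nat \<Rightarrow> (nat \<Rightarrow> 'a) \<Rightarrow> real"
  assumes meas: "\<And>n. n \<le> N \<Longrightarrow> v n \<in> borel_measurable \<mu>"
    and nonneg: "\<And>n x. 0 \<le> v n x"
    and dep: "\<And>n x x'. n \<le> N \<Longrightarrow> x \<in> space \<mu> \<Longrightarrow> x' \<in> space \<mu> \<Longrightarrow>
      (\<And>i. i \<in> {1..n} \<Longrightarrow> x i = x' i) \<Longrightarrow> v n x = v n x'"
  shows "(\<integral>\<^sup>+x. ennreal (sqrt (\<Sum>n\<le>N. v n x)) \<partial>\<mu>) \<le>
      4 * (\<integral>\<^sup>+y. \<integral>\<^sup>+x. ennreal (sqrt (\<Sum>n\<le>N. v n (x(n := y n)))) \<partial>\<mu> \<partial>\<mu>)"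
    and "(\<integral>\<^sup>+y. \<integral>\<^sup>+x. ennreal (sqrt (\<Sum>n\<le>N. v n (x(n := y n)))) \<partial>\<mu> \<partial>\<mu>) \<le>
      4 * (\<integral>\<^sup>+x. ennreal (sqrt (\<Sum>n\<le>N. v n x)) \<partial>\<mu>)"
proof -
  define a where "a n z = v n (snd z)" for n and z :: "(nat \<Rightarrow> 'a) \<times> (nat \<Rightarrow> 'a)"
  define b where "b n z = v n ((snd z)(n := fst z n))" for n and z :: "(nat \<Rightarrow> 'a) \<times> (nat \<Rightarrow> 'a)"
  have a[measurable]: "a n \<in> borel_measurable (\<mu> \<Otimes>\<^sub>M \<mu>)" if "n \<le> N" for n
    unfolding a_def using measurable_compose[OF measurable_snd meas[OF that]] .
  have "(\<lambda>z. (snd z)(n := fst z n)) \<in> measurable (\<mu> \<Otimes>\<^sub>M \<mu>) \<mu>" for n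
    using measurable_compose[OF measurable_Pair[OF measurable_snd measurable_fst] measurable_upd_coord[of n]]
    by simp
  then have b[measurable]: "b n \<in> borel_measurable (\<mu> \<Otimes>\<^sub>M \<mu>)" if "n \<le> N" for n
    unfolding b_def using measurable_compose[OF _ meas[OF that]] by blast
  define T where "T n z = (\<Sum>k\<le>n. a k z + b k z)" for n z
  have T[measurable]: "T n \<in> borel_measurable (\<mu> \<Otimes>\<^sub>M \<mu>)" if "n \<le> N" for n
    unfolding T_def using that by (intro borel_measurable_sum borel_measurable_add a b) auto
  have ex: "(\<integral>\<^sup>+z. ennreal (a n z / sqrt (T n z)) \<partial>(\<mu> \<Otimes>\<^sub>M \<mu>)) =
      (\<integral>\<^sup>+z. ennreal (b n z / sqrt (T n z)) \<partial>(\<mu> \<Otimes>\<^sub>M \<mu>))" if nN: "n \<le> N" for n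
  proof (cases "n = 0")
    case True
    then show ?thesis
      by (intro nn_integral_cong) (auto simp: a_def b_def space_pair_measure upd_zero simp del: fun_upd_apply)
  next
    case False
    then have n: "n \<in> {1..N}" using nN by auto
    have sw: "a n (y(n := x n), x(n := y n)) = b n (y, x)" "T n (y(n := x n), x(n := y n)) = T n (y, x)"
      if xy: "x \<in> space \<mu>" "y \<in> space \<mu>" for x y
    proof -
      let ?y = "y(n := x n)" and ?x = "x(n := y n)"
      have sp: "?y \<in> space \<mu>" "?x \<in> space \<mu>" using xy upd_coord_in_space by auto
      show an: "a n (?y, ?x) = b n (y, x)" by (simp add: a_def b_def)
      have bn: "b n (?y, ?x) = a n (y, x)" by (simp add: a_def b_def)
      have "a k (?y, ?x) = a k (y, x)" "b k (?y, ?x) = b k (y, x)" if k: "k < n" for k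
      proof -
        show "a k (?y, ?x) = a k (y, x)" unfolding a_def snd_conv using k nN sp xy
          by (intro dep) auto
        show "b k (?y, ?x) = b k (y, x)" unfolding b_def snd_conv fst_conv using k nN sp xy upd_coord_in_space
          by (intro dep) auto
      qed
      then have "(\<Sum>k<n. a k (?y, ?x) + b k (?y, ?x)) = (\<Sum>k<n. a k (y, x) + b k (y, x))" by simp
      then show "T n (?y, ?x) = T n (y, x)"
        unfolding T_def lessThan_Suc_atMost[symmetric] using an bn by simp
    qed
    have "(\<integral>\<^sup>+z. ennreal (a n z / sqrt (T n z)) \<partial>(\<mu> \<Otimes>\<^sub>M \<mu>)) =
      (\<integral>\<^sup>+y. \<integral>\<^sup>+x. ennreal (a n (y, x) / sqrt (T n (y, x))) \<partial>\<mu> \<partial>\<mu>)"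
      using nN by (subst PS.P.nn_integral_fst[symmetric]) auto
    also have "\<dots> = (\<integral>\<^sup>+y. \<integral>\<^sup>+x. ennreal (a n (y(n := x n), x(n := y n)) / sqrt (T n (y(n := x n), x(n := y n)))) \<partial>\<mu> \<partial>\<mu>)"
      using nN n by (intro nn_integral_swap_coordinate[symmetric, of "\<lambda>z. ennreal (a n z / sqrt (T n z))"]) auto
    also have "\<dots> = (\<integral>\<^sup>+y. \<integral>\<^sup>+x. ennreal (b n (y, x) / sqrt (T n (y, x))) \<partial>\<mu> \<partial>\<mu>)"
      by (intro nn_integral_cong) (simp add: sw)
    also have "\<dots> = (\<integral>\<^sup>+z. ennreal (b n z / sqrt (T n z)) \<partial>(\<mu> \<Otimes>\<^sub>M \<mu>))"
      using nN by (subst PS.P.nn_integral_fst[symmetric]) auto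
    finally show ?thesis .
  qed
  have nn: "0 \<le> a n z" "0 \<le> b n z" for n z by (simp_all add: a_def b_def nonneg)
  have A: "(\<integral>\<^sup>+z. ennreal (sqrt (\<Sum>k\<le>N. a k z)) \<partial>(\<mu> \<Otimes>\<^sub>M \<mu>)) = (\<integral>\<^sup>+x. ennreal (sqrt (\<Sum>n\<le>N. v n x)) \<partial>\<mu>)"
  proof -
    have "(\<lambda>z. ennreal (sqrt (\<Sum>k\<le>N. a k z))) \<in> borel_measurable (\<mu> \<Otimes>\<^sub>M \<mu>)" by measurable
    from PS.P.nn_integral_fst[OF this, symmetric] show ?thesis by (simp add: a_def PS.P.emeasure_space_1)
  qed
  have B: "(\<integral>\<^sup>+z. ennreal (sqrt (\<Sum>k\<le>N. b k z)) \<partial>(\<mu> \<Otimes>\<^sub>M \<mu>)) =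
      (\<integral>\<^sup>+y. \<integral>\<^sup>+x. ennreal (sqrt (\<Sum>n\<le>N. v n (x(n := y n)))) \<partial>\<mu> \<partial>\<mu>)"
  proof -
    have "(\<lambda>z. ennreal (sqrt (\<Sum>k\<le>N. b k z))) \<in> borel_measurable (\<mu> \<Otimes>\<^sub>M \<mu>)" by measurable
    from PS.P.nn_integral_fst[OF this, symmetric] show ?thesis by (simp add: b_def)
  qed
  show "(\<integral>\<^sup>+x. ennreal (sqrt (\<Sum>n\<le>N. v n x)) \<partial>\<mu>) \<le>
      4 * (\<integral>\<^sup>+y. \<integral>\<^sup>+x. ennreal (sqrt (\<Sum>n\<le>N. v n (x(n := y n)))) \<partial>\<mu> \<partial>\<mu>)"
    using nn_integral_sqrt_sum_exchange[of N a "\<mu> \<Otimes>\<^sub>M \<mu>" b, OF a b nn ex[unfolded T_def]] A B by simp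
  show "(\<integral>\<^sup>+y. \<integral>\<^sup>+x. ennreal (sqrt (\<Sum>n\<le>N. v n (x(n := y n)))) \<partial>\<mu> \<partial>\<mu>) \<le>
      4 * (\<integral>\<^sup>+x. ennreal (sqrt (\<Sum>n\<le>N. v n x)) \<partial>\<mu>)"
    using nn_integral_sqrt_sum_exchange[of N b "\<mu> \<Otimes>\<^sub>M \<mu>" a, OF b a nn(2,1)] ex A B
    by (simp add: T_def add.commute)
qed

end

subsection \<open>Square functions and their recursion\<close>

text \<open>Pairing each \<open>B\<close> that omits \<open>n\<close> with \<open>insert n B\<close>
  exhibits the alternating sum as an iterated difference, with the direction \<open>n\<close> taken
  first.\<close>

lemma sum_Pow_insert_alternating:
  fixes g :: "'b set \<Rightarrow> 'c::comm_ring_1"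
  assumes A: "finite A" "n \<notin> A"
  shows "(\<Sum>B\<in>Pow (insert n A). (-1) ^ card (insert n A - B) * g B) =
    (\<Sum>B\<in>Pow A. (-1) ^ card (A - B) * (g (insert n B) - g B))"
proof -
  have inj: "inj_on (insert n) (Pow A)" using A by (auto simp: inj_on_def)
  have "(\<Sum>B\<in>Pow (insert n A). (-1) ^ card (insert n A - B) * g B) =
     (\<Sum>B\<in>Pow A. (-1) ^ card (insert n A - B) * g B) +
     (\<Sum>B\<in>insert n ` Pow A. (-1) ^ card (insert n A - B) * g B)"
    unfolding Pow_insert using A by (intro sum.union_disjoint) auto
  also have "(\<Sum>B\<in>insert n ` Pow A. (-1) ^ card (insert n A - B) * g B) =
      (\<Sum>B\<in>Pow A. (-1) ^ card (A - B) * g (insert n B))"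
    unfolding sum.reindex[OF inj] using A
    by (intro sum.cong refl) (auto simp: Diff_insert2[symmetric] insert_Diff_if intro!: arg_cong[where f = card])
  also have "(\<Sum>B\<in>Pow A. (-1) ^ card (insert n A - B) * g B) =
      (\<Sum>B\<in>Pow A. - ((-1) ^ card (A - B) * g B))"
  proof (intro sum.cong refl)
    fix B assume "B \<in> Pow A"
    then have "insert n A - B = insert n (A - B)" "n \<notin> A - B" using A by auto
    then show "(-1) ^ card (insert n A - B) * g B = - ((-1) ^ card (A - B) * g B)"
      using A by simp
  qed
  finally show ?thesis
    by (simp add: algebra_simps sum.distrib sum_subtractf sum_negf)
qed

lemma sum_Pow_alternating_eq_0:
  fixes g :: "'b set \<Rightarrow> 'c::comm_ring_1"
  assumes "finite A" "a \<in> A" "\<And>B. B \<subseteq> A - {a} \<Longrightarrow> g (insert a B) = g B"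
  shows "(\<Sum>B\<in>Pow A. (-1) ^ card (A - B) * g B) = 0"
  using sum_Pow_insert_alternating[of "A - {a}" a g] assms by (simp add: insert_absorb)

text \<open>The maximum is the index to remove: what is left lies in \<open>{1..<n}\<close>, and the
  minimum is affected only when nothing is left. The empty set stands apart, corresponding to index
  0 of the differences.\<close>

lemma sum_subsets_by_Max:
  fixes g :: "nat set \<Rightarrow> 'c::comm_monoid_add"
  shows "(\<Sum>A | A \<subseteq> {1..N} \<and> card A \<le> Suc m. g A) =
    g {} + (\<Sum>n\<in>{1..N}. \<Sum>A | A \<subseteq> {1..<n} \<and> card A \<le> m. g (insert n A))"
proof -
  let ?F = "\<lambda>n::nat. {A. A \<subseteq> {1..<n} \<and> card A \<le> m}"
  have fin: "finite (?F n)" for n by (rule finite_subset[of _ "Pow {1..<n}"]) auto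
  have mx: "Max (insert n A) = n" if "A \<subseteq> {1..<n}" for n :: nat and A
    using that finite_subset[OF that] by (intro Max_eqI) (auto simp: finite_subset)
  have "(\<Sum>n\<in>{1..N}. \<Sum>A\<in>?F n. g (insert n A)) =
      (\<Sum>(n, A)\<in>Sigma {1..N} ?F. g (insert n A))"
    using fin by (intro sum.Sigma) auto
  also have "\<dots> = (\<Sum>A\<in>{A. A \<subseteq> {1..N} \<and> card A \<le> Suc m} - {{}}. g A)"
  proof (rule sum.reindex_bij_witness[where i = "\<lambda>A. (Max A, A - {Max A})" and j = "\<lambda>(n, A). insert n A"]; clarsimp)
    fix n A assume "A \<subseteq> {1..<n}" "card A \<le> m" "1 \<le> n" "n \<le> N"
    moreover have "n \<notin> A" using \<open>A \<subseteq> {1..<n}\<close> by auto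
    ultimately show "Max (insert n A) = n \<and> insert n A - {Max (insert n A)} = A"
      by (simp add: mx)
    show "A \<subseteq> {1..N} \<and> card (insert n A) \<le> Suc m"
      using \<open>n \<notin> A\<close> \<open>A \<subseteq> {1..<n}\<close> finite_subset[OF \<open>A \<subseteq> {1..<n}\<close>] \<open>card A \<le> m\<close> \<open>n \<le> N\<close> by force
  next
    fix A assume A: "A \<subseteq> {1..N}" "card A \<le> Suc m" "A \<noteq> {}"
    have f: "finite A" using A finite_subset by blast
    have mem: "Max A \<in> A" using f A by simp
    show "insert (Max A) A = A" using mem by auto
    show "1 \<le> Max A \<and> Max A \<le> N \<and> A - {Max A} \<subseteq> {1..<Max A} \<and> card (A - {Max A}) \<le> m"
    proof (intro conjI)
      show "A - {Max A} \<subseteq> {1..<Max A}" using A f by (force simp: less_le)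
      show "1 \<le> Max A" "Max A \<le> N" using subsetD[OF A(1) mem] by auto
      show "card (A - {Max A}) \<le> m" using mem A f by simp
    qed
  qed
  finally have "(\<Sum>n\<in>{1..N}. \<Sum>A\<in>?F n. g (insert n A)) =
     (\<Sum>A\<in>{A. A \<subseteq> {1..N} \<and> card A \<le> Suc m} - {{}}. g A)" .
  moreover have "finite {A. A \<subseteq> {1..N} \<and> card A \<le> Suc m}"
    by (rule finite_subset[of _ "Pow {1..N}"]) auto
  ultimately show ?thesis by (subst sum.remove[of _ "{}"]) auto
qed

context coordinate_space
begin

text \<open>Index 0 holds the mean, so that for bounded \<open>f\<close> the differences with
  \<open>n \<le> N\<close> add up to \<open>f\<close> itself.\<close>

definition mdiff :: "nat \<Rightarrow> ((nat \<Rightarrow> 'a) \<Rightarrow> complex) \<Rightarrow> (nat \<Rightarrow> 'a) \<Rightarrow> complex" where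
  "mdiff n f x = (if n = 0 then coordE M N {} f x else coordE M N {1..n} f x - coordE M N {1..<n} f x)"

text \<open>For disjoint \<open>A\<close> and \<open>C\<close> this is \<open>id - E\<close> on the
  coordinates in \<open>A\<close>, the identity on those in \<open>C\<close> and the expectation on
  the rest.\<close>

definition altE :: "nat set \<Rightarrow> nat set \<Rightarrow> ((nat \<Rightarrow> 'a) \<Rightarrow> complex) \<Rightarrow> (nat \<Rightarrow> 'a) \<Rightarrow> complex" where
  "altE C A f x = (\<Sum>B\<in>Pow A. (-1) ^ card (A - B) * coordE M N (B \<union> C) f x)"

text \<open>The switch \<open>b\<close> selects between the operators \<open>Delta\<close> (true) and \<open>projP\<close> (false);
  for \<open>m = 0\<close> and \<open>A = \<emptyset>\<close> the former is the identity.\<close>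

definition free_coords :: "bool \<Rightarrow> nat \<Rightarrow> nat set \<Rightarrow> nat set" where
  "free_coords b m A = (if b \<and> card A = m then {j \<in> {1..N}. \<forall>a\<in>A. j < a} else {})"

definition sqfun :: "bool \<Rightarrow> nat \<Rightarrow> ((nat \<Rightarrow> 'a) \<Rightarrow> complex) \<Rightarrow> (nat \<Rightarrow> 'a) \<Rightarrow> real" where
  "sqfun b m f x = (\<Sum>A | A \<subseteq> {1..N} \<and> card A \<le> m. (cmod (altE (free_coords b m A) A f x))\<^sup>2)"

text \<open>The terms of order \<open>Suc m\<close> whose largest index is \<open>n\<close>. The
  bound \<open>card A \<le> m\<close> counts only the elements below \<open>n\<close>, which is why
  the order shifts by one.\<close>

definition sqfun_part :: "bool \<Rightarrow> nat \<Rightarrow> nat \<Rightarrow> ((nat \<Rightarrow> 'a) \<Rightarrow> complex) \<Rightarrow> (nat \<Rightarrow> 'a) \<Rightarrow> real" where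
  "sqfun_part b m n f x = (if n = 0 then (cmod (coordE M N {} f x))\<^sup>2
     else (\<Sum>A | A \<subseteq> {1..<n} \<and> card A \<le> m.
       (cmod (altE (free_coords b (Suc m) (insert n A)) (insert n A) f x))\<^sup>2))"

lemma sqfun_Suc: "sqfun b (Suc m) f x = (\<Sum>n\<le>N. sqfun_part b m n f x)"
proof -
  have "sqfun b (Suc m) f x = (cmod (altE (free_coords b (Suc m) {}) {} f x))\<^sup>2 +
     (\<Sum>n\<in>{1..N}. sqfun_part b m n f x)"
    unfolding sqfun_def sum_subsets_by_Max by (intro arg_cong2[where f = "(+)"] sum.cong) (auto simp: sqfun_part_def)
  also have "(cmod (altE (free_coords b (Suc m) {}) {} f x))\<^sup>2 = sqfun_part b m 0 f x"
    by (simp add: free_coords_def altE_def sqfun_part_def)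
  also have "\<dots> + (\<Sum>n\<in>{1..N}. sqfun_part b m n f x) = (\<Sum>n\<in>insert 0 {1..N}. sqfun_part b m n f x)"
    by simp
  also have "insert 0 {1..N} = {..N}" by auto
  finally show ?thesis .
qed

lemma free_coords_subset: "free_coords b m A \<subseteq> {1..N}"
  by (auto simp: free_coords_def)

text \<open>For \<open>m = 0\<close> and \<open>A = {}\<close> all coordinates are free and those
  below \<open>n\<close> survive, which is the martingale case. For nonempty \<open>A\<close>, being
  below \<open>A\<close> already means being below \<open>n\<close>.\<close>

lemma free_coords_insert:
  assumes "n \<in> {1..N}" "A \<subseteq> {1..<n}"
  shows "free_coords b m A \<inter> {1..<n} = free_coords b (Suc m) (insert n A)"
proof -
  have "n \<notin> A" "finite A" using assms finite_subset by auto
  then have "card (insert n A) = Suc (card A)" by simp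
  then show ?thesis using assms by (cases "b \<and> card A = m") (auto simp: free_coords_def)
qed

lemma bm_mdiff: "n \<le> N \<Longrightarrow> bm f \<Longrightarrow> bm (mdiff n f)"
  unfolding mdiff_def[abs_def] by (cases "n = 0") (auto intro!: bm_diff bm_coordE)

lemma borel_measurable_altE:
  "A \<subseteq> {1..N} \<Longrightarrow> C \<subseteq> {1..N} \<Longrightarrow> bm f \<Longrightarrow> altE C A f \<in> borel_measurable \<mu>"
  unfolding altE_def[abs_def]
  by (intro borel_measurable_sum borel_measurable_times borel_measurable_const borel_measurable_coordE bm_measurable) auto

lemma coordE_mdiff_upd:
  assumes n: "n \<in> {1..N}" and c: "c \<in> space M" and B: "B \<subseteq> {1..N}" and f: "bm f" and x: "x \<in> space \<mu>"
  shows "coordE M N B (\<lambda>x. mdiff n f (x(n := c))) x =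
    coordE M N (insert n (B \<inter> {1..<n})) f (x(n := c)) - coordE M N (B \<inter> {1..<n}) f (x(n := c))"
proof -
  have sets: "insert n B \<inter> {1..n} = insert n (B \<inter> {1..<n})" "insert n B \<inter> {1..<n} = B \<inter> {1..<n}"
    using n by auto
  have s: "{1..n} \<subseteq> {1..N}" "{1..<n} \<subseteq> {1..N}" "insert n B \<subseteq> {1..N}" using n B by auto
  have x': "x(n := c) \<in> space \<mu>" using upd_in_space x c n by blast
  have "coordE M N B (\<lambda>x. mdiff n f (x(n := c))) x = coordE M N (insert n B) (mdiff n f) (x(n := c))"
    using n by (intro coordE_upd B n c x bm_mdiff f) auto
  also have "\<dots> = coordE M N (insert n B) (coordE M N {1..n} f) (x(n := c))
      - coordE M N (insert n B) (coordE M N {1..<n} f) (x(n := c))"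
  proof -
    have "mdiff n f = (\<lambda>x. coordE M N {1..n} f x - coordE M N {1..<n} f x)"
      using n by (simp add: mdiff_def fun_eq_iff)
    then show ?thesis by (simp only:) (intro coordE_diff bm_coordE s f x')
  qed
  also have "\<dots> = coordE M N (insert n (B \<inter> {1..<n})) f (x(n := c)) - coordE M N (B \<inter> {1..<n}) f (x(n := c))"
    unfolding coordE_coordE[OF s(3,1) f x'] coordE_coordE[OF s(3,2) f x'] sets ..
  finally show ?thesis .
qed

text \<open>With coordinate \<open>n\<close> frozen, \<open>mdiff n f\<close> reads only the
  coordinates below \<open>n\<close> and already carries one difference, in direction
  \<open>n\<close>; this completes \<open>A\<close> to \<open>insert n A\<close>. An element of
  \<open>A\<close> outside \<open>{1..<n}\<close> asks for a difference in a direction that is not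
  read.\<close>

lemma altE_mdiff_upd:
  assumes n: "n \<in> {1..N}" and c: "c \<in> space M" and A: "A \<subseteq> {1..N}" and C: "C \<subseteq> {1..N}"
    and f: "bm f" and x: "x \<in> space \<mu>"
  shows "altE C A (\<lambda>x. mdiff n f (x(n := c))) x =
    (if A \<subseteq> {1..<n} then altE (C \<inter> {1..<n}) (insert n A) f (x(n := c)) else 0)"
proof -
  let ?g = "\<lambda>B. coordE M N (insert n (B \<inter> {1..<n} \<union> C \<inter> {1..<n})) f (x(n := c))
      - coordE M N (B \<inter> {1..<n} \<union> C \<inter> {1..<n}) f (x(n := c))"
  have fA: "finite A" using A finite_subset by blast
  have "coordE M N (B \<union> C) (\<lambda>x. mdiff n f (x(n := c))) x = ?g B" if "B \<subseteq> A" for B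
    using that A C by (subst coordE_mdiff_upd[OF n c _ f x]) (auto simp: Int_Un_distrib2)
  then have eq: "altE C A (\<lambda>x. mdiff n f (x(n := c))) x = (\<Sum>B\<in>Pow A. (-1) ^ card (A - B) * ?g B)"
    unfolding altE_def by (intro sum.cong refl) auto
  show ?thesis
  proof (cases "A \<subseteq> {1..<n}")
    case True
    then have "n \<notin> A" by auto
    have "altE (C \<inter> {1..<n}) (insert n A) f (x(n := c)) = (\<Sum>B\<in>Pow A. (-1) ^ card (A - B) *
        (coordE M N (insert n B \<union> C \<inter> {1..<n}) f (x(n := c)) - coordE M N (B \<union> C \<inter> {1..<n}) f (x(n := c))))"
      unfolding altE_def by (rule sum_Pow_insert_alternating[OF fA \<open>n \<notin> A\<close>])
    also have "\<dots> = (\<Sum>B\<in>Pow A. (-1) ^ card (A - B) * ?g B)"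
    proof (intro sum.cong refl)
      fix B assume "B \<in> Pow A"
      then have "B \<inter> {1..<n} = B" using True by auto
      then show "(-1) ^ card (A - B) * (coordE M N (insert n B \<union> C \<inter> {1..<n}) f (x(n := c))
           - coordE M N (B \<union> C \<inter> {1..<n}) f (x(n := c))) = (-1) ^ card (A - B) * ?g B" by simp
    qed
    finally show ?thesis using True eq by simp
  next
    case False
    then obtain a where a: "a \<in> A" "a \<notin> {1..<n}" by blast
    have "(\<Sum>B\<in>Pow A. (-1) ^ card (A - B) * ?g B) = 0"
      using a by (intro sum_Pow_alternating_eq_0[OF fA a(1)]) simp
    then show ?thesis using False eq by simp
  qed
qed

lemma altE_mdiff_0:
  assumes A: "A \<subseteq> {1..N}" and C: "C \<subseteq> {1..N}" and f: "bm f" and x: "x \<in> space \<mu>"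
  shows "altE C A (mdiff 0 f) x = (if A = {} then coordE M N {} f x else 0)"
proof -
  have fA: "finite A" using A finite_subset by blast
  have "coordE M N (B \<union> C) (mdiff 0 f) x = coordE M N {} f x" if "B \<subseteq> A" for B
  proof -
    have "mdiff 0 f = coordE M N {} f" by (simp add: mdiff_def fun_eq_iff)
    moreover have "B \<union> C \<subseteq> {1..N}" using that A C by blast
    ultimately show ?thesis using coordE_coordE[of "B \<union> C" "{}" f x] f x by (simp only: empty_subsetI Int_empty_right)
  qed
  then have eq: "altE C A (mdiff 0 f) x = (\<Sum>B\<in>Pow A. (-1) ^ card (A - B) * coordE M N {} f x)"
    unfolding altE_def by (intro sum.cong refl) auto
  show ?thesis
  proof (cases "A = {}")
    case True
    then show ?thesis unfolding eq by simp
  next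
    case False
    then obtain a where "a \<in> A" by auto
    then show ?thesis using False sum_Pow_alternating_eq_0[OF fA, of a "\<lambda>_. coordE M N {} f x"] eq by simp
  qed
qed

text \<open>Because of this, square functions of order \<open>m\<close> of the decoupled family
  reassemble to that of order \<open>Suc m\<close> of the original one; every induction on the order
  rests on it.\<close>

lemma sqfun_mdiff_upd:
  assumes n: "n \<in> {1..N}" and c: "c \<in> space M" and f: "bm f" and x: "x \<in> space \<mu>"
  shows "sqfun b m (\<lambda>x. mdiff n f (x(n := c))) x = sqfun_part b m n f (x(n := c))"
proof -
  have fin: "finite {A. A \<subseteq> {1..N} \<and> card A \<le> m}" by (rule finite_subset[of _ "Pow {1..N}"]) auto
  have "sqfun b m (\<lambda>x. mdiff n f (x(n := c))) x =
    (\<Sum>A | A \<subseteq> {1..<n} \<and> card A \<le> m. (cmod (altE (free_coords b m A) A (\<lambda>x. mdiff n f (x(n := c))) x))\<^sup>2)"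
    unfolding sqfun_def using n
    by (intro sum.mono_neutral_right fin) (auto simp: altE_mdiff_upd[OF n c _ free_coords_subset f x] simp del: fun_upd_apply)
  also have "\<dots> = sqfun_part b m n f (x(n := c))"
  proof -
    have "altE (free_coords b m A) A (\<lambda>x. mdiff n f (x(n := c))) x =
        altE (free_coords b (Suc m) (insert n A)) (insert n A) f (x(n := c))" if A: "A \<subseteq> {1..<n}" for A
    proof -
      have "A \<subseteq> {1..N}" using A n by auto
      from altE_mdiff_upd[OF n c this free_coords_subset f x] show ?thesis
        using A free_coords_insert[OF n A, of b m] by (simp only: if_True)
    qed
    then show ?thesis unfolding sqfun_part_def using n by simp
  qed
  finally show ?thesis .
qed

lemma sqfun_mdiff_0:
  assumes f: "bm f" and x: "x \<in> space \<mu>"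
  shows "sqfun b m (mdiff 0 f) x = sqfun_part b m 0 f x"
proof -
  have fin: "finite {A. A \<subseteq> {1..N} \<and> card A \<le> m}" by (rule finite_subset[of _ "Pow {1..N}"]) auto
  have "sqfun b m (mdiff 0 f) x = (\<Sum>A\<in>{{}}. (cmod (altE (free_coords b m A) A (mdiff 0 f) x))\<^sup>2)"
    unfolding sqfun_def
    by (intro sum.mono_neutral_right fin) (auto simp: altE_mdiff_0[OF _ free_coords_subset f x])
  then show ?thesis by (simp add: sqfun_part_def altE_mdiff_0[OF _ free_coords_subset f x])
qed

lemma borel_measurable_sqfun_part:
  assumes "n \<le> N" and f: "bm f"
  shows "sqfun_part b m n f \<in> borel_measurable \<mu>"
proof (cases "n = 0")
  case True
  then show ?thesis unfolding sqfun_part_def[abs_def] using f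
    by (auto intro!: borel_measurable_power measurable_compose[OF _ borel_measurable_norm] borel_measurable_coordE intro: bm_measurable)
next
  case False
  then show ?thesis unfolding sqfun_part_def[abs_def] using assms
    by (auto intro!: borel_measurable_sum borel_measurable_power measurable_compose[OF _ borel_measurable_norm]
       borel_measurable_altE free_coords_subset)
qed

lemma sqfun_part_nonneg: "0 \<le> sqfun_part b m n f x"
  by (auto simp: sqfun_part_def intro!: sum_nonneg)

lemma altE_cong:
  assumes "A \<subseteq> {1..N}" "C \<subseteq> {1..N}" "x \<in> space \<mu>" "x' \<in> space \<mu>" "\<And>i. i \<in> A \<union> C \<Longrightarrow> x i = x' i"
    "f \<in> borel_measurable \<mu>" "g \<in> borel_measurable \<mu>" "\<And>z. z \<in> space \<mu> \<Longrightarrow> f z = g z"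
  shows "altE C A f x = altE C A g x'"
  unfolding altE_def using assms
  by (intro sum.cong refl arg_cong2[where f = "(*)"] coordE_cong) (auto simp: subset_iff)

text \<open>Adaptedness to the first \<open>n\<close> coordinates, the hypothesis under which
  \<open>decoupling\<close> works.\<close>

lemma sqfun_part_cong:
  assumes n: "n \<le> N" and x: "x \<in> space \<mu>" "x' \<in> space \<mu>" and eq: "\<And>i. i \<in> {1..n} \<Longrightarrow> x i = x' i" and f: "bm f"
  shows "sqfun_part b m n f x = sqfun_part b m n f x'"
proof (cases "n = 0")
  case True
  have "coordE M N {} f x = coordE M N {} f x'"
    using x by (intro coordE_cong bm_measurable f) auto
  with True show ?thesis by (simp add: sqfun_part_def)
next
  case False
  have "altE (free_coords b (Suc m) (insert n A)) (insert n A) f x = altE (free_coords b (Suc m) (insert n A)) (insert n A) f x'"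
    if "A \<subseteq> {1..<n}" for A
  proof (intro altE_cong x free_coords_subset bm_measurable f refl)
    show "insert n A \<subseteq> {1..N}" using that n False by auto
    show "x i = x' i" if "i \<in> insert n A \<union> free_coords b (Suc m) (insert n A)" for i
      using that \<open>A \<subseteq> {1..<n}\<close> False by (intro eq) (auto simp: free_coords_def split: if_splits)
  qed
  then show ?thesis using False by (simp add: sqfun_part_def)
qed

text \<open>With \<open>b\<close> true, order 0 is the L^1 norm of the l^2-valued family and order
  \<open>m\<close> its H^1 norm; with \<open>b\<close> false, order 0 sees only the means.\<close>

definition Hnorm :: "bool \<Rightarrow> nat \<Rightarrow> nat set \<Rightarrow> (nat \<Rightarrow> (nat \<Rightarrow> 'a) \<Rightarrow> complex) \<Rightarrow> ennreal" where
  "Hnorm b m I f = (\<integral>\<^sup>+x. ennreal (sqrt (\<Sum>i\<in>I. sqfun b m (f i) x)) \<partial>\<mu>)"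

text \<open>The martingale differences of a family, with the last active coordinate replaced by an
  independent copy, form a new family; pairs of indices are encoded as natural numbers.\<close>

definition dec_index :: "nat set \<Rightarrow> nat set" where
  "dec_index I = prod_encode ` ({..N} \<times> I)"

definition dec_family :: "(nat \<Rightarrow> (nat \<Rightarrow> 'a) \<Rightarrow> complex) \<Rightarrow> (nat \<Rightarrow> 'a) \<Rightarrow> nat \<Rightarrow> (nat \<Rightarrow> 'a) \<Rightarrow> complex" where
  "dec_family f y k = (case prod_decode k of (n, i) \<Rightarrow>
     if n = 0 then mdiff 0 (f i) else (\<lambda>x. mdiff n (f i) (x(n := y n))))"

lemma finite_dec_index: "finite I \<Longrightarrow> finite (dec_index I)"
  by (simp add: dec_index_def)

lemma bm_dec_family:
  assumes "\<And>i. i \<in> I \<Longrightarrow> bm (f i)" "y \<in> space \<mu>" "k \<in> dec_index I"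
  shows "bm (dec_family f y k)"
proof -
  obtain n i where k: "k = prod_encode (n, i)" "n \<le> N" "i \<in> I" using assms(3) by (auto simp: dec_index_def)
  show ?thesis
  proof (cases "n = 0")
    case True
    then show ?thesis using assms k by (simp add: dec_family_def bm_mdiff)
  next
    case False
    then show ?thesis using assms k coord_in_space[OF assms(2), of n]
      by (simp add: dec_family_def bm_mdiff bm_upd del: fun_upd_apply)
  qed
qed

lemma sum_sqfun_dec_family:
  assumes f: "\<And>i. i \<in> I \<Longrightarrow> bm (f i)" and x: "x \<in> space \<mu>" and y: "y \<in> space \<mu>"
  shows "(\<Sum>k\<in>dec_index I. sqfun b m (dec_family f y k) x) =
    (\<Sum>n\<le>N. \<Sum>i\<in>I. sqfun_part b m n (f i) (x(n := y n)))"
proof -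
  have "(\<Sum>k\<in>dec_index I. sqfun b m (dec_family f y k) x) =
     (\<Sum>(n, i)\<in>{..N} \<times> I. sqfun b m (dec_family f y (prod_encode (n, i))) x)"
    unfolding dec_index_def by (subst sum.reindex[OF inj_prod_encode]) (simp add: case_prod_beta')
  also have "\<dots> = (\<Sum>(n, i)\<in>{..N} \<times> I. sqfun_part b m n (f i) (x(n := y n)))"
  proof (intro sum.cong refl, clarsimp simp del: fun_upd_apply)
    fix n i assume ni: "n \<le> N" "i \<in> I"
    show "sqfun b m (dec_family f y (prod_encode (n, i))) x = sqfun_part b m n (f i) (x(n := y n))"
    proof (cases "n = 0")
      case True
      then show ?thesis using ni f x y by (simp add: dec_family_def sqfun_mdiff_0 upd_zero del: fun_upd_apply)
    next
      case False
      then show ?thesis using ni f x y coord_in_space[OF y, of n]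
        by (simp add: dec_family_def sqfun_mdiff_upd del: fun_upd_apply)
    qed
  qed
  finally show ?thesis by (simp add: sum.cartesian_product)
qed

definition sqfun_sum :: "bool \<Rightarrow> nat \<Rightarrow> nat set \<Rightarrow> (nat \<Rightarrow> (nat \<Rightarrow> 'a) \<Rightarrow> complex) \<Rightarrow> nat \<Rightarrow> (nat \<Rightarrow> 'a) \<Rightarrow> real" where
  "sqfun_sum b m I f n x = (\<Sum>i\<in>I. sqfun_part b m n (f i) x)"

lemma borel_measurable_sqfun_sum:
  "n \<le> N \<Longrightarrow> (\<And>i. i \<in> I \<Longrightarrow> bm (f i)) \<Longrightarrow> sqfun_sum b m I f n \<in> borel_measurable \<mu>"
  unfolding sqfun_sum_def[abs_def] by (intro borel_measurable_sum borel_measurable_sqfun_part) auto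

lemma Hnorm_dec_family:
  assumes f: "\<And>i. i \<in> I \<Longrightarrow> bm (f i)" and "y \<in> space \<mu>"
  shows "Hnorm b m (dec_index I) (dec_family f y) =
    (\<integral>\<^sup>+x. ennreal (sqrt (\<Sum>n\<le>N. sqfun_sum b m I f n (x(n := y n)))) \<partial>\<mu>)"
  unfolding Hnorm_def sqfun_sum_def using assms(2)
  by (intro nn_integral_cong) (simp only: sum_sqfun_dec_family[OF f])

lemma Hnorm_decoupling:
  assumes f: "\<And>i. i \<in> I \<Longrightarrow> bm (f i)"
  shows "Hnorm b (Suc m) I f \<le> 4 * (\<integral>\<^sup>+y. Hnorm b m (dec_index I) (dec_family f y) \<partial>\<mu>)"
    and "(\<integral>\<^sup>+y. Hnorm b m (dec_index I) (dec_family f y) \<partial>\<mu>) \<le> 4 * Hnorm b (Suc m) I f"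
proof -
  let ?v = "sqfun_sum b m I f"
  have v: "?v n \<in> borel_measurable \<mu>" if "n \<le> N" for n
    using borel_measurable_sqfun_sum[OF that] f by blast
  have v0: "0 \<le> ?v n x" for n x unfolding sqfun_sum_def by (intro sum_nonneg sqfun_part_nonneg)
  have vd: "?v n x = ?v n x'" if "n \<le> N" "x \<in> space \<mu>" "x' \<in> space \<mu>" "\<And>i. i \<in> {1..n} \<Longrightarrow> x i = x' i" for n x x'
    unfolding sqfun_sum_def using that f by (intro sum.cong refl sqfun_part_cong) auto
  have A: "Hnorm b (Suc m) I f = (\<integral>\<^sup>+x. ennreal (sqrt (\<Sum>n\<le>N. ?v n x)) \<partial>\<mu>)"
    unfolding Hnorm_def sqfun_sum_def sqfun_Suc by (subst sum.swap) simp
  have B: "(\<integral>\<^sup>+y. Hnorm b m (dec_index I) (dec_family f y) \<partial>\<mu>) =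
     (\<integral>\<^sup>+y. \<integral>\<^sup>+x. ennreal (sqrt (\<Sum>n\<le>N. ?v n (x(n := y n)))) \<partial>\<mu> \<partial>\<mu>)"
    by (intro nn_integral_cong Hnorm_dec_family f)
  show "Hnorm b (Suc m) I f \<le> 4 * (\<integral>\<^sup>+y. Hnorm b m (dec_index I) (dec_family f y) \<partial>\<mu>)"
    unfolding A B by (rule decoupling(1)[of ?v, OF v v0 vd])
  show "(\<integral>\<^sup>+y. Hnorm b m (dec_index I) (dec_family f y) \<partial>\<mu>) \<le> 4 * Hnorm b (Suc m) I f"
    unfolding A B by (rule decoupling(2)[of ?v, OF v v0 vd])
qed

lemma borel_measurable_Hnorm_dec:
  assumes f: "\<And>i. i \<in> I \<Longrightarrow> bm (f i)"
  shows "(\<lambda>y. Hnorm b m (dec_index I) (dec_family f y)) \<in> borel_measurable \<mu>"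
proof -
  let ?v = "sqfun_sum b m I f"
  have "(\<lambda>z. ?v n ((snd z)(n := fst z n))) \<in> borel_measurable (\<mu> \<Otimes>\<^sub>M \<mu>)" if "n \<le> N" for n
    using measurable_compose[OF measurable_compose[OF measurable_Pair[OF measurable_snd measurable_fst]
        measurable_upd_coord[of n]] borel_measurable_sqfun_sum[OF that f]] by simp
  then have "(\<lambda>z. ennreal (sqrt (\<Sum>n\<le>N. ?v n ((snd z)(n := fst z n))))) \<in> borel_measurable (\<mu> \<Otimes>\<^sub>M \<mu>)"
    by (intro measurable_compose[OF _ measurable_ennreal] measurable_compose[OF _ borel_measurable_sqrt]
        borel_measurable_sum) auto
  from PS.P.borel_measurable_nn_integral_fst[OF this]
  have "(\<lambda>y. \<integral>\<^sup>+x. ennreal (sqrt (\<Sum>n\<le>N. ?v n (x(n := y n)))) \<partial>\<mu>) \<in> borel_measurable \<mu>" by simp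
  then show ?thesis by (subst measurable_cong[OF Hnorm_dec_family[OF f]])
qed

end

subsection \<open>One step of a martingale\<close>

lemma bm_Re: "bounded_meas P f \<Longrightarrow> bounded_meas P (\<lambda>x. Re (f x))"
  unfolding bounded_meas_def by (auto intro: order_trans[OF abs_Re_le_cmod])

lemma bm_norm_sq:
  fixes f :: "'b \<Rightarrow> complex"
  shows "bounded_meas P f \<Longrightarrow> bounded_meas P (\<lambda>x. (cmod (f x))\<^sup>2)"
  unfolding power2_eq_square by (intro bm_mult bm_norm)

lemma sum_cmod_add_sq:
  "(\<Sum>i\<in>I. (cmod (a i + d i))\<^sup>2) =
    (\<Sum>i\<in>I. (cmod (a i))\<^sup>2) + 2 * (\<Sum>i\<in>I. Re (cnj (a i) * d i)) + (\<Sum>i\<in>I. (cmod (d i))\<^sup>2)"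
proof -
  have "(cmod (a i + d i))\<^sup>2 = (cmod (a i))\<^sup>2 + 2 * Re (cnj (a i) * d i) + (cmod (d i))\<^sup>2" for i
    unfolding cmod_power2 by (simp add: power2_eq_square algebra_simps)
  then show ?thesis by (simp add: sum.distrib sum_distrib_left)
qed

lemma norm_sum_cnj_mult_le:
  "cmod (\<Sum>i\<in>I. cnj (a i) * d i) \<le> sqrt (\<Sum>i\<in>I. (cmod (a i))\<^sup>2) * sqrt (\<Sum>i\<in>I. (cmod (d i))\<^sup>2)"
proof -
  have "cmod (\<Sum>i\<in>I. cnj (a i) * d i) \<le> (\<Sum>i\<in>I. \<bar>cmod (a i)\<bar> * \<bar>cmod (d i)\<bar>)"
    by (rule order_trans[OF norm_sum]) (simp add: norm_mult)
  also have "\<dots> \<le> L2_set (\<lambda>i. cmod (a i)) I * L2_set (\<lambda>i. cmod (d i)) I"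
    by (rule L2_set_mult_ineq)
  finally show ?thesis by (simp add: L2_set_def)
qed

lemma cross_term_le:
  "\<bar>\<Sum>i\<in>I. Re (cnj (a i) * d i)\<bar> \<le> sqrt (\<Sum>i\<in>I. (cmod (a i))\<^sup>2) * sqrt (\<Sum>i\<in>I. (cmod (d i))\<^sup>2)"
  unfolding Re_sum[symmetric] by (rule order_trans[OF abs_Re_le_cmod norm_sum_cnj_mult_le])

context prob_space
begin

lemma cross_term_mean_zero:
  fixes a :: "'i \<Rightarrow> complex" and d :: "'i \<Rightarrow> 'a \<Rightarrow> complex"
  assumes bd: "\<And>i. i \<in> I \<Longrightarrow> bounded_meas M (d i)" and mean: "\<And>i. i \<in> I \<Longrightarrow> (\<integral>c. d i c \<partial>M) = 0"
  shows "bounded_meas M (\<lambda>c. \<Sum>i\<in>I. Re (cnj (a i) * d i c))"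
    and "(\<integral>c. (\<Sum>i\<in>I. Re (cnj (a i) * d i c)) \<partial>M) = 0"
proof -
  show "bounded_meas M (\<lambda>c. \<Sum>i\<in>I. Re (cnj (a i) * d i c))" using bd by (intro bm_sum bm_Re bm_cmult)
  have "(\<integral>c. (\<Sum>i\<in>I. Re (cnj (a i) * d i c)) \<partial>M) = (\<Sum>i\<in>I. \<integral>c. Re (cnj (a i) * d i c) \<partial>M)"
    using bd by (intro Bochner_Integration.integral_sum integrable_bounded_meas bm_Re bm_cmult)
  also have "\<dots> = (\<Sum>i\<in>I. Re (\<integral>c. cnj (a i) * d i c \<partial>M))"
    using bd by (intro sum.cong refl integral_Re integrable_bounded_meas bm_cmult)
  finally show "(\<integral>c. (\<Sum>i\<in>I. Re (cnj (a i) * d i c)) \<partial>M) = 0" using mean by simp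
qed

text \<open>One step of a vector-valued martingale: \<open>a\<close> is the current value,
  \<open>d\<close> the increment, and \<open>s\<close> the squared square function so far. In the
  pointwise bound from \<open>sqrt_supermartingale_step\<close> the only term depending on the
  increment is \<open>p / A\<close>, which integrates to zero.\<close>

lemma square_function_step_upper:
  fixes a :: "'i \<Rightarrow> complex" and d :: "'i \<Rightarrow> 'a \<Rightarrow> complex"
  assumes bd: "\<And>i. i \<in> I \<Longrightarrow> bounded_meas M (d i)" and mean: "\<And>i. i \<in> I \<Longrightarrow> (\<integral>c. d i c \<partial>M) = 0"
    and s: "0 \<le> s"
  defines "q \<equiv> \<lambda>c. \<Sum>i\<in>I. (cmod (d i c))\<^sup>2"
  shows "(\<integral>c. sqrt (s + q c + (\<Sum>i\<in>I. (cmod (a i + d i c))\<^sup>2)) - 4 * sqrt (s + q c) \<partial>M)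
    \<le> sqrt (s + (\<Sum>i\<in>I. (cmod (a i))\<^sup>2)) - 4 * sqrt s"
proof -
  define A2 where "A2 = (\<Sum>i\<in>I. (cmod (a i))\<^sup>2)"
  define al where "al = sqrt A2"
  define p where "p c = (\<Sum>i\<in>I. Re (cnj (a i) * d i c))" for c
  define t where "t c = sqrt (q c)" for c
  have A2: "A2 \<ge> 0" "al \<ge> 0" "al\<^sup>2 = A2" unfolding A2_def al_def by (auto intro: sum_nonneg)
  have q0: "0 \<le> q c" for c unfolding q_def by (intro sum_nonneg) auto
  have t: "t c \<ge> 0" "(t c)\<^sup>2 = q c" for c unfolding t_def using q0 by auto
  have bq: "bounded_meas M q" unfolding q_def using bd by (intro bm_sum bm_norm_sq)
  have bp: "bounded_meas M p" and pint: "(\<integral>c. p c \<partial>M) = 0"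
    unfolding p_def[abs_def] by (rule cross_term_mean_zero[OF bd mean], assumption+)+
  have ple: "\<bar>p c\<bar> \<le> al * t c" for c
    unfolding p_def al_def A2_def t_def q_def by (rule cross_term_le)
  have ex: "(\<Sum>i\<in>I. (cmod (a i + d i c))\<^sup>2) = al\<^sup>2 + 2 * p c + (t c)\<^sup>2" for c
    unfolding sum_cmod_add_sq A2 t p_def A2_def q_def ..
  let ?A = "sqrt (s + al\<^sup>2)"
  have pt: "sqrt (s + q c + (\<Sum>i\<in>I. (cmod (a i + d i c))\<^sup>2)) - 4 * sqrt (s + q c)
     \<le> ?A - 4 * sqrt s + p c / ?A" for c
  proof (cases "s + al\<^sup>2 > 0")
    case True
    show ?thesis unfolding ex t(2)[symmetric]
      by (rule sqrt_supermartingale_step[OF s A2(2) t(1) ple True])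
  next
    \<comment> \<open>Here \<open>A\<close> is 0, and so is \<open>p / A\<close> by the convention
      for division. The claim reduces to \<open>sqrt 2 * t \<le> 4 * t\<close>.\<close>
    case False
    then have "s = 0 \<and> al\<^sup>2 = 0" using s zero_le_power2[of al] by linarith
    then have z: "s = 0" "al = 0" by auto
    then have "p c = 0" using ple[of c] by simp
    have "sqrt ((t c)\<^sup>2 + (t c)\<^sup>2) \<le> sqrt ((2 * t c)\<^sup>2)"
      by (intro real_sqrt_le_mono) (simp add: power2_eq_square)
    then have "sqrt ((t c)\<^sup>2 + (t c)\<^sup>2) \<le> 2 * t c" unfolding real_sqrt_abs using t(1)[of c] by simp
    then show ?thesis unfolding ex t(2)[symmetric] using z \<open>p c = 0\<close> t(1)[of c] by simp
  qed
  have "(\<integral>c. sqrt (s + q c + (\<Sum>i\<in>I. (cmod (a i + d i c))\<^sup>2)) - 4 * sqrt (s + q c) \<partial>M)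
     \<le> (\<integral>c. ?A - 4 * sqrt s + p c / ?A \<partial>M)"
  proof (rule integral_mono)
    show "integrable M (\<lambda>c. sqrt (s + q c + (\<Sum>i\<in>I. (cmod (a i + d i c))\<^sup>2)) - 4 * sqrt (s + q c))"
      using bd bq by (intro integrable_bounded_meas bm_diff bm_cmult bm_sqrt bm_add bm_sum bm_norm_sq bm_const)
    show "integrable M (\<lambda>c. ?A - 4 * sqrt s + p c / ?A)"
      using integrable_bounded_meas[OF bp] by simp
  qed (rule pt)
  also have "\<dots> = ?A - 4 * sqrt s"
    using integrable_bounded_meas[OF bp] pint by (simp add: prob_space)
  finally show ?thesis unfolding A2 A2_def .
qed

text \<open>The half-power hypothesis enters for one functional only, the projection
  \<open>W\<close> on the direction of \<open>a\<close>. It makes \<open>sqrt al\<close> at most the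
  mean of \<open>sqrt R\<close>, so the mean of \<open>(sqrt R - sqrt al)^2\<close> is at most the
  mean of \<open>R - al\<close>. As \<open>Re W\<close> has mean \<open>al\<close>, the defect
  \<open>\<eta>\<close> has the same mean as \<open>R - al\<close>. The total factor is 25/2 + 2,
  rounded up to 15.\<close>

lemma square_function_step_lower:
  fixes a :: "'i \<Rightarrow> complex" and d :: "'i \<Rightarrow> 'a \<Rightarrow> complex"
  assumes bd: "\<And>i. i \<in> I \<Longrightarrow> bounded_meas M (d i)" and mean: "\<And>i. i \<in> I \<Longrightarrow> (\<integral>c. d i c \<partial>M) = 0"
    and s: "0 \<le> s"
    and half: "\<And>w. sqrt (cmod (\<integral>c. (\<Sum>i\<in>I. w i * (a i + d i c)) \<partial>M)) \<le>
      (\<integral>c. sqrt (cmod (\<Sum>i\<in>I. w i * (a i + d i c))) \<partial>M)"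
  defines "q \<equiv> \<lambda>c. \<Sum>i\<in>I. (cmod (d i c))\<^sup>2"
  shows "15 * sqrt (\<Sum>i\<in>I. (cmod (a i))\<^sup>2) - sqrt (s + (\<Sum>i\<in>I. (cmod (a i))\<^sup>2)) \<le>
    (\<integral>c. 15 * sqrt (\<Sum>i\<in>I. (cmod (a i + d i c))\<^sup>2) - sqrt (s + q c + (\<Sum>i\<in>I. (cmod (a i + d i c))\<^sup>2)) \<partial>M)"
proof -
  define A2 where "A2 = (\<Sum>i\<in>I. (cmod (a i))\<^sup>2)"
  define al where "al = sqrt A2"
  define p where "p c = (\<Sum>i\<in>I. Re (cnj (a i) * d i c))" for c
  define t where "t c = sqrt (q c)" for c
  define R where "R c = sqrt (\<Sum>i\<in>I. (cmod (a i + d i c))\<^sup>2)" for c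
  have A2: "A2 \<ge> 0" "al \<ge> 0" "al\<^sup>2 = A2" unfolding A2_def al_def by (auto intro: sum_nonneg)
  have q0: "0 \<le> q c" for c unfolding q_def by (intro sum_nonneg) auto
  have t: "t c \<ge> 0" "(t c)\<^sup>2 = q c" for c unfolding t_def using q0 by auto
  have R0: "R c \<ge> 0" "(R c)\<^sup>2 = (\<Sum>i\<in>I. (cmod (a i + d i c))\<^sup>2)" for c
    unfolding R_def by (auto intro!: sum_nonneg)
  have bq: "bounded_meas M q" unfolding q_def using bd by (intro bm_sum bm_norm_sq)
  have bR: "bounded_meas M R" unfolding R_def[abs_def] using bd
    by (intro bm_sqrt bm_sum bm_norm_sq bm_add bm_const)
  have bp: "bounded_meas M p" and pint: "(\<integral>c. p c \<partial>M) = 0"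
    unfolding p_def[abs_def] by (rule cross_term_mean_zero[OF bd mean], assumption+)+
  have ple: "\<bar>p c\<bar> \<le> al * t c" for c
    unfolding p_def al_def A2_def t_def q_def by (rule cross_term_le)
  have ex: "(R c)\<^sup>2 = al\<^sup>2 + 2 * p c + (t c)\<^sup>2" for c
    unfolding R0 sum_cmod_add_sq A2 t p_def A2_def q_def ..
  let ?A = "sqrt (s + al\<^sup>2)"
  have intR: "integrable M R" "integrable M (\<lambda>c. sqrt (R c))" "integrable M p"
    using bR bp by (auto intro!: integrable_bounded_meas bm_sqrt)
  have intS: "integrable M (\<lambda>c. sqrt (s + q c + (R c)\<^sup>2))"
    unfolding R0 using bd bq by (intro integrable_bounded_meas bm_sqrt bm_add bm_sum bm_norm_sq bm_const)
  have main: "(\<integral>c. sqrt (s + q c + (R c)\<^sup>2) \<partial>M) \<le> ?A + 15 * ((\<integral>c. R c \<partial>M) - al)"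
  proof (cases "al = 0")
    \<comment> \<open>There is no direction to project on. Here \<open>R = t\<close>, and
      subadditivity of the square root suffices.\<close>
    case True
    have "sqrt (s + q c + (R c)\<^sup>2) \<le> ?A + 15 * R c" for c
    proof -
      have Rt: "R c = t c" using ex[of c] ple[of c] True R0(1)[of c] t(1)[of c] by (simp add: power2_eq_imp_eq)
      have "sqrt (s + ((t c)\<^sup>2 + (t c)\<^sup>2)) \<le> sqrt s + sqrt ((t c)\<^sup>2 + (t c)\<^sup>2)"
        using s by (intro sqrt_add_le_add_sqrt) auto
      also have "sqrt ((t c)\<^sup>2 + (t c)\<^sup>2) \<le> sqrt ((2 * t c)\<^sup>2)"
        by (intro real_sqrt_le_mono) (simp add: power2_eq_square)
      also have "\<dots> = 2 * t c" unfolding real_sqrt_abs using t(1)[of c] by simp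
      finally show ?thesis using Rt True t[of c] by (simp add: add.assoc)
    qed
    then have "(\<integral>c. sqrt (s + q c + (R c)\<^sup>2) \<partial>M) \<le> (\<integral>c. ?A + 15 * R c \<partial>M)"
      using intR intS by (intro integral_mono) auto
    then show ?thesis using True intR by (simp add: prob_space)
  next
    case False
    then have al: "al > 0" using A2 by simp
    define W where "W c = (\<Sum>i\<in>I. (cnj (a i) / al) * (a i + d i c))" for c
    have bW: "bounded_meas M W" unfolding W_def[abs_def] using bd
      by (intro bm_sum bm_cmult bm_add bm_const)
    define \<eta> where "\<eta> c = R c - Re (W c)" for c
    have ReW: "al * Re (W c) = al\<^sup>2 + p c" for c
    proof -
      have "al * W c = (\<Sum>i\<in>I. cnj (a i) * a i) + (\<Sum>i\<in>I. cnj (a i) * d i c)"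
        unfolding W_def sum_distrib_left sum.distrib[symmetric] using al
        by (intro sum.cong refl) (simp add: distrib_left)
      also have "(\<Sum>i\<in>I. cnj (a i) * a i) = complex_of_real (al\<^sup>2)"
        unfolding A2 A2_def of_real_sum by (intro sum.cong refl) (metis complex_norm_square mult.commute)
      finally have "Re (al * W c) = Re (complex_of_real (al\<^sup>2) + (\<Sum>i\<in>I. cnj (a i) * d i c))" by simp
      then show ?thesis unfolding plus_complex.simps Re_sum p_def by simp
    qed
    have Wint: "(\<integral>c. W c \<partial>M) = al"
    proof -
      have "(\<integral>c. W c \<partial>M) = (\<Sum>i\<in>I. \<integral>c. (cnj (a i) / al) * (a i + d i c) \<partial>M)"
        unfolding W_def using bd by (intro Bochner_Integration.integral_sum integrable_bounded_meas bm_cmult bm_add bm_const)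
      also have "\<dots> = (\<Sum>i\<in>I. (cnj (a i) / al) * a i)"
        using mean bd by (intro sum.cong refl) (simp add: integrable_bounded_meas prob_space)
      also have "\<dots> = (\<Sum>i\<in>I. complex_of_real ((cmod (a i))\<^sup>2)) / al"
        unfolding sum_divide_distrib by (intro sum.cong refl) (simp add: complex_norm_square mult.commute del: of_real_power)
      also have "\<dots> = complex_of_real (al\<^sup>2) / al" unfolding A2 A2_def by simp
      finally show ?thesis using al by (simp add: power2_eq_square)
    qed
    have WR: "cmod (W c) \<le> R c" for c
    proof -
      have "al * cmod (W c) = cmod (al * W c)" using al by (simp add: norm_mult)
      also have "al * W c = (\<Sum>i\<in>I. cnj (a i) * (a i + d i c))"
        using al by (simp add: W_def sum_distrib_left)
      also have "cmod \<dots> \<le> al * R c" unfolding al_def A2_def R_def by (rule norm_sum_cnj_mult_le)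
      finally show ?thesis using al by simp
    qed
    have \<eta>0: "\<eta> c \<ge> 0" for c using WR[of c] complex_Re_le_cmod[of "W c"] by (simp add: \<eta>_def)
    \<comment> \<open>The law of cosines for a triangle with sides \<open>al\<close>,
      \<open>R\<close> and \<open>t\<close>: a radial deviation plus an angular defect.\<close>
    have tt: "(t c)\<^sup>2 = (R c - al)\<^sup>2 + 2 * al * \<eta> c" for c
      using ex[of c] ReW[of c] by (simp add: \<eta>_def power2_eq_square algebra_simps)
    have tle: "t c \<le> R c + al" for c
    proof -
      have "- Re (W c) \<le> R c" using WR[of c] abs_Re_le_cmod[of "W c"] by linarith
      then have "al * (- Re (W c)) \<le> al * R c" using al by (intro mult_left_mono) auto
      moreover have "(t c)\<^sup>2 = (R c + al)\<^sup>2 - 2 * (al * R c) + 2 * (al * (- Re (W c)))"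
        unfolding tt \<eta>_def by algebra
      ultimately have "(t c)\<^sup>2 \<le> (R c + al)\<^sup>2" by linarith
      then show ?thesis by (rule power2_le_imp_le) (use R0(1)[of c] al in linarith)
    qed
    have Apos: "s + al\<^sup>2 > 0" using s al by (simp add: add_nonneg_pos)
    have alA: "al \<le> ?A" using s by (simp add: real_le_rsqrt)
    let ?E = "\<lambda>c. 25 / 2 * (sqrt (R c) - sqrt al)\<^sup>2 + 2 * \<eta> c"
    have pt: "sqrt (s + q c + (R c)\<^sup>2) \<le> ?A + p c / ?A + ?E c" for c
    proof -
      have "(t c)\<^sup>2 / ?A \<le> (t c)\<^sup>2 / al" using alA al Apos by (intro divide_left_mono) auto
      moreover have "sqrt (s + q c + (R c)\<^sup>2) \<le> ?A + p c / ?A + (t c)\<^sup>2 / ?A"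
        using sqrt_plus_increment_quadratic[OF s ple Apos] by (simp add: ex t)
      moreover have "sqrt (s + q c + (R c)\<^sup>2) \<le> ?A + p c / ?A + 5 / 2 * t c"
        using sqrt_plus_increment_linear[OF s A2(2) t(1) ple Apos] by (simp add: ex t)
      ultimately show ?thesis
        using sqrt_deviation_bound[OF R0(1) al t(1) \<eta>0 tt tle, of c] by linarith
    qed
    have intW: "integrable M (\<lambda>c. Re (W c))" using bW by (intro integrable_bounded_meas bm_Re)
    have Eq: "?E c = 25 / 2 * R c + 25 / 2 * al - 25 * sqrt al * sqrt (R c) + 2 * R c - 2 * Re (W c)" for c
    proof -
      have "(sqrt (R c) - sqrt al)\<^sup>2 = R c + al - 2 * (sqrt al * sqrt (R c))"
        using R0(1)[of c] al by (simp add: power2_diff)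
      then show ?thesis by (simp add: \<eta>_def field_simps)
    qed
    have intE: "integrable M ?E" unfolding Eq using intR intW by simp
    have "sqrt al * sqrt al \<le> sqrt al * (\<integral>c. sqrt (R c) \<partial>M)"
    proof (intro mult_left_mono)
      have "sqrt al = sqrt (cmod (\<integral>c. W c \<partial>M))" using Wint al by simp
      also have "\<dots> \<le> (\<integral>c. sqrt (cmod (W c)) \<partial>M)" unfolding W_def by (rule half)
      also have "\<dots> \<le> (\<integral>c. sqrt (R c) \<partial>M)"
        using bW bR WR by (intro integral_mono integrable_bounded_meas bm_sqrt bm_norm) auto
      finally show "sqrt al \<le> (\<integral>c. sqrt (R c) \<partial>M)" .
    qed (use al in auto)
    then have h: "al \<le> sqrt al * (\<integral>c. sqrt (R c) \<partial>M)" using al by simp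
    have ReWint: "(\<integral>c. Re (W c) \<partial>M) = al"
      using integral_Re[OF integrable_bounded_meas[OF bW]] Wint by simp
    have "al \<le> (\<integral>c. R c \<partial>M)"
      unfolding ReWint[symmetric] using WR complex_Re_le_cmod order_trans intR intW
      by (intro integral_mono) blast+
    moreover have "(\<integral>c. ?E c \<partial>M) = 25 / 2 * (\<integral>c. R c \<partial>M) + 25 / 2 * al
        - 25 * (sqrt al * (\<integral>c. sqrt (R c) \<partial>M)) + 2 * (\<integral>c. R c \<partial>M) - 2 * al"
      unfolding Eq using intR intW by (simp add: prob_space ReWint)
    ultimately have E15: "(\<integral>c. ?E c \<partial>M) \<le> 15 * ((\<integral>c. R c \<partial>M) - al)" using h by argo
    have "(\<integral>c. sqrt (s + q c + (R c)\<^sup>2) \<partial>M) \<le> (\<integral>c. ?A + p c / ?A + ?E c \<partial>M)"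
      using intS intR intE by (intro integral_mono pt) auto
    also have "\<dots> = ?A + (\<integral>c. p c \<partial>M) / ?A + (\<integral>c. ?E c \<partial>M)"
    proof -
      have i: "integrable M (\<lambda>c. ?A + p c / ?A)" using intR by simp
      show ?thesis using Bochner_Integration.integral_add[OF i intE] intR by (simp add: prob_space)
    qed
    finally show ?thesis using pint E15 by simp
  qed
  have "(\<integral>c. 15 * R c - sqrt (s + q c + (R c)\<^sup>2) \<partial>M) = 15 * (\<integral>c. R c \<partial>M) - (\<integral>c. sqrt (s + q c + (R c)\<^sup>2) \<partial>M)"
    using intR intS by simp
  also have "\<dots> \<ge> 15 * al - ?A" using main by argo
  finally show ?thesis unfolding R0(2) A2(3) unfolding R_def al_def A2_def .
qed

end

subsection \<open>Norm comparisons for bounded functions\<close>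

context coordinate_space
begin

lemma integral_upd_mono:
  fixes g h :: "(nat \<Rightarrow> 'a) \<Rightarrow> real"
  assumes g: "bm g" and h: "bm h" and n: "n \<in> {1..N}"
  shows "(\<And>x. x \<in> space \<mu> \<Longrightarrow> (\<integral>c. g (x(n := c)) \<partial>M) \<le> h x) \<Longrightarrow> (\<integral>x. g x \<partial>\<mu>) \<le> (\<integral>x. h x \<partial>\<mu>)"
    and "(\<And>x. x \<in> space \<mu> \<Longrightarrow> h x \<le> (\<integral>c. g (x(n := c)) \<partial>M)) \<Longrightarrow> (\<integral>x. h x \<partial>\<mu>) \<le> (\<integral>x. g x \<partial>\<mu>)"
proof -
  interpret Q: pair_prob_space \<mu> M ..
  have i: "integrable \<mu> (\<lambda>x. \<integral>c. g (x(n := c)) \<partial>M)"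
    using Q.integrable_fst[OF integral_upd(1)[OF integrable_bm[OF g] n]] by simp
  show "(\<integral>x. g x \<partial>\<mu>) \<le> (\<integral>x. h x \<partial>\<mu>)"
    if "\<And>x. x \<in> space \<mu> \<Longrightarrow> (\<integral>c. g (x(n := c)) \<partial>M) \<le> h x"
    unfolding integral_upd(2)[OF integrable_bm[OF g] n, symmetric]
    by (intro integral_mono i integrable_bm h that)
  show "(\<integral>x. h x \<partial>\<mu>) \<le> (\<integral>x. g x \<partial>\<mu>)"
    if "\<And>x. x \<in> space \<mu> \<Longrightarrow> h x \<le> (\<integral>c. g (x(n := c)) \<partial>M)"
    unfolding integral_upd(2)[OF integrable_bm[OF g] n, symmetric]
    by (intro integral_mono i integrable_bm h that)
qed

lemma sqfun_identity:
  assumes "bm f" "x \<in> space \<mu>"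
  shows "sqfun True 0 f x = (cmod (f x))\<^sup>2"
proof -
  have "{A. A \<subseteq> {1..N} \<and> card A \<le> 0} = {{}}" by (auto dest: finite_subset)
  moreover have "free_coords True 0 {} = {1..N}" by (auto simp: free_coords_def)
  ultimately show ?thesis using assms by (simp add: sqfun_def altE_def coordE_full)
qed

lemma sqfun_part_martingale:
  assumes "n \<le> N"
  shows "sqfun_part True 0 n f x = (cmod (mdiff n f x))\<^sup>2"
proof (cases "n = 0")
  case False
  have "{A. A \<subseteq> {1..<n} \<and> card A \<le> 0} = {{}}" by (auto dest: finite_subset)
  moreover have "free_coords True (Suc 0) {n} = {1..<n}" using assms by (auto simp: free_coords_def)
  moreover have "insert n {1..<n} = {1..n}" using False by auto
  moreover have "altE {1..<n} {n} f x = coordE M N (insert n {1..<n}) f x - coordE M N {1..<n} f x"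
    using sum_Pow_insert_alternating[of "{}" n "\<lambda>B. coordE M N (B \<union> {1..<n}) f x"] by (simp add: altE_def)
  ultimately show ?thesis using False by (simp add: sqfun_part_def mdiff_def)
qed (simp add: sqfun_part_def mdiff_def)

lemma mdiff_Suc: "mdiff (Suc k) f x = coordE M N {1..Suc k} f x - coordE M N {1..k} f x"
  by (simp add: mdiff_def atLeastLessThanSuc_atLeastAtMost)

lemma coordE_upd_unused:
  assumes "k < n" "n \<in> {1..N}" "x \<in> space \<mu>" "c \<in> space M" "bm f"
  shows "coordE M N {1..k} f (x(n := c)) = coordE M N {1..k} f x"
  using assms by (intro coordE_cong upd_in_space bm_measurable) auto

lemma mdiff_upd_unused:
  assumes "k < n" "n \<in> {1..N}" "x \<in> space \<mu>" "c \<in> space M" "bm f"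
  shows "mdiff k f (x(n := c)) = mdiff k f x"
proof (cases k)
  case 0
  then show ?thesis using coordE_upd_unused[of 0 n x c f] assms by (simp add: mdiff_def)
next
  case (Suc j)
  then show ?thesis using coordE_upd_unused[of k n x c f] coordE_upd_unused[of j n x c f] assms
    by (simp add: mdiff_Suc)
qed

lemma integral_mdiff_upd:
  assumes n: "n \<in> {1..N}" and f: "bm f" and x: "x \<in> space \<mu>"
  shows "(\<integral>c. mdiff n f (x(n := c)) \<partial>M) = 0"
proof -
  obtain k where k: "n = Suc k" using n by (cases n) auto
  have bE: "bm (coordE M N {1..n} f)" using n by (intro bm_coordE f) auto
  have "(\<integral>c. mdiff n f (x(n := c)) \<partial>M) = (\<integral>c. coordE M N {1..n} f (x(n := c)) - coordE M N {1..<n} f x \<partial>M)"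
    using coordE_upd_unused[of k n x _ f] n x f k
    by (intro Bochner_Integration.integral_cong refl) (simp add: mdiff_Suc atLeastLessThanSuc_atLeastAtMost del: fun_upd_apply)
  also have "\<dots> = 0"
    using integral_coordE_upd[OF n f x] integrable_bounded_meas[OF bm_upd_section[OF bE n x]]
    by (simp add: prob_space del: fun_upd_apply)
  finally show ?thesis .
qed

definition msq :: "nat set \<Rightarrow> (nat \<Rightarrow> (nat \<Rightarrow> 'a) \<Rightarrow> complex) \<Rightarrow> nat \<Rightarrow> (nat \<Rightarrow> 'a) \<Rightarrow> real" where
  "msq I f n x = (\<Sum>k\<le>n. \<Sum>i\<in>I. (cmod (mdiff k (f i) x))\<^sup>2)"

definition mval :: "nat set \<Rightarrow> (nat \<Rightarrow> (nat \<Rightarrow> 'a) \<Rightarrow> complex) \<Rightarrow> nat \<Rightarrow> (nat \<Rightarrow> 'a) \<Rightarrow> real" where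
  "mval I f n x = (\<Sum>i\<in>I. (cmod (coordE M N {1..n} (f i) x))\<^sup>2)"

lemma msq_nonneg: "0 \<le> msq I f n x"
  by (auto simp: msq_def intro!: sum_nonneg)

lemma mval_nonneg: "0 \<le> mval I f n x"
  by (auto simp: mval_def intro!: sum_nonneg)

lemma mval_0: "mval I f 0 x = msq I f 0 x"
  by (simp add: mval_def msq_def mdiff_def)

lemma bm_msq: "n \<le> N \<Longrightarrow> (\<And>i. i \<in> I \<Longrightarrow> bm (f i)) \<Longrightarrow> bm (msq I f n)"
  unfolding msq_def[abs_def] by (intro bm_sum bm_norm_sq bm_mdiff) auto

lemma bm_mval: "n \<le> N \<Longrightarrow> (\<And>i. i \<in> I \<Longrightarrow> bm (f i)) \<Longrightarrow> bm (mval I f n)"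
  unfolding mval_def[abs_def] by (intro bm_sum bm_norm_sq bm_coordE) auto

lemma msq_upd:
  assumes k: "Suc k \<in> {1..N}" and f: "\<And>i. i \<in> I \<Longrightarrow> bm (f i)" and x: "x \<in> space \<mu>" and c: "c \<in> space M"
  shows "msq I f (Suc k) (x(Suc k := c)) = msq I f k x + (\<Sum>i\<in>I. (cmod (mdiff (Suc k) (f i) (x(Suc k := c))))\<^sup>2)"
proof -
  have "mdiff j (f i) (x(Suc k := c)) = mdiff j (f i) x" if "j \<le> k" "i \<in> I" for i j
    using that by (intro mdiff_upd_unused k x c f) auto
  then show ?thesis by (simp add: msq_def del: fun_upd_apply)
qed

lemma mval_upd:
  assumes k: "Suc k \<in> {1..N}" and f: "\<And>i. i \<in> I \<Longrightarrow> bm (f i)" and x: "x \<in> space \<mu>" and c: "c \<in> space M"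
  shows "mval I f (Suc k) (x(Suc k := c)) =
    (\<Sum>i\<in>I. (cmod (coordE M N {1..k} (f i) x + mdiff (Suc k) (f i) (x(Suc k := c))))\<^sup>2)"
proof -
  have "coordE M N {1..Suc k} (f i) (x(Suc k := c)) =
      coordE M N {1..k} (f i) x + mdiff (Suc k) (f i) (x(Suc k := c))" if "i \<in> I" for i
    using coordE_upd_unused[OF _ k x c f[OF that], of k] by (simp add: mdiff_Suc del: fun_upd_apply)
  then show ?thesis by (simp add: mval_def del: fun_upd_apply)
qed

lemma Hnorm_0_eq:
  assumes "\<And>i. i \<in> I \<Longrightarrow> bm (f i)"
  shows "Hnorm True 0 I f = ennreal (\<integral>x. sqrt (mval I f N x) \<partial>\<mu>)"
proof -
  have "Hnorm True 0 I f = (\<integral>\<^sup>+x. ennreal (sqrt (mval I f N x)) \<partial>\<mu>)"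
    unfolding Hnorm_def mval_def using assms
    by (intro nn_integral_cong) (simp add: sqfun_identity coordE_full)
  also have "\<dots> = ennreal (\<integral>x. sqrt (mval I f N x) \<partial>\<mu>)"
    using assms by (intro nn_integral_eq_integral integrable_bm bm_sqrt bm_mval) (auto simp: mval_nonneg)
  finally show ?thesis .
qed

lemma Hnorm_1_eq:
  assumes "\<And>i. i \<in> I \<Longrightarrow> bm (f i)"
  shows "Hnorm True (Suc 0) I f = ennreal (\<integral>x. sqrt (msq I f N x) \<partial>\<mu>)"
proof -
  have "Hnorm True (Suc 0) I f = (\<integral>\<^sup>+x. ennreal (sqrt (msq I f N x)) \<partial>\<mu>)"
    unfolding Hnorm_def msq_def sqfun_Suc
    by (subst sum.swap) (simp add: sqfun_part_martingale)
  also have "\<dots> = ennreal (\<integral>x. sqrt (msq I f N x) \<partial>\<mu>)"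
    using assms by (intro nn_integral_eq_integral integrable_bm bm_sqrt bm_msq) (auto simp: msq_nonneg)
  finally show ?thesis .
qed

text \<open>The mean of \<open>U n\<close> does not increase with \<open>n\<close>. It starts at
  most 0, since \<open>mval\<close> and \<open>msq\<close> agree at index 0, and at the end
  \<open>msq\<close> is dropped inside the first root.\<close>

lemma martingale_upper:
  assumes f: "\<And>i. i \<in> I \<Longrightarrow> bm (f i)"
  shows "Hnorm True 0 I f \<le> 4 * Hnorm True (Suc 0) I f"
proof -
  define U where "U n x = sqrt (msq I f n x + mval I f n x) - 4 * sqrt (msq I f n x)" for n x
  have bU: "bm (U n)" if "n \<le> N" for n
    unfolding U_def[abs_def] using that f by (intro bm_diff bm_cmult bm_sqrt bm_add bm_msq bm_mval) auto
  have "(\<integral>x. U n x \<partial>\<mu>) \<le> 0" if "n \<le> N" for n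
    using that
  proof (induction n)
    case 0
    have "U 0 x \<le> 0" for x
    proof -
      have "sqrt (msq I f 0 x + msq I f 0 x) \<le> sqrt (msq I f 0 x) + sqrt (msq I f 0 x)"
        by (intro sqrt_add_le_add_sqrt msq_nonneg)
      then show ?thesis using msq_nonneg[of I f 0 x] real_sqrt_ge_zero[OF msq_nonneg, of I f 0 x]
        unfolding U_def mval_0 by linarith
    qed
    then have "(\<integral>x. U 0 x \<partial>\<mu>) \<le> (\<integral>x. 0 \<partial>\<mu>)"
      using bU[of 0] by (intro integral_mono integrable_bm) (auto intro: bm_const)
    then show ?case by simp
  next
    case (Suc k)
    have k: "Suc k \<in> {1..N}" using Suc by auto
    have "(\<integral>x. U (Suc k) x \<partial>\<mu>) \<le> (\<integral>x. U k x \<partial>\<mu>)"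
    proof (rule integral_upd_mono(1)[OF bU bU k])
      fix x assume x: "x \<in> space \<mu>"
      let ?d = "\<lambda>i c. mdiff (Suc k) (f i) (x(Suc k := c))" and ?a = "\<lambda>i. coordE M N {1..k} (f i) x"
      have "(\<integral>c. U (Suc k) (x(Suc k := c)) \<partial>M) =
        (\<integral>c. sqrt (msq I f k x + (\<Sum>i\<in>I. (cmod (?d i c))\<^sup>2) + (\<Sum>i\<in>I. (cmod (?a i + ?d i c))\<^sup>2))
           - 4 * sqrt (msq I f k x + (\<Sum>i\<in>I. (cmod (?d i c))\<^sup>2)) \<partial>M)"
        by (intro Bochner_Integration.integral_cong refl)
           (simp only: U_def msq_upd[OF k f x] mval_upd[OF k f x])
      also have "\<dots> \<le> sqrt (msq I f k x + (\<Sum>i\<in>I. (cmod (?a i))\<^sup>2)) - 4 * sqrt (msq I f k x)"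
        using k by (intro square_function_step_upper bm_upd_section x integral_mdiff_upd f msq_nonneg bm_mdiff) auto
      also have "\<dots> = U k x" by (simp add: U_def mval_def)
      finally show "(\<integral>c. U (Suc k) (x(Suc k := c)) \<partial>M) \<le> U k x" .
    qed (use k in auto)
    then show ?case using Suc by simp
  qed
  then have "(\<integral>x. U N x \<partial>\<mu>) \<le> 0" by simp
  moreover have "(\<integral>x. sqrt (mval I f N x) - 4 * sqrt (msq I f N x) \<partial>\<mu>) \<le> (\<integral>x. U N x \<partial>\<mu>)"
    using f by (intro integral_mono integrable_bm bU bm_diff bm_cmult bm_sqrt bm_msq bm_mval)
      (auto simp: U_def msq_nonneg)
  moreover have "(\<integral>x. sqrt (mval I f N x) - 4 * sqrt (msq I f N x) \<partial>\<mu>) =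
      (\<integral>x. sqrt (mval I f N x) \<partial>\<mu>) - 4 * (\<integral>x. sqrt (msq I f N x) \<partial>\<mu>)"
    using integrable_bm[OF bm_sqrt[OF bm_mval[OF _ f]], of N] integrable_bm[OF bm_sqrt[OF bm_msq[OF _ f]], of N]
    by simp
  ultimately have "(\<integral>x. sqrt (mval I f N x) \<partial>\<mu>) \<le> 4 * (\<integral>x. sqrt (msq I f N x) \<partial>\<mu>)" by linarith
  then have "ennreal (\<integral>x. sqrt (mval I f N x) \<partial>\<mu>) \<le> ennreal (4 * (\<integral>x. sqrt (msq I f N x) \<partial>\<mu>))"
    by (rule ennreal_leI)
  then show ?thesis using Hnorm_0_eq[of I f, OF f] Hnorm_1_eq[of I f, OF f] by (simp add: ennreal_mult')
qed

text \<open>The only analyticity used: subharmonicity of \<open>|F|\<^bsup>1/2\<^esup>\<close> in the last variable.\<close>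

lemma martingale_lower:
  assumes f: "\<And>i. i \<in> I \<Longrightarrow> bm (f i)"
    and half: "\<And>n x w. n \<in> {1..N} \<Longrightarrow> x \<in> space \<mu> \<Longrightarrow>
      sqrt (cmod (\<integral>c. (\<Sum>i\<in>I. w i * coordE M N {1..n} (f i) (x(n := c))) \<partial>M)) \<le>
      (\<integral>c. sqrt (cmod (\<Sum>i\<in>I. w i * coordE M N {1..n} (f i) (x(n := c)))) \<partial>M)"
  shows "Hnorm True (Suc 0) I f \<le> 15 * Hnorm True 0 I f"
proof -
  define V where "V n x = 15 * sqrt (mval I f n x) - sqrt (msq I f n x + mval I f n x)" for n x
  have bV: "bm (V n)" if "n \<le> N" for n
    unfolding V_def[abs_def] using that f by (intro bm_diff bm_cmult bm_sqrt bm_add bm_msq bm_mval) auto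
  have "0 \<le> (\<integral>x. V n x \<partial>\<mu>)" if "n \<le> N" for n
    using that
  proof (induction n)
    case 0
    have "0 \<le> V 0 x" for x
    proof -
      have "sqrt (msq I f 0 x + msq I f 0 x) \<le> sqrt (msq I f 0 x) + sqrt (msq I f 0 x)"
        by (intro sqrt_add_le_add_sqrt msq_nonneg)
      then show ?thesis using real_sqrt_ge_zero[OF msq_nonneg, of I f 0 x]
        unfolding V_def mval_0 by linarith
    qed
    then show ?case by (intro Bochner_Integration.integral_nonneg) auto
  next
    case (Suc k)
    have k: "Suc k \<in> {1..N}" using Suc by auto
    have "(\<integral>x. V k x \<partial>\<mu>) \<le> (\<integral>x. V (Suc k) x \<partial>\<mu>)"
    proof (rule integral_upd_mono(2)[OF bV bV k])
      fix x assume x: "x \<in> space \<mu>"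
      let ?d = "\<lambda>i c. mdiff (Suc k) (f i) (x(Suc k := c))" and ?a = "\<lambda>i. coordE M N {1..k} (f i) x"
      have ad: "?a i + ?d i c = coordE M N {1..Suc k} (f i) (x(Suc k := c))" if "i \<in> I" "c \<in> space M" for i c
        using coordE_upd_unused[OF _ k x that(2) f[OF that(1)], of k] by (simp add: mdiff_Suc del: fun_upd_apply)
      have half': "sqrt (cmod (\<integral>c. (\<Sum>i\<in>I. w i * (?a i + ?d i c)) \<partial>M)) \<le>
          (\<integral>c. sqrt (cmod (\<Sum>i\<in>I. w i * (?a i + ?d i c))) \<partial>M)" for w
        using half[OF k x, of w] by (simp add: ad cong: Bochner_Integration.integral_cong del: fun_upd_apply)
      have "V k x = 15 * sqrt (\<Sum>i\<in>I. (cmod (?a i))\<^sup>2) - sqrt (msq I f k x + (\<Sum>i\<in>I. (cmod (?a i))\<^sup>2))"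
        by (simp add: V_def mval_def)
      also have "\<dots> \<le> (\<integral>c. 15 * sqrt (\<Sum>i\<in>I. (cmod (?a i + ?d i c))\<^sup>2)
          - sqrt (msq I f k x + (\<Sum>i\<in>I. (cmod (?d i c))\<^sup>2) + (\<Sum>i\<in>I. (cmod (?a i + ?d i c))\<^sup>2)) \<partial>M)"
        using k by (intro square_function_step_lower half' bm_upd_section x integral_mdiff_upd f msq_nonneg bm_mdiff) auto
      also have "\<dots> = (\<integral>c. V (Suc k) (x(Suc k := c)) \<partial>M)"
        by (intro Bochner_Integration.integral_cong refl)
           (simp only: V_def msq_upd[OF k f x] mval_upd[OF k f x])
      finally show "V k x \<le> (\<integral>c. V (Suc k) (x(Suc k := c)) \<partial>M)" .
    qed (use k in auto)
    then show ?case using Suc by simp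
  qed
  then have "0 \<le> (\<integral>x. V N x \<partial>\<mu>)" by simp
  moreover have "(\<integral>x. V N x \<partial>\<mu>) \<le> (\<integral>x. 15 * sqrt (mval I f N x) - sqrt (msq I f N x) \<partial>\<mu>)"
    using f by (intro integral_mono integrable_bm bV bm_diff bm_cmult bm_sqrt bm_msq bm_mval)
      (auto simp: V_def mval_nonneg)
  moreover have "(\<integral>x. 15 * sqrt (mval I f N x) - sqrt (msq I f N x) \<partial>\<mu>) =
      15 * (\<integral>x. sqrt (mval I f N x) \<partial>\<mu>) - (\<integral>x. sqrt (msq I f N x) \<partial>\<mu>)"
    using integrable_bm[OF bm_sqrt[OF bm_mval[OF _ f]], of N] integrable_bm[OF bm_sqrt[OF bm_msq[OF _ f]], of N]
    by simp
  ultimately have "(\<integral>x. sqrt (msq I f N x) \<partial>\<mu>) \<le> 15 * (\<integral>x. sqrt (mval I f N x) \<partial>\<mu>)" by linarith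
  then have "ennreal (\<integral>x. sqrt (msq I f N x) \<partial>\<mu>) \<le> ennreal (15 * (\<integral>x. sqrt (mval I f N x) \<partial>\<mu>))"
    by (rule ennreal_leI)
  then show ?thesis using Hnorm_0_eq[of I f, OF f] Hnorm_1_eq[of I f, OF f] by (simp add: ennreal_mult')
qed

section \<open>Induction on the order\<close>

text \<open>The martingale case, decoupling, the induction hypothesis for the decoupled family at
  fixed \<open>y\<close>, and recoupling: these cost 4, 4, \<open>64 ^ m\<close> and 4.\<close>

lemma norm_upper:
  assumes "\<And>i. i \<in> I \<Longrightarrow> bm (f i)"
  shows "Hnorm True 0 I f \<le> 64 ^ m * Hnorm True m I f"
  using assms
proof (induction m arbitrary: I f)
  case (Suc m)
  have "Hnorm True 0 I f \<le> 4 * Hnorm True (Suc 0) I f"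
    using Suc.prems by (rule martingale_upper)
  also have "\<dots> \<le> 4 * (4 * (\<integral>\<^sup>+y. Hnorm True 0 (dec_index I) (dec_family f y) \<partial>\<mu>))"
    by (intro mult_left_mono Hnorm_decoupling(1) Suc.prems) auto
  also have "\<dots> \<le> 4 * (4 * (\<integral>\<^sup>+y. 64 ^ m * Hnorm True m (dec_index I) (dec_family f y) \<partial>\<mu>))"
    using Suc.prems by (intro mult_left_mono nn_integral_mono Suc.IH bm_dec_family) auto
  also have "\<dots> = 4 * (4 * (64 ^ m * (\<integral>\<^sup>+y. Hnorm True m (dec_index I) (dec_family f y) \<partial>\<mu>)))"
    using Suc.prems by (subst nn_integral_cmult) (auto intro: borel_measurable_Hnorm_dec)
  also have "\<dots> \<le> 4 * (4 * (64 ^ m * (4 * Hnorm True (Suc m) I f)))"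
    by (intro mult_left_mono Hnorm_decoupling(2) Suc.prems) auto
  also have "\<dots> = (4 * 4 * 4) * 64 ^ m * Hnorm True (Suc m) I f" by (simp only: ac_simps)
  finally show ?case by simp
qed auto

text \<open>Exactly what the induction consumes: each conditional expectation lies in
  \<open>\<A>\<close> as a function of its last variable, and each decoupled difference is of the
  same kind at one order less. The class stays abstract; it enters through linearity and the
  half-power inequality.\<close>

primrec hardy :: "('a \<Rightarrow> complex) set \<Rightarrow> nat \<Rightarrow> ((nat \<Rightarrow> 'a) \<Rightarrow> complex) \<Rightarrow> bool" where
  "hardy \<A> 0 f \<longleftrightarrow> bm f"
| "hardy \<A> (Suc m) f \<longleftrightarrow> bm f \<and>
     (\<forall>n\<in>{1..N}. \<forall>x\<in>space \<mu>. (\<lambda>c. coordE M N {1..n} f (x(n := c))) \<in> \<A>) \<and>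
     hardy \<A> m (mdiff 0 f) \<and>
     (\<forall>n\<in>{1..N}. \<forall>c\<in>space M. hardy \<A> m (\<lambda>x. mdiff n f (x(n := c))))"

lemma hardy_bm: "hardy \<A> m f \<Longrightarrow> bm f"
  by (cases m) auto

lemma hardy_dec_family:
  assumes f: "\<And>i. i \<in> I \<Longrightarrow> hardy \<A> (Suc m) (f i)" and y: "y \<in> space \<mu>" and k: "k \<in> dec_index I"
  shows "hardy \<A> m (dec_family f y k)"
proof -
  obtain n i where k: "k = prod_encode (n, i)" "n \<le> N" "i \<in> I" using k by (auto simp: dec_index_def)
  show ?thesis using f[OF k(3)] k coord_in_space[OF y, of n]
    by (cases "n = 0") (auto simp: dec_family_def simp del: fun_upd_apply)
qed

text \<open>The chain of \<open>norm_upper\<close> traversed backwards, with 15 instead of 4 for the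
  martingale step.\<close>

lemma norm_lower:
  assumes half: "\<And>g. g \<in> \<A> \<Longrightarrow> sqrt (cmod (\<integral>c. g c \<partial>M)) \<le> (\<integral>c. sqrt (cmod (g c)) \<partial>M)"
    and lin: "\<And>I w (g :: nat \<Rightarrow> 'a \<Rightarrow> complex). finite I \<Longrightarrow> (\<And>i. i \<in> I \<Longrightarrow> g i \<in> \<A>) \<Longrightarrow>
      (\<lambda>c. \<Sum>i\<in>I. w i * g i c) \<in> \<A>"
    and "finite I" "\<And>i. i \<in> I \<Longrightarrow> hardy \<A> m (f i)"
  shows "Hnorm True m I f \<le> 240 ^ m * Hnorm True 0 I f"
  using assms(3,4)
proof (induction m arbitrary: I f)
  case (Suc m)
  have f: "bm (f i)" if "i \<in> I" for i using Suc.prems(2)[OF that] by (rule hardy_bm)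
  have "Hnorm True (Suc m) I f \<le> 4 * (\<integral>\<^sup>+y. Hnorm True m (dec_index I) (dec_family f y) \<partial>\<mu>)"
    by (rule Hnorm_decoupling(1)[OF f])
  also have "\<dots> \<le> 4 * (\<integral>\<^sup>+y. 240 ^ m * Hnorm True 0 (dec_index I) (dec_family f y) \<partial>\<mu>)"
    using Suc.prems by (intro mult_left_mono nn_integral_mono Suc.IH hardy_dec_family finite_dec_index) auto
  also have "\<dots> = 4 * (240 ^ m * (\<integral>\<^sup>+y. Hnorm True 0 (dec_index I) (dec_family f y) \<partial>\<mu>))"
    using f by (subst nn_integral_cmult) (auto intro: borel_measurable_Hnorm_dec)
  also have "\<dots> \<le> 4 * (240 ^ m * (4 * Hnorm True (Suc 0) I f))"
    by (intro mult_left_mono Hnorm_decoupling(2) f) auto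
  also have "\<dots> \<le> 4 * (240 ^ m * (4 * (15 * Hnorm True 0 I f)))"
    using Suc.prems f by (intro mult_left_mono martingale_lower half lin) auto
  also have "\<dots> = (4 * 4 * 15) * 240 ^ m * Hnorm True 0 I f" by (simp only: ac_simps)
  finally show ?case by simp
qed auto

lemma coordE_empty:
  assumes "bm f" "x \<in> space \<mu>"
  shows "coordE M N {} f x = (\<integral>y. f y \<partial>\<mu>)"
  using assms by (subst coordE_mix) (auto simp: bm_measurable mix_def)

text \<open>Pairing the family with the conjugates of its own means integrates to
  \<open>al * al\<close>, and by Cauchy-Schwarz is pointwise at most
  \<open>al * ?R x\<close>.\<close>

lemma norm_expectation_le:
  assumes f: "\<And>i. i \<in> I \<Longrightarrow> bm (f i)"
  shows "Hnorm False 0 I f \<le> Hnorm True 0 I f"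
proof -
  define al where "al = sqrt (\<Sum>i\<in>I. (cmod (\<integral>y. f i y \<partial>\<mu>))\<^sup>2)"
  have al0: "al \<ge> 0" unfolding al_def by (auto intro: sum_nonneg)
  have "{A. A \<subseteq> {1..N} \<and> card A \<le> 0} = {{}}" by (auto dest: finite_subset)
  then have "sqfun False 0 (f i) x = (cmod (\<integral>y. f i y \<partial>\<mu>))\<^sup>2" if "i \<in> I" "x \<in> space \<mu>" for i x
    using that f by (simp add: sqfun_def altE_def free_coords_def coordE_empty)
  then have "Hnorm False 0 I f = (\<integral>\<^sup>+x. ennreal al \<partial>\<mu>)"
    unfolding Hnorm_def al_def by (intro nn_integral_cong) simp
  then have L: "Hnorm False 0 I f = ennreal al" by (simp add: PS.P.emeasure_space_1)
  let ?R = "\<lambda>x. sqrt (\<Sum>i\<in>I. (cmod (f i x))\<^sup>2)"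
  have bR: "bm ?R" using f by (intro bm_sqrt bm_sum bm_norm_sq)
  have "Hnorm True 0 I f = (\<integral>\<^sup>+x. ennreal (?R x) \<partial>\<mu>)"
    unfolding Hnorm_def using f by (intro nn_integral_cong) (simp add: sqfun_identity)
  then have R: "Hnorm True 0 I f = ennreal (\<integral>x. ?R x \<partial>\<mu>)"
    using integrable_bm[OF bR] by (simp add: nn_integral_eq_integral sum_nonneg)
  let ?W = "\<lambda>x. \<Sum>i\<in>I. cnj (\<integral>y. f i y \<partial>\<mu>) * f i x"
  have "al * al = cmod (\<integral>x. ?W x \<partial>\<mu>)"
  proof -
    have "(\<integral>x. ?W x \<partial>\<mu>) = (\<Sum>i\<in>I. cnj (\<integral>y. f i y \<partial>\<mu>) * (\<integral>y. f i y \<partial>\<mu>))"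
      using f by (subst Bochner_Integration.integral_sum) (auto intro!: integrable_bm bm_cmult)
    also have "\<dots> = complex_of_real (al * al)"
      unfolding al_def by (simp add: sum_nonneg complex_norm_square mult.commute del: of_real_power)
    finally show ?thesis using al0 by (simp del: of_real_mult)
  qed
  also have "\<dots> \<le> (\<integral>x. cmod (?W x) \<partial>\<mu>)" by (rule integral_norm_bound)
  also have "\<dots> \<le> (\<integral>x. al * ?R x \<partial>\<mu>)"
    using f by (intro integral_mono integrable_bm bm_norm bm_sum bm_cmult bR)
      (auto simp: al_def intro: norm_sum_cnj_mult_le)
  also have "\<dots> = al * (\<integral>x. ?R x \<partial>\<mu>)" by simp
  finally have "al \<le> (\<integral>x. ?R x \<partial>\<mu>)"
    using al0 by (cases "al = 0") (auto intro!: Bochner_Integration.integral_nonneg sum_nonneg)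
  then show ?thesis unfolding L R by (rule ennreal_leI)
qed

text \<open>A form of Stein's inequality for sequences of conditional expectations: on sets of size
  \<open>m\<close>, passing from \<open>Delta\<close> to \<open>projP\<close> averages out the free
  coordinates. Each round costs two decouplings, and at order 0 only a plain expectation
  remains.\<close>

lemma norm_stein:
  assumes "\<And>i. i \<in> I \<Longrightarrow> bm (f i)"
  shows "Hnorm False m I f \<le> 16 ^ m * Hnorm True m I f"
  using assms
proof (induction m arbitrary: I f)
  case 0
  then show ?case using norm_expectation_le by simp
next
  case (Suc m)
  have "Hnorm False (Suc m) I f \<le> 4 * (\<integral>\<^sup>+y. Hnorm False m (dec_index I) (dec_family f y) \<partial>\<mu>)"
    by (rule Hnorm_decoupling(1)[OF Suc.prems])
  also have "\<dots> \<le> 4 * (\<integral>\<^sup>+y. 16 ^ m * Hnorm True m (dec_index I) (dec_family f y) \<partial>\<mu>)"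
    using Suc.prems by (intro mult_left_mono nn_integral_mono Suc.IH bm_dec_family) auto
  also have "\<dots> = 4 * (16 ^ m * (\<integral>\<^sup>+y. Hnorm True m (dec_index I) (dec_family f y) \<partial>\<mu>))"
    using Suc.prems by (subst nn_integral_cmult) (auto intro: borel_measurable_Hnorm_dec)
  also have "\<dots> \<le> 4 * (16 ^ m * (4 * Hnorm True (Suc m) I f))"
    by (intro mult_left_mono Hnorm_decoupling(2) Suc.prems) auto
  also have "\<dots> = (4 * 4) * 16 ^ m * Hnorm True (Suc m) I f" by (simp only: ac_simps)
  finally show ?case by simp
qed

end

subsection \<open>Passage to integrable functions\<close>

lemma ennreal_le_epsilon_mult:
  fixes x y :: ennreal
  assumes K: "0 \<le> K" and le: "\<And>e. 0 < e \<Longrightarrow> x \<le> y + ennreal K * ennreal e"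
  shows "x \<le> y"
proof (rule ennreal_le_epsilon)
  fix e :: real assume e: "0 < e"
  have "x \<le> y + ennreal K * ennreal (e / (K + 1))" using e K by (intro le) simp
  also have "\<dots> = y + ennreal (K * (e / (K + 1)))" using e K by (subst ennreal_mult) auto
  also have "\<dots> \<le> y + ennreal e"
    using e K by (intro add_left_mono ennreal_leI) (simp add: field_simps)
  finally show "x \<le> y + ennreal e" .
qed

context coordinate_space
begin

lemma prodM_eq: "prodM M N = \<mu>"
  by (simp add: prodM_def)

lemma free_coords_Min:
  assumes "A \<subseteq> {1..N}" "A \<noteq> {}"
  shows "free_coords True (card A) A = {1..<Min A}"
proof -
  have fA: "finite A" using assms finite_subset by blast
  have "Min A \<in> A" using fA assms by simp
  then have "Min A \<le> N" using assms by auto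
  moreover have "(\<forall>a\<in>A. j < a) \<longleftrightarrow> j < Min A" for j using fA assms by simp
  ultimately have "free_coords True (card A) A = {j \<in> {1..N}. j < Min A}"
    by (simp only: free_coords_def simp_thms if_True)
  also have "\<dots> = {1..<Min A}" using \<open>Min A \<le> N\<close> by (intro set_eqI) (simp only: mem_Collect_eq atLeastAtMost_iff atLeastLessThan_iff, linarith)
  finally show ?thesis .
qed

lemma Delta_eq_altE:
  assumes m: "m \<ge> 1" and A: "A \<subseteq> {1..N}" "card A \<le> m"
  shows "Delta M N m A f x = altE (free_coords True m A) A f x"
proof (cases "card A < m")
  case True
  then show ?thesis by (simp add: Delta_def projP_def altE_def free_coords_def)
next
  case False
  then have "card A = m" "A \<noteq> {}" using A m by auto
  then show ?thesis using free_coords_Min[of A] A by (simp add: Delta_def altE_def)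
qed

lemma H1norm_eq:
  assumes "m \<ge> 1"
  shows "H1norm M N m f = (\<integral>\<^sup>+x. ennreal (sqrt (sqfun True m f x)) \<partial>\<mu>)"
  unfolding H1norm_def prodM_eq sqfun_def using assms
  by (intro nn_integral_cong arg_cong[where f = "\<lambda>z. ennreal (sqrt z)"] sum.cong refl) (simp add: Delta_eq_altE)

lemma H1norm_Hnorm: "m \<ge> 1 \<Longrightarrow> H1norm M N m f = Hnorm True m {0} (\<lambda>_. f)"
  by (simp add: H1norm_eq Hnorm_def)

lemma L1norm_Hnorm: "bm f \<Longrightarrow> L1norm M N f = Hnorm True 0 {0} (\<lambda>_. f)"
  unfolding L1norm_def prodM_eq Hnorm_def by (intro nn_integral_cong) (simp add: sqfun_identity)

lemma projPk_altE: "projPk M N k f x = (\<Sum>A | A \<subseteq> {1..N} \<and> card A = k. altE {} A f x)"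
  by (simp add: projPk_def projP_def altE_def)

lemma finite_subsets_card: "finite {A. A \<subseteq> {1..N} \<and> P A}"
  by (rule finite_subset[of _ "Pow {1..N}"]) auto

lemma bm_altE: "A \<subseteq> {1..N} \<Longrightarrow> C \<subseteq> {1..N} \<Longrightarrow> bm f \<Longrightarrow> bm (altE C A f)"
  unfolding altE_def[abs_def] by (intro bm_sum bm_cmult bm_coordE) auto

lemma bm_projPk: "bm f \<Longrightarrow> bm (projPk M N k f)"
  unfolding projPk_altE[abs_def] by (intro bm_sum bm_altE) auto

lemma altE_sum:
  assumes "A \<subseteq> {1..N}" "C \<subseteq> {1..N}" "\<And>i. i \<in> S \<Longrightarrow> bm (f i)" "x \<in> space \<mu>"
  shows "altE C A (\<lambda>x. \<Sum>i\<in>S. f i x) x = (\<Sum>i\<in>S. altE C A (f i) x)"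
proof -
  have "coordE M N (B \<union> C) (\<lambda>x. \<Sum>i\<in>S. f i x) x = (\<Sum>i\<in>S. coordE M N (B \<union> C) (f i) x)" if "B \<subseteq> A" for B
    using that assms by (intro coordE_sum) auto
  then have "altE C A (\<lambda>x. \<Sum>i\<in>S. f i x) x =
      (\<Sum>B\<in>Pow A. \<Sum>i\<in>S. (-1) ^ card (A - B) * coordE M N (B \<union> C) (f i) x)"
    unfolding altE_def by (intro sum.cong refl) (simp add: sum_distrib_left)
  then show ?thesis unfolding altE_def by (subst sum.swap) 
qed

lemma altE_cmult:
  assumes "A \<subseteq> {1..N}" "C \<subseteq> {1..N}" "bm f" "x \<in> space \<mu>"
  shows "altE C A (\<lambda>x. c * f x) x = c * altE C A f x"
proof -
  have "coordE M N (B \<union> C) (\<lambda>x. c * f x) x = c * coordE M N (B \<union> C) f x" if "B \<subseteq> A" for B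
    using that assms by (intro coordE_cmult) auto
  then show ?thesis unfolding altE_def sum_distrib_left by (intro sum.cong refl) (simp add: mult_ac)
qed

lemma altE_coordE:
  assumes A: "A \<subseteq> {1..N}" and C: "C \<subseteq> {1..N}" and E: "E \<subseteq> {1..N}" and f: "bm f" and x: "x \<in> space \<mu>"
  shows "altE C A (coordE M N E f) x = (if A \<subseteq> E then altE (C \<inter> E) A f x else 0)"
proof -
  have fA: "finite A" using A finite_subset by blast
  have "coordE M N (B \<union> C) (coordE M N E f) x = coordE M N (B \<inter> E \<union> C \<inter> E) f x" if "B \<subseteq> A" for B
    using that A C E f x by (subst coordE_coordE) (auto simp: Int_Un_distrib2)
  then have eq: "altE C A (coordE M N E f) x =
      (\<Sum>B\<in>Pow A. (-1) ^ card (A - B) * coordE M N (B \<inter> E \<union> C \<inter> E) f x)"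
    unfolding altE_def by (intro sum.cong refl) auto
  show ?thesis
  proof (cases "A \<subseteq> E")
    case True
    then have "B \<inter> E = B" if "B \<subseteq> A" for B using that by auto
    then have "altE (C \<inter> E) A f x = (\<Sum>B\<in>Pow A. (-1) ^ card (A - B) * coordE M N (B \<inter> E \<union> C \<inter> E) f x)"
      unfolding altE_def by (intro sum.cong refl) simp
    then show ?thesis using True eq by simp
  next
    case False
    then obtain a where a: "a \<in> A" "a \<notin> E" by auto
    then have "altE C A (coordE M N E f) x = 0" unfolding eq
      by (intro sum_Pow_alternating_eq_0[OF fA a(1)]) simp
    then show ?thesis using False by simp
  qed
qed

text \<open>For \<open>A = D\<close> the free coordinates miss \<open>A\<close>, and only the term
  \<open>E = D\<close> survives. For a proper subset \<open>A\<close> of \<open>D\<close> the bound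
  \<open>card D \<le> m\<close> matters: then \<open>card A < m\<close>, so \<open>A\<close> has no
  free coordinates, and the alternating sum over the directions in \<open>D - A\<close>
  cancels.\<close>

lemma altE_projP:
  assumes A: "A \<subseteq> {1..N}" "card A \<le> m" and D: "D \<subseteq> {1..N}" "card D \<le> m" and f: "bm f" and x: "x \<in> space \<mu>"
  shows "altE (free_coords True m A) A (altE {} D f) x = (if A = D then altE {} A f x else 0)"
proof -
  let ?C = "free_coords True m A"
  have fin: "finite A" "finite D" using A D finite_subset by auto
  have dist: "altE ?C A (altE {} D f) x = (\<Sum>E\<in>Pow D. (-1) ^ card (D - E) * altE ?C A (coordE M N E f) x)"
  proof -
    have b: "bm (coordE M N E f)" if "E \<subseteq> D" for E using that D by (intro bm_coordE f) auto
    have "altE ?C A (\<lambda>x. \<Sum>E\<in>Pow D. (-1) ^ card (D - E) * coordE M N E f x) x =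
        (\<Sum>E\<in>Pow D. altE ?C A (\<lambda>x. (-1) ^ card (D - E) * coordE M N E f x) x)"
      using b by (intro altE_sum A free_coords_subset x bm_cmult) auto
    also have "\<dots> = (\<Sum>E\<in>Pow D. (-1) ^ card (D - E) * altE ?C A (coordE M N E f) x)"
      using b by (intro sum.cong refl altE_cmult A free_coords_subset x) auto
    moreover have "altE {} D f = (\<lambda>x. \<Sum>E\<in>Pow D. (-1) ^ card (D - E) * coordE M N E f x)"
      by (simp add: altE_def fun_eq_iff)
    ultimately show ?thesis by simp
  qed
  have alt: "altE ?C A (coordE M N E f) x = (if A \<subseteq> E then altE (?C \<inter> E) A f x else 0)" if "E \<subseteq> D" for E
    using that D by (intro altE_coordE A free_coords_subset f x) auto
  consider "\<not> A \<subseteq> D" | "A = D" | "A \<subset> D" by auto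
  then show ?thesis
  proof cases
    case 1
    then have "\<not> A \<subseteq> E" if "E \<subseteq> D" for E using that by auto
    then have "altE ?C A (coordE M N E f) x = 0" if "E \<subseteq> D" for E using alt[OF that] that by auto
    then show ?thesis using 1 unfolding dist by (auto intro!: sum.neutral)
  next
    case 2
    have "free_coords True m A \<inter> A = {}" by (auto simp: free_coords_def)
    then have t: "altE ?C A (coordE M N E f) x = (if E = A then altE {} A f x else 0)" if "E \<subseteq> A" for E
      using alt[of E] that 2 by auto
    have "altE ?C A (altE {} D f) x = (\<Sum>E\<in>Pow A. if E = A then altE {} A f x else 0)"
      unfolding dist unfolding 2[symmetric] by (intro sum.cong refl) (simp add: t)
    also have "\<dots> = altE {} A f x" using fin by simp
    finally show ?thesis using 2 by simp
  next
    case 3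
    then have "card A < m" using psubset_card_mono[OF fin(2) 3] D by simp
    then have C: "?C = {}" by (simp add: free_coords_def)
    obtain a where a: "a \<in> D" "a \<notin> A" using 3 by auto
    have "altE ?C A (altE {} D f) x =
        (\<Sum>E\<in>Pow D. (-1) ^ card (D - E) * (if A \<subseteq> E then altE {} A f x else 0))"
      unfolding dist by (intro sum.cong refl) (simp add: alt, simp add: C)
    also have "\<dots> = 0"
      using a by (intro sum_Pow_alternating_eq_0[OF fin(2) a(1)]) auto
    finally show ?thesis using 3 by auto
  qed
qed

text \<open>Of each \<open>Delta\<close> term \<open>projPk\<close> leaves the corresponding
  \<open>projP\<close> term when \<open>card A = k\<close>, and nothing otherwise.\<close>

lemma sqfun_projPk_le:
  assumes "k \<le> m" and f: "bm f" and x: "x \<in> space \<mu>"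
  shows "sqfun True m (projPk M N k f) x \<le> sqfun False m f x"
  unfolding sqfun_def
proof (rule sum_mono)
  fix A assume "A \<in> {A. A \<subseteq> {1..N} \<and> card A \<le> m}"
  then have A: "A \<subseteq> {1..N}" "card A \<le> m" by auto
  have "altE (free_coords True m A) A (projPk M N k f) x =
      (\<Sum>D | D \<subseteq> {1..N} \<and> card D = k. altE (free_coords True m A) A (altE {} D f) x)"
    unfolding projPk_altE[abs_def] by (intro altE_sum A free_coords_subset x bm_altE f) auto
  also have "\<dots> = (\<Sum>D | D \<subseteq> {1..N} \<and> card D = k. if A = D then altE {} A f x else 0)"
    using assms A by (intro sum.cong refl altE_projP) auto
  also have "\<dots> = (if card A = k then altE {} A f x else 0)"
    using A finite_subsets_card[of "\<lambda>D. card D = k"] by simp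
  finally show "(cmod (altE (free_coords True m A) A (projPk M N k f) x))\<^sup>2
      \<le> (cmod (altE (free_coords False m A) A f x))\<^sup>2"
    by (simp add: free_coords_def)
qed

lemma H1norm_projPk_bounded:
  assumes "m \<ge> 1" "k \<le> m" and f: "bm f"
  shows "H1norm M N m (projPk M N k f) \<le> 16 ^ m * H1norm M N m f"
proof -
  have "H1norm M N m (projPk M N k f) \<le> Hnorm False m {0} (\<lambda>_. f)"
    unfolding H1norm_eq[OF assms(1)] Hnorm_def using assms
    by (intro nn_integral_mono ennreal_leI real_sqrt_le_mono) (simp add: sqfun_projPk_le)
  also have "\<dots> \<le> 16 ^ m * Hnorm True m {0} (\<lambda>_. f)"
    using f by (intro norm_stein) auto
  finally show ?thesis by (simp add: H1norm_Hnorm assms)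
qed

lemma L1norm_upper_bounded:
  "m \<ge> 1 \<Longrightarrow> bm f \<Longrightarrow> L1norm M N f \<le> 64 ^ m * H1norm M N m f"
  using norm_upper[of "{0}" "\<lambda>_. f" m] by (simp add: H1norm_Hnorm L1norm_Hnorm)

section \<open>L^1 continuity at fixed N and removal of boundedness\<close>

lemma integrable_coordE:
  assumes A: "A \<subseteq> {1..N}" and f: "integrable \<mu> f"
  shows "integrable \<mu> (coordE M N A f)"
proof -
  have "integrable \<mu> (\<lambda>x. \<integral>y. f (mix A x y) \<partial>\<mu>)"
    using PP.integrable_fst[OF integrable_mix[OF f, of A]] by simp
  then show ?thesis
    by (subst Bochner_Integration.integrable_cong[OF refl coordE_mix[OF A]]) (use f in auto)
qed

text \<open>Sections of an integrable function are integrable only for almost every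
  \<open>x\<close>, so linearity of \<open>coordE\<close> is used almost everywhere; resampling then
  restores the full integral.\<close>

lemma coordE_L1_contraction:
  assumes A: "A \<subseteq> {1..N}" and f: "integrable \<mu> f" and g: "integrable \<mu> g"
  shows "(\<integral>\<^sup>+x. ennreal (cmod (coordE M N A f x - coordE M N A g x)) \<partial>\<mu>) \<le> L1norm M N (\<lambda>x. f x - g x)"
proof -
  have sec: "AE x in \<mu>. integrable \<mu> (\<lambda>y. h (mix A x y))" if "integrable \<mu> h" for h :: "_ \<Rightarrow> complex"
    using PP.AE_integrable_fst[OF integrable_mix[OF that, of A]] by simp
  have "(\<integral>\<^sup>+x. ennreal (cmod (coordE M N A f x - coordE M N A g x)) \<partial>\<mu>)
      \<le> (\<integral>\<^sup>+x. \<integral>\<^sup>+y. ennreal (cmod (f (mix A x y) - g (mix A x y))) \<partial>\<mu> \<partial>\<mu>)"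
  proof (rule nn_integral_mono_AE)
    show "AE x in \<mu>. ennreal (cmod (coordE M N A f x - coordE M N A g x))
        \<le> (\<integral>\<^sup>+y. ennreal (cmod (f (mix A x y) - g (mix A x y))) \<partial>\<mu>)"
      using sec[OF f] sec[OF g] AE_space
    proof eventually_elim
      case (elim x)
      then have "coordE M N A f x - coordE M N A g x = (\<integral>y. f (mix A x y) - g (mix A x y) \<partial>\<mu>)"
        using f g A by (simp add: coordE_mix)
      then show ?case using elim by (simp only:) (intro integral_norm_bound_ennreal, auto)
    qed
  qed
  also have "\<dots> = L1norm M N (\<lambda>x. f x - g x)"
    unfolding L1norm_def prodM_eq using f g
    by (intro nn_integral_mix[of "\<lambda>x. ennreal (cmod (f x - g x))"]) auto
  finally show ?thesis .
qed

lemma altE_L1_bound: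
  assumes A: "A \<subseteq> {1..N}" and C: "C \<subseteq> {1..N}" and f: "integrable \<mu> f" and g: "integrable \<mu> g"
  shows "(\<integral>\<^sup>+x. ennreal (cmod (altE C A f x - altE C A g x)) \<partial>\<mu>) \<le> of_nat (card (Pow A)) * L1norm M N (\<lambda>x. f x - g x)"
proof -
  have BC: "B \<union> C \<subseteq> {1..N}" if "B \<in> Pow A" for B using that A C by auto
  have [measurable]: "coordE M N (B \<union> C) h \<in> borel_measurable \<mu>" if "B \<in> Pow A" "integrable \<mu> h" for B h
    using BC[OF that(1)] that(2) by (intro borel_measurable_coordE) auto
  have "(\<integral>\<^sup>+x. ennreal (cmod (altE C A f x - altE C A g x)) \<partial>\<mu>)
      \<le> (\<integral>\<^sup>+x. (\<Sum>B\<in>Pow A. ennreal (cmod (coordE M N (B \<union> C) f x - coordE M N (B \<union> C) g x))) \<partial>\<mu>)"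
  proof (intro nn_integral_mono)
    fix x
    have "cmod (altE C A f x - altE C A g x) =
        cmod (\<Sum>B\<in>Pow A. (-1) ^ card (A - B) * (coordE M N (B \<union> C) f x - coordE M N (B \<union> C) g x))"
      by (simp add: altE_def sum_subtractf[symmetric] right_diff_distrib)
    also have "\<dots> \<le> (\<Sum>B\<in>Pow A. cmod (coordE M N (B \<union> C) f x - coordE M N (B \<union> C) g x))"
      by (rule order_trans[OF norm_sum]) (simp add: norm_mult norm_power)
    finally show "ennreal (cmod (altE C A f x - altE C A g x))
        \<le> (\<Sum>B\<in>Pow A. ennreal (cmod (coordE M N (B \<union> C) f x - coordE M N (B \<union> C) g x)))"
      by (simp add: sum_ennreal ennreal_leI)
  qed
  also have "\<dots> = (\<Sum>B\<in>Pow A. \<integral>\<^sup>+x. ennreal (cmod (coordE M N (B \<union> C) f x - coordE M N (B \<union> C) g x)) \<partial>\<mu>)"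
    using f g by (intro nn_integral_sum) measurable
  also have "\<dots> \<le> (\<Sum>B\<in>Pow A. L1norm M N (\<lambda>x. f x - g x))"
    by (intro sum_mono coordE_L1_contraction BC f g)
  finally show ?thesis by simp
qed

text \<open>A crude count that grows with \<open>N\<close>. It multiplies only approximation errors
  and therefore never enters the final constants.\<close>

definition op_const :: nat where
  "op_const = (\<Sum>A\<in>Pow {1..N}. card (Pow A))"

lemma integrable_projPk: "integrable \<mu> f \<Longrightarrow> integrable \<mu> (projPk M N k f)"
  unfolding projPk_altE[abs_def] altE_def
  by (intro Bochner_Integration.integrable_sum Bochner_Integration.integrable_mult_right integrable_coordE) auto

lemma projPk_L1_bound:
  assumes f: "integrable \<mu> f" and g: "integrable \<mu> g"
  shows "L1norm M N (\<lambda>x. projPk M N k f x - projPk M N k g x) \<le> of_nat op_const * L1norm M N (\<lambda>x. f x - g x)"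
proof -
  let ?S = "{A. A \<subseteq> {1..N} \<and> card A = k}"
  have [measurable]: "altE {} A h \<in> borel_measurable \<mu>" if "A \<in> ?S" "integrable \<mu> h" for A h
    using that unfolding altE_def[abs_def]
    by (intro borel_measurable_sum borel_measurable_times borel_measurable_const borel_measurable_coordE) auto
  have "L1norm M N (\<lambda>x. projPk M N k f x - projPk M N k g x)
      \<le> (\<integral>\<^sup>+x. (\<Sum>A\<in>?S. ennreal (cmod (altE {} A f x - altE {} A g x))) \<partial>\<mu>)"
    unfolding L1norm_def prodM_eq
    by (intro nn_integral_mono)
       (simp add: projPk_altE sum_subtractf[symmetric] norm_sum ennreal_leI)
  also have "\<dots> = (\<Sum>A\<in>?S. \<integral>\<^sup>+x. ennreal (cmod (altE {} A f x - altE {} A g x)) \<partial>\<mu>)"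
    using f g by (intro nn_integral_sum) measurable
  also have "\<dots> \<le> (\<Sum>A\<in>?S. of_nat (card (Pow A)) * L1norm M N (\<lambda>x. f x - g x))"
    by (intro sum_mono altE_L1_bound f g) auto
  also have "\<dots> \<le> (\<Sum>A\<in>Pow {1..N}. of_nat (card (Pow A)) * L1norm M N (\<lambda>x. f x - g x))"
    by (intro sum_mono2) auto
  finally show ?thesis by (simp add: op_const_def sum_distrib_right del: of_nat_power)
qed

lemma borel_measurable_sqfun:
  assumes f: "f \<in> borel_measurable \<mu>"
  shows "sqfun b m f \<in> borel_measurable \<mu>"
  unfolding sqfun_def[abs_def] altE_def using f subsetD[OF free_coords_subset]
  by (intro borel_measurable_sum borel_measurable_power measurable_compose[OF _ borel_measurable_norm]
      borel_measurable_times borel_measurable_const borel_measurable_coordE) auto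

lemma H1norm_perturbation:
  assumes m: "m \<ge> 1" and f: "integrable \<mu> f" and g: "integrable \<mu> g"
  shows "H1norm M N m f \<le> H1norm M N m g + of_nat op_const * L1norm M N (\<lambda>x. f x - g x)"
proof -
  let ?S = "{A. A \<subseteq> {1..N} \<and> card A \<le> m}"
  let ?d = "\<lambda>A f x. altE (free_coords True m A) A f x"
  have [measurable]: "?d A h \<in> borel_measurable \<mu>" if "A \<in> ?S" "integrable \<mu> h" for A h
    using that subsetD[OF free_coords_subset] unfolding altE_def[abs_def]
    by (intro borel_measurable_sum borel_measurable_times borel_measurable_const borel_measurable_coordE) auto
  have "H1norm M N m f \<le> (\<integral>\<^sup>+x. ennreal (sqrt (sqfun True m g x)) +
      (\<Sum>A\<in>?S. ennreal (cmod (?d A f x - ?d A g x))) \<partial>\<mu>)"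
    unfolding H1norm_eq[OF m]
  proof (intro nn_integral_mono)
    fix x
    have "sqrt (sqfun True m f x) = L2_set (\<lambda>A. cmod (?d A f x)) ?S"
      by (simp add: sqfun_def L2_set_def)
    also have "\<dots> \<le> L2_set (\<lambda>A. cmod (?d A g x) + cmod (?d A f x - ?d A g x)) ?S"
      by (intro L2_set_mono) (auto intro: norm_triangle_sub)
    also have "\<dots> \<le> L2_set (\<lambda>A. cmod (?d A g x)) ?S + L2_set (\<lambda>A. cmod (?d A f x - ?d A g x)) ?S"
      by (rule L2_set_triangle_ineq)
    also have "\<dots> \<le> sqrt (sqfun True m g x) + (\<Sum>A\<in>?S. cmod (?d A f x - ?d A g x))"
      by (intro add_mono L2_set_le_sum) (auto simp: sqfun_def L2_set_def)
    finally have "ennreal (sqrt (sqfun True m f x)) \<le>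
        ennreal (sqrt (sqfun True m g x) + (\<Sum>A\<in>?S. cmod (?d A f x - ?d A g x)))" by (rule ennreal_leI)
    also have "\<dots> = ennreal (sqrt (sqfun True m g x)) + (\<Sum>A\<in>?S. ennreal (cmod (?d A f x - ?d A g x)))"
      by (subst ennreal_plus) (auto simp: sqfun_def sum_nonneg)
    finally show "ennreal (sqrt (sqfun True m f x)) \<le>
        ennreal (sqrt (sqfun True m g x)) + (\<Sum>A\<in>?S. ennreal (cmod (?d A f x - ?d A g x)))" .
  qed
  also have "\<dots> = H1norm M N m g + (\<integral>\<^sup>+x. (\<Sum>A\<in>?S. ennreal (cmod (?d A f x - ?d A g x))) \<partial>\<mu>)"
  proof -
    have [measurable]: "sqfun True m g \<in> borel_measurable \<mu>" using g by (intro borel_measurable_sqfun) auto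
    show ?thesis unfolding H1norm_eq[OF m] using f g by (intro nn_integral_add) measurable
  qed
  also have "(\<integral>\<^sup>+x. (\<Sum>A\<in>?S. ennreal (cmod (?d A f x - ?d A g x))) \<partial>\<mu>)
      = (\<Sum>A\<in>?S. \<integral>\<^sup>+x. ennreal (cmod (?d A f x - ?d A g x)) \<partial>\<mu>)"
    using f g by (intro nn_integral_sum) measurable
  also have "\<dots> \<le> (\<Sum>A\<in>?S. of_nat (card (Pow A)) * L1norm M N (\<lambda>x. f x - g x))"
    by (intro sum_mono altE_L1_bound f g free_coords_subset) auto
  also have "\<dots> \<le> (\<Sum>A\<in>Pow {1..N}. of_nat (card (Pow A)) * L1norm M N (\<lambda>x. f x - g x))"
    by (intro sum_mono2) auto
  finally show ?thesis by (simp add: op_const_def sum_distrib_right del: of_nat_power)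
qed

lemma bounded_approximation:
  assumes f: "integrable \<mu> f" and e: "0 < e"
  shows "\<exists>g. bm g \<and> L1norm M N (\<lambda>x. f x - g x) \<le> ennreal e \<and> L1norm M N (\<lambda>x. g x - f x) \<le> ennreal e"
proof -
  define g where "g k x = (if cmod (f x) \<le> real k then f x else 0)" for k x
  have fm[measurable]: "f \<in> borel_measurable \<mu>" using f by auto
  have gm[measurable]: "g k \<in> borel_measurable \<mu>" for k unfolding g_def[abs_def] by measurable
  have "(\<lambda>k. \<integral>\<^sup>+x. ennreal (cmod (f x - g k x)) \<partial>\<mu>) \<longlonglongrightarrow> (\<integral>\<^sup>+x. 0 \<partial>\<mu>)"
  proof (rule nn_integral_dominated_convergence[where w = "\<lambda>x. ennreal (cmod (f x))"])
    show "(\<integral>\<^sup>+x. ennreal (cmod (f x)) \<partial>\<mu>) < \<infinity>" using f by (simp add: integrable_iff_bounded)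
    show "AE x in \<mu>. (\<lambda>k. ennreal (cmod (f x - g k x))) \<longlonglongrightarrow> 0"
    proof (rule AE_I2)
      fix x
      obtain k0 where "cmod (f x) \<le> real k0" using real_arch_simple by blast
      then have "ennreal (cmod (f x - g k x)) = 0" if "k \<ge> k0" for k
        using that by (simp add: g_def)
      then have "eventually (\<lambda>k. ennreal (cmod (f x - g k x)) = 0) sequentially"
        by (rule eventually_sequentiallyI)
      then show "(\<lambda>k. ennreal (cmod (f x - g k x))) \<longlonglongrightarrow> 0" by (rule tendsto_eventually)
    qed
  qed (auto simp: g_def)
  then have "(\<lambda>k. L1norm M N (\<lambda>x. f x - g k x)) \<longlonglongrightarrow> 0" by (simp add: L1norm_def prodM_eq)
  then have "eventually (\<lambda>k. L1norm M N (\<lambda>x. f x - g k x) < ennreal e) sequentially"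
    using e by (intro order_tendstoD) auto
  then obtain k where k: "L1norm M N (\<lambda>x. f x - g k x) < ennreal e"
    by (auto simp: eventually_sequentially)
  moreover have "bm (g k)" using gm by (auto simp: bounded_meas_def g_def intro!: exI[of _ "real k"])
  moreover have "L1norm M N (\<lambda>x. g k x - f x) = L1norm M N (\<lambda>x. f x - g k x)"
    by (simp add: L1norm_def norm_minus_commute)
  ultimately show ?thesis by (intro exI[of _ "g k"]) auto
qed

text \<open>Passing to \<open>g\<close> and back costs a multiple of \<open>e\<close> that depends
  on \<open>N\<close>. Letting \<open>e\<close> tend to 0 at fixed \<open>N\<close> leaves the
  uniform constant of the bounded case.\<close>

lemma H1norm_projPk:
  assumes m: "m \<ge> 1" and k: "k \<le> m" and f: "integrable \<mu> f"
  shows "H1norm M N m (projPk M N k f) \<le> 16 ^ m * H1norm M N m f"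
proof (rule ennreal_le_epsilon_mult[where K = "(16 ^ m + real op_const) * real op_const"])
  fix e :: real assume e: "0 < e"
  obtain g where g: "bm g" "L1norm M N (\<lambda>x. f x - g x) \<le> ennreal e" "L1norm M N (\<lambda>x. g x - f x) \<le> ennreal e"
    using bounded_approximation[OF f e] by blast
  have gi: "integrable \<mu> g" using g by (intro integrable_bm)
  have "H1norm M N m (projPk M N k f) \<le> H1norm M N m (projPk M N k g)
      + of_nat op_const * L1norm M N (\<lambda>x. projPk M N k f x - projPk M N k g x)"
    by (intro H1norm_perturbation m integrable_projPk f gi)
  also have "\<dots> \<le> 16 ^ m * H1norm M N m g + of_nat op_const * (of_nat op_const * L1norm M N (\<lambda>x. f x - g x))"
    by (intro add_mono H1norm_projPk_bounded mult_left_mono projPk_L1_bound m k g f gi) auto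
  also have "\<dots> \<le> 16 ^ m * (H1norm M N m f + of_nat op_const * L1norm M N (\<lambda>x. g x - f x))
      + of_nat op_const * (of_nat op_const * L1norm M N (\<lambda>x. f x - g x))"
    by (intro add_mono mult_left_mono H1norm_perturbation m f gi) auto
  also have "\<dots> \<le> 16 ^ m * (H1norm M N m f + of_nat op_const * ennreal e)
      + of_nat op_const * (of_nat op_const * ennreal e)"
    by (intro add_mono mult_left_mono g order_refl) auto
  also have "\<dots> = 16 ^ m * H1norm M N m f + (16 ^ m + of_nat op_const) * of_nat op_const * ennreal e"
    by (simp add: distrib_left distrib_right mult.assoc add.assoc)
  also have "(16 ^ m + of_nat op_const) * of_nat op_const = ennreal ((16 ^ m + real op_const) * real op_const)"
    by (simp add: ennreal_mult ennreal_power[symmetric] ennreal_of_nat_eq_real_of_nat)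
  finally show "H1norm M N m (projPk M N k f) \<le> 16 ^ m * H1norm M N m f
      + ennreal ((16 ^ m + real op_const) * real op_const) * ennreal e" .
qed simp

lemma L1norm_triangle:
  assumes f: "integrable \<mu> f" and g: "integrable \<mu> g"
  shows "L1norm M N f \<le> L1norm M N g + L1norm M N (\<lambda>x. f x - g x)"
proof -
  have "L1norm M N f \<le> (\<integral>\<^sup>+x. ennreal (cmod (g x)) + ennreal (cmod (f x - g x)) \<partial>\<mu>)"
    unfolding L1norm_def prodM_eq
    by (intro nn_integral_mono) (simp add: ennreal_plus[symmetric] norm_triangle_sub ennreal_leI del: ennreal_plus)
  also have "\<dots> = L1norm M N g + L1norm M N (\<lambda>x. f x - g x)"
    unfolding L1norm_def prodM_eq using f g by (intro nn_integral_add) auto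
  finally show ?thesis .
qed

lemma L1norm_minus_commute: "L1norm M N (\<lambda>x. g x - f x) = L1norm M N (\<lambda>x. f x - g x)"
  by (simp add: L1norm_def norm_minus_commute)

lemma L1norm_upper:
  assumes m: "m \<ge> 1" and f: "integrable \<mu> f"
  shows "L1norm M N f \<le> 64 ^ m * H1norm M N m f"
proof (rule ennreal_le_epsilon_mult[where K = "64 ^ m * real op_const + 1"])
  fix e :: real assume e: "0 < e"
  obtain g where g: "bm g" "L1norm M N (\<lambda>x. f x - g x) \<le> ennreal e"
    using bounded_approximation[OF f e] by blast
  have gi: "integrable \<mu> g" using g by (intro integrable_bm)
  have "L1norm M N f \<le> L1norm M N g + L1norm M N (\<lambda>x. f x - g x)"
    by (rule L1norm_triangle[OF f gi])
  also have "\<dots> \<le> 64 ^ m * (H1norm M N m f + of_nat op_const * L1norm M N (\<lambda>x. g x - f x)) + L1norm M N (\<lambda>x. f x - g x)"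
    by (intro add_mono order_trans[OF L1norm_upper_bounded[OF m g(1)]] mult_left_mono H1norm_perturbation m f gi) auto
  also have "\<dots> \<le> 64 ^ m * (H1norm M N m f + of_nat op_const * ennreal e) + ennreal e"
    unfolding L1norm_minus_commute[of g f] by (intro add_mono mult_left_mono g order_refl) auto
  also have "\<dots> = 64 ^ m * H1norm M N m f + (64 ^ m * of_nat op_const + 1) * ennreal e"
    by (simp add: distrib_left distrib_right mult.assoc add.assoc)
  also have "64 ^ m * of_nat op_const + 1 = ennreal (64 ^ m * real op_const + 1)"
    by (simp add: ennreal_mult ennreal_power[symmetric] ennreal_of_nat_eq_real_of_nat)
  finally show "L1norm M N f \<le> 64 ^ m * H1norm M N m f + ennreal (64 ^ m * real op_const + 1) * ennreal e" .
qed simp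

end

subsection \<open>Analytic polynomials on the circle\<close>

text \<open>Reflecting the zeros inside the unit disc does not change the modulus on the circle and
  does not decrease it at the origin.\<close>

lemma zero_free_majorant:
  fixes p :: "complex poly"
  assumes "p \<noteq> 0"
  shows "\<exists>q. (\<forall>z. cmod z = 1 \<longrightarrow> cmod (poly q z) = cmod (poly p z)) \<and>
    (\<forall>z. cmod z < 1 \<longrightarrow> poly q z \<noteq> 0) \<and> cmod (poly p 0) \<le> cmod (poly q 0)"
  using assms
proof (induction "degree p" arbitrary: p rule: less_induct)
  case less
  show ?case
  proof (cases "\<exists>a. cmod a < 1 \<and> poly p a = 0")
    case False
    then show ?thesis by (intro exI[of _ p]) auto
  next
    case True
    then obtain a where a: "cmod a < 1" "poly p a = 0" by blast
    then obtain p1 where p1: "p = [:- a, 1:] * p1" by (metis poly_eq_0_iff_dvd dvd_def)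
    then have "p1 \<noteq> 0" using less.prems by auto
    then have "degree p = Suc (degree p1)" unfolding p1 by (subst degree_mult_eq) auto
    with less.hyps[of p1] \<open>p1 \<noteq> 0\<close> obtain q1 where q1:
      "\<And>z. cmod z = 1 \<Longrightarrow> cmod (poly q1 z) = cmod (poly p1 z)"
      "\<And>z. cmod z < 1 \<Longrightarrow> poly q1 z \<noteq> 0" "cmod (poly p1 0) \<le> cmod (poly q1 0)" by auto
    show ?thesis
    proof (intro exI[of _ "[:1, - cnj a:] * q1"] conjI allI impI)
      fix z :: complex assume z: "cmod z = 1"
      have "cmod (1 - cnj a * z) = cmod (z - a)"
      proof -
        have "z * cnj z = 1" using z complex_norm_square[of z] by simp
        then have "1 - cnj a * z = z * cnj (z - a)" by (simp add: algebra_simps)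
        then have "cmod (1 - cnj a * z) = cmod z * cmod (cnj (z - a))" by (simp only: norm_mult)
        then show ?thesis using z by (simp only: complex_mod_cnj mult_1)
      qed
      moreover have "poly ([:1, - cnj a:] * q1) z = (1 - cnj a * z) * poly q1 z" "poly p z = (z - a) * poly p1 z"
        by (simp_all add: p1 algebra_simps)
      ultimately show "cmod (poly ([:1, - cnj a:] * q1) z) = cmod (poly p z)"
        using q1(1)[OF z] by (simp only: norm_mult)
    next
      fix z :: complex assume z: "cmod z < 1"
      have "cmod (cnj a * z) < 1" using a z mult_strict_mono'[of "cmod a" 1 "cmod z" 1] by (simp add: norm_mult)
      then have "1 - cnj a * z \<noteq> 0" by auto
      then show "poly ([:1, - cnj a:] * q1) z \<noteq> 0" using q1(2)[OF z] by (simp add: mult.commute)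
    next
      have "cmod a * cmod (poly p1 0) \<le> 1 * cmod (poly q1 0)"
        using a q1(3) by (intro mult_mono) auto
      then show "cmod (poly p 0) \<le> cmod (poly ([:1, - cnj a:] * q1) 0)"
        by (simp add: p1 norm_mult)
    qed
  qed
qed

text \<open>Without zeros in the disc, \<open>q\<close> has a holomorphic square root
  \<open>h\<close>, whose modulus is the root of that of \<open>q\<close>; the mean value property
  of \<open>h\<close> gives the bound. The radius stays below 1 because \<open>q\<close> may vanish
  on the unit circle.\<close>

lemma sqrt_norm_le_circle_mean:
  fixes q :: "complex poly"
  assumes nz: "\<And>z. cmod z < 1 \<Longrightarrow> poly q z \<noteq> 0" and r: "0 < r" "r < 1"
  shows "2 * pi * sqrt (cmod (poly q 0)) \<le> integral {0..2*pi} (\<lambda>t. sqrt (cmod (poly q (of_real r * cis t))))"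
proof -
  have "poly q holomorphic_on ball 0 1" by (intro holomorphic_intros)
  then obtain h where h: "h holomorphic_on ball 0 1" "\<And>z. z \<in> ball 0 1 \<Longrightarrow> poly q z = h z ^ 2"
    using contractible_imp_holomorphic_sqrt[of "poly q" "ball 0 1"] nz
    by (metis convex_ball convex_imp_contractible mem_ball_0)
  have sub: "cball (0::complex) r \<subseteq> ball 0 1" using r by auto
  have "((\<lambda>u. h u / (u - 0)) has_contour_integral (2 * of_real pi * \<i> * h 0)) (circlepath 0 r)"
    using r by (intro Cauchy_integral_circlepath_simple holomorphic_on_subset[OF h(1) sub]) auto
  then have "((\<lambda>t. h (0 + r * cis t) / (0 + r * cis t - 0) * r * \<i> * cis t) has_integral (2 * of_real pi * \<i> * h 0)) {0..2*pi}"
    unfolding circlepath_def by (subst (asm) has_contour_integral_part_circlepath_iff) auto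
  moreover have "(\<lambda>t. h (0 + r * cis t) / (0 + r * cis t - 0) * r * \<i> * cis t) = (\<lambda>t. \<i> * h (r * cis t))"
    using r by (simp add: fun_eq_iff)
  ultimately have hi: "((\<lambda>t. \<i> * h (r * cis t)) has_integral (2 * of_real pi * \<i> * h 0)) {0..2*pi}" by (simp only:)
  have hn: "cmod (h z) = sqrt (cmod (poly q z))" if "cmod z < 1" for z
    using h(2)[of z] that by (simp add: norm_power)
  have rn: "cmod (r * cis t) < 1" for t using r by (simp add: norm_mult)
  have "cmod (2 * of_real pi * \<i> * h 0) \<le> integral {0..2*pi} (\<lambda>t. sqrt (cmod (poly q (of_real r * cis t))))"
    unfolding integral_unique[OF hi, symmetric]
  proof (rule integral_norm_bound_integral)
    show "(\<lambda>t. sqrt (cmod (poly q (of_real r * cis t)))) integrable_on {0..2*pi}"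
      by (intro integrable_continuous_interval continuous_intros)
  qed (use hi hn rn in \<open>auto simp: norm_mult\<close>)
  then show ?thesis by (simp add: norm_mult hn)
qed

text \<open>Apply the bound to the zero-free majorant and let the radius tend to 1; the circle means
  depend continuously on the radius up to 1.\<close>

lemma sqrt_norm_poly_le_integral:
  fixes p :: "complex poly"
  shows "2 * pi * sqrt (cmod (poly p 0)) \<le> integral {0..2*pi} (\<lambda>t. sqrt (cmod (poly p (cis t))))"
proof (cases "p = 0")
  case False
  then obtain q where q: "\<And>z. cmod z = 1 \<Longrightarrow> cmod (poly q z) = cmod (poly p z)"
    "\<And>z. cmod z < 1 \<Longrightarrow> poly q z \<noteq> 0" "cmod (poly p 0) \<le> cmod (poly q 0)"
    using zero_free_majorant by blast
  define \<Phi> where "\<Phi> r = integral (cbox 0 (2*pi)) (\<lambda>t. sqrt (cmod (poly q (of_real r * cis t))))" for r :: real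
  have "continuous_on {0..1} \<Phi>" unfolding \<Phi>_def
    by (intro integral_continuous_on_param) (auto simp: case_prod_beta' intro!: continuous_intros)
  then have "(\<Phi> \<longlongrightarrow> \<Phi> 1) (at 1 within {0..1})" by (simp add: continuous_on_def)
  then have lim: "(\<Phi> \<longlongrightarrow> \<Phi> 1) (at_left 1)"
    by (metis at_within_Icc_at_left zero_less_one)
  have ev: "eventually (\<lambda>r. 2 * pi * sqrt (cmod (poly q 0)) \<le> \<Phi> r) (at_left 1)"
    using eventually_at_left_real[OF zero_less_one]
    by eventually_elim (use sqrt_norm_le_circle_mean[of q] q(2) in \<open>auto simp: \<Phi>_def\<close>)
  have "2 * pi * sqrt (cmod (poly p 0)) \<le> 2 * pi * sqrt (cmod (poly q 0))" using q(3) by simp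
  also have "\<dots> \<le> \<Phi> 1" using ev lim by (intro tendsto_lowerbound[OF lim]) auto
  also have "\<dots> = integral {0..2*pi} (\<lambda>t. sqrt (cmod (poly p (cis t))))"
    by (simp add: \<Phi>_def q(1))
  finally show ?thesis .
qed simp

section \<open>The normalized measure on the circle\<close>

lemma prob_space_torus: "prob_space torus"
  unfolding torus_def by (rule prob_space_uniform_measure) auto

lemma space_torus [simp]: "space torus = UNIV"
  and sets_torus [measurable_cong, simp]: "sets torus = sets borel"
  by (simp_all add: torus_def)

lemma integral_torus:
  fixes g :: "real \<Rightarrow> 'b::euclidean_space"
  assumes g: "continuous_on UNIV g"
  shows "(\<integral>t. g t \<partial>torus) = integral {0..2*pi} g /\<^sub>R (2 * pi)"
proof -
  have gm: "g \<in> borel_measurable lborel" using g by (simp add: borel_measurable_continuous_onI)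
  have e: "emeasure lborel {0..<2*pi} = ennreal (2 * pi)" by simp
  have "torus = density lborel (\<lambda>x. ennreal (indicator {0..<2*pi} x / (2 * pi)))"
    unfolding torus_def uniform_measure_def e
    by (intro density_cong) (auto simp: indicator_def divide_ennreal[symmetric])
  then have "(\<integral>t. g t \<partial>torus) = (\<integral>t. (indicator {0..<2*pi} t / (2 * pi)) *\<^sub>R g t \<partial>lborel)"
    using integral_density[OF gm, of "\<lambda>x. indicator {0..<2*pi} x / (2 * pi)"] by simp
  also have "\<dots> = (\<integral>t. (indicator {0..2*pi} t *\<^sub>R g t) /\<^sub>R (2 * pi) \<partial>lborel)"
  proof (rule integral_cong_AE)
    have "AE t in lborel. t \<noteq> 2 * pi" by (rule AE_lborel_singleton)
    then show "AE t in lborel. (indicator {0..<2*pi} t / (2 * pi)) *\<^sub>R g t = (indicator {0..2*pi} t *\<^sub>R g t) /\<^sub>R (2 * pi)"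
      by eventually_elim (auto simp: indicator_def inverse_eq_divide)
  qed (use gm in measurable)
  also have "\<dots> = (LINT t:{0..2*pi}|lborel. g t) /\<^sub>R (2 * pi)"
    unfolding set_lebesgue_integral_def by (rule integral_scaleR_right)
  also have "(LINT t:{0..2*pi}|lborel. g t) = integral {0..2*pi} g"
    using g by (intro set_borel_integral_eq_integral borel_integrable_atLeastAtMost') (auto intro: continuous_on_subset)
  finally show ?thesis .
qed

lemma integral_torus_exp:
  "(\<integral>t. exp (\<i> * of_real (of_int k * t)) \<partial>torus) = (if k = 0 then 1 else 0)"
proof (cases "k = 0")
  case True
  then show ?thesis using prob_space.prob_space[OF prob_space_torus] by simp
next
  case False
  let ?F = "\<lambda>t. exp (\<i> * of_real (of_int k * t)) / (\<i> * of_int k)"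
  have "((\<lambda>t. exp (\<i> * of_real (of_int k * t))) has_integral (?F (2*pi) - ?F 0)) {0..2*pi}"
  proof (rule fundamental_theorem_of_calculus)
    fix t assume "t \<in> {0..2*pi}"
    show "(?F has_vector_derivative exp (\<i> * of_real (of_int k * t))) (at t within {0..2*pi})"
      using False by (auto intro!: derivative_eq_intros has_vector_derivative_real_field simp: field_simps)
  qed auto
  moreover have "?F (2*pi) = ?F 0"
  proof -
    have "exp (\<i> * of_real (of_int k * (2 * pi))) = exp (complex_of_real (2 * of_int k * pi) * \<i>)"
      by (simp add: mult_ac)
    also have "\<dots> = 1" by (intro exp_integer_2pi Ints_of_int)
    finally show ?thesis by simp
  qed
  ultimately have "integral {0..2*pi} (\<lambda>t. exp (\<i> * of_real (of_int k * t))) = 0"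
    by (simp add: integral_unique)
  moreover have "continuous_on UNIV (\<lambda>t. exp (\<i> * of_real (of_int k * t)))" by (intro continuous_intros)
  ultimately show ?thesis using False by (simp only: integral_torus) simp
qed

lemma integral_torus_poly: "(\<integral>t. poly p (cis t) \<partial>torus) = poly p 0"
proof -
  interpret prob_space torus by (rule prob_space_torus)
  have c: "cis t ^ k = exp (\<i> * of_real (of_int (int k) * t))" for t k
    unfolding cis_conv_exp exp_of_nat_mult[symmetric] by (simp add: mult_ac)
  have i: "integrable torus (\<lambda>t. cis t ^ k)" for k
  proof (rule integrable_const_bound[where B = 1])
    have "(\<lambda>t. cis t ^ k) \<in> borel_measurable borel"
      by (intro borel_measurable_continuous_onI continuous_intros)
    then show "(\<lambda>t. cis t ^ k) \<in> borel_measurable torus"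
      by (simp cong: measurable_cong_sets)
  qed (simp add: norm_power)
  have "(\<integral>t. poly p (cis t) \<partial>torus) = (\<integral>t. (\<Sum>k\<le>degree p. coeff p k * cis t ^ k) \<partial>torus)"
    by (simp add: poly_altdef)
  also have "\<dots> = (\<Sum>k\<le>degree p. coeff p k * (\<integral>t. cis t ^ k \<partial>torus))"
    using i by (subst Bochner_Integration.integral_sum) auto
  also have "\<dots> = (\<Sum>k\<le>degree p. if k = 0 then coeff p k else 0)"
    unfolding c integral_torus_exp by (intro sum.cong) auto
  also have "\<dots> = poly p 0" by (simp add: poly_0_coeff_0)
  finally show ?thesis .
qed

lemma half_power_torus:
  "sqrt (cmod (\<integral>t. poly p (cis t) \<partial>torus)) \<le> (\<integral>t. sqrt (cmod (poly p (cis t))) \<partial>torus)"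
proof -
  have "(\<integral>t. sqrt (cmod (poly p (cis t))) \<partial>torus) = integral {0..2*pi} (\<lambda>t. sqrt (cmod (poly p (cis t)))) /\<^sub>R (2 * pi)"
    by (intro integral_torus continuous_intros)
  then have "integral {0..2*pi} (\<lambda>t. sqrt (cmod (poly p (cis t)))) = (2 * pi) * (\<integral>t. sqrt (cmod (poly p (cis t))) \<partial>torus)"
    by (simp add: field_simps)
  then have "(2 * pi) * sqrt (cmod (poly p 0)) \<le> (2 * pi) * (\<integral>t. sqrt (cmod (poly p (cis t))) \<partial>torus)"
    using sqrt_norm_poly_le_integral[of p] by simp
  then show ?thesis unfolding integral_torus_poly by (subst (asm) mult_le_cancel_left_pos) auto
qed

subsection \<open>Characters of the torus\<close>

text \<open>Elementary tensors, on which all operators act factor by factor. Characters and Riesz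
  products are both of this form.\<close>

definition prodf :: "nat \<Rightarrow> (nat \<Rightarrow> 'a \<Rightarrow> complex) \<Rightarrow> (nat \<Rightarrow> 'a) \<Rightarrow> complex" where
  "prodf N g x = (\<Prod>j\<in>{1..N}. g j (x j))"

context coordinate_space
begin

lemma bm_prodf:
  assumes "\<And>j. j \<in> {1..N} \<Longrightarrow> bounded_meas M (g j)"
  shows "bm (prodf N g)"
  unfolding prodf_def[abs_def] using assms
  by (intro bm_prod) (rule bm_compose[OF _ measurable_component_singleton], auto)

lemma integral_prodf:
  assumes "\<And>j. j \<in> {1..N} \<Longrightarrow> bounded_meas M (g j)"
  shows "(\<integral>x. prodf N g x \<partial>\<mu>) = (\<Prod>j\<in>{1..N}. \<integral>c. g j c \<partial>M)"
  unfolding prodf_def using assms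
  by (intro PS.product_integral_prod integrable_bounded_meas) auto

lemma coordE_prodf:
  assumes A: "A \<subseteq> {1..N}" and g: "\<And>j. j \<in> {1..N} \<Longrightarrow> bounded_meas M (g j)" and x: "x \<in> space \<mu>"
  shows "coordE M N A (prodf N g) x = (\<Prod>j\<in>{1..N}. if j \<in> A then g j (x j) else (\<integral>c. g j c \<partial>M))"
proof -
  let ?h = "\<lambda>j c. if j \<in> A then g j (x j) else g j c"
  have "coordE M N A (prodf N g) x = (\<integral>y. prodf N g (mix A x y) \<partial>\<mu>)"
    by (intro coordE_mix A x bm_measurable bm_prodf g)
  also have "\<dots> = (\<integral>y. prodf N ?h y \<partial>\<mu>)"
    by (intro Bochner_Integration.integral_cong refl) (auto simp: prodf_def mix_def intro!: prod.cong)
  also have "\<dots> = (\<Prod>j\<in>{1..N}. \<integral>c. ?h j c \<partial>M)"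
  proof (rule integral_prodf)
    show "bounded_meas M (?h j)" if "j \<in> {1..N}" for j
      using g[OF that] by (cases "j \<in> A") (simp_all add: bm_const)
  qed
  also have "\<dots> = (\<Prod>j\<in>{1..N}. if j \<in> A then g j (x j) else (\<integral>c. g j c \<partial>M))"
    by (intro prod.cong refl) (simp add: prob_space)
  finally show ?thesis .
qed

text \<open>The alternating sum over \<open>B\<close> is the expansion of the product over
  \<open>A\<close> of the differences \<open>g j (x j)\<close> minus mean.\<close>

lemma altE_prodf:
  assumes A: "A \<subseteq> {1..N}" and C: "C \<subseteq> {1..N}" and AC: "A \<inter> C = {}"
    and g: "\<And>j. j \<in> {1..N} \<Longrightarrow> bounded_meas M (g j)" and x: "x \<in> space \<mu>"
  shows "altE C A (prodf N g) x = (\<Prod>j\<in>{1..N}. if j \<in> A then g j (x j) - (\<integral>c. g j c \<partial>M)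
    else if j \<in> C then g j (x j) else (\<integral>c. g j c \<partial>M))"
proof -
  have fA: "finite A" using A finite_subset by blast
  let ?e = "\<lambda>j. \<integral>c. g j c \<partial>M"
  let ?r = "\<Prod>j\<in>{1..N} - A. if j \<in> C then g j (x j) else ?e j"
  have split: "(\<Prod>j\<in>{1..N}. h j) = (\<Prod>j\<in>A. h j) * (\<Prod>j\<in>{1..N} - A. h j)" for h :: "nat \<Rightarrow> complex"
    using prod.subset_diff[OF A, of h] by (simp add: mult.commute)
  have "coordE M N (B \<union> C) (prodf N g) x = (\<Prod>j\<in>B. g j (x j)) * (\<Prod>j\<in>A - B. ?e j) * ?r" if B: "B \<subseteq> A" for B
  proof -
    have "coordE M N (B \<union> C) (prodf N g) x = (\<Prod>j\<in>{1..N}. if j \<in> B \<union> C then g j (x j) else ?e j)"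
      using B A C by (intro coordE_prodf g x) auto
    also have "\<dots> = (\<Prod>j\<in>A. if j \<in> B then g j (x j) else ?e j) * ?r"
      unfolding split using AC B by (intro arg_cong2[where f = "(*)"] prod.cong) auto
    also have "(\<Prod>j\<in>A. if j \<in> B then g j (x j) else ?e j) =
        (\<Prod>j\<in>B. if j \<in> B then g j (x j) else ?e j) * (\<Prod>j\<in>A - B. if j \<in> B then g j (x j) else ?e j)"
      using prod.subset_diff[OF B fA, of "\<lambda>j. if j \<in> B then g j (x j) else ?e j"] by (simp add: mult.commute)
    also have "\<dots> = (\<Prod>j\<in>B. g j (x j)) * (\<Prod>j\<in>A - B. ?e j)"
      by (intro arg_cong2[where f = "(*)"] prod.cong) auto
    finally show ?thesis .
  qed
  then have "altE C A (prodf N g) x =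
      (\<Sum>B\<in>Pow A. (-1) ^ card (A - B) * ((\<Prod>j\<in>B. g j (x j)) * (\<Prod>j\<in>A - B. ?e j) * ?r))"
    unfolding altE_def by (intro sum.cong refl) auto
  also have "\<dots> = (\<Sum>B\<in>Pow A. (-1) ^ (card A - card B) * (\<Prod>j\<in>B. g j (x j)) * (\<Prod>j\<in>A - B. ?e j)) * ?r"
    unfolding sum_distrib_right using fA
    by (intro sum.cong refl) (simp add: card_Diff_subset finite_subset mult.assoc)
  also have "(\<Sum>B\<in>Pow A. (-1) ^ (card A - card B) * (\<Prod>j\<in>B. g j (x j)) * (\<Prod>j\<in>A - B. ?e j)) =
      (\<Prod>j\<in>A. g j (x j) - ?e j)"
    by (rule prod_diff_conv_sum'[OF fA, symmetric])
  also have "\<dots> * ?r = (\<Prod>j\<in>{1..N}. if j \<in> A then g j (x j) - ?e j else if j \<in> C then g j (x j) else ?e j)"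
    unfolding split by (intro arg_cong2[where f = "(*)"] prod.cong) auto
  finally show ?thesis .
qed

text \<open>Membership in \<open>\<A>\<close> concerns functions on the whole type, whereas the
  given equality holds on the space only; \<open>space M = UNIV\<close> bridges the two in each
  single variable.\<close>

lemma hardy_cong:
  assumes U: "space M = UNIV"
  shows "hardy \<A> m f \<Longrightarrow> bm g \<Longrightarrow> (\<And>x. x \<in> space \<mu> \<Longrightarrow> f x = g x) \<Longrightarrow> hardy \<A> m g"
proof (induction m arbitrary: f g)
  case (Suc m)
  have f: "bm f" using hardy_bm[OF Suc.prems(1)] .
  have E: "coordE M N {1..n} f x = coordE M N {1..n} g x" if "n \<le> N" "x \<in> space \<mu>" for n x
    using that Suc.prems f by (intro coordE_cong bm_measurable) auto
  have D: "mdiff n f x = mdiff n g x" if "n \<le> N" "x \<in> space \<mu>" for n x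
    using E[of n x] E[of "n - 1" x] that by (cases n) (auto simp: mdiff_Suc, simp add: mdiff_def)
  have A: "(\<lambda>c. coordE M N {1..n} g (x(n := c))) = (\<lambda>c. coordE M N {1..n} f (x(n := c)))"
    if "n \<in> {1..N}" "x \<in> space \<mu>" for n x
    using that U upd_in_space[of x _ n] by (intro ext E[symmetric]) auto
  show ?case unfolding hardy.simps
  proof (intro conjI ballI)
    fix n x assume nx: "n \<in> {1..N}" "x \<in> space \<mu>"
    show "(\<lambda>c. coordE M N {1..n} g (x(n := c))) \<in> \<A>"
      unfolding A[OF nx] using Suc.prems(1) nx by auto
  next
    show "hardy \<A> m (mdiff 0 g)"
    proof (rule Suc.IH[of "mdiff 0 f"])
      show "hardy \<A> m (mdiff 0 f)" using Suc.prems(1) by simp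
      show "bm (mdiff 0 g)" by (intro bm_mdiff Suc.prems(2)) simp
    qed (rule D, simp_all)
  next
    fix n c assume nc: "n \<in> {1..N}" "c \<in> space M"
    show "hardy \<A> m (\<lambda>x. mdiff n g (x(n := c)))"
    proof (rule Suc.IH[of "\<lambda>x. mdiff n f (x(n := c))"])
      show "hardy \<A> m (\<lambda>x. mdiff n f (x(n := c)))" using Suc.prems(1) nc by simp
      show "bm (\<lambda>x. mdiff n g (x(n := c)))" using nc Suc.prems by (intro bm_upd bm_mdiff) auto
      show "mdiff n f (x(n := c)) = mdiff n g (x(n := c))" if "x \<in> space \<mu>" for x
        using nc that by (intro D upd_in_space) auto
    qed
  qed (rule Suc.prems)
qed simp

lemma mdiff_sum:
  assumes "n \<le> N" "\<And>i. i \<in> S \<Longrightarrow> bm (f i)" "x \<in> space \<mu>"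
  shows "mdiff n (\<lambda>x. \<Sum>i\<in>S. w i * f i x) x = (\<Sum>i\<in>S. w i * mdiff n (f i) x)"
proof -
  have E: "coordE M N A (\<lambda>x. \<Sum>i\<in>S. w i * f i x) x = (\<Sum>i\<in>S. w i * coordE M N A (f i) x)" if "A \<subseteq> {1..N}" for A
    using that assms by (subst coordE_sum) (auto simp: coordE_cmult intro: bm_cmult)
  show ?thesis
  proof (cases n)
    case 0
    then show ?thesis using E[of "{}"] by (simp add: mdiff_def)
  next
    case (Suc k)
    then show ?thesis using E[of "{1..n}"] E[of "{1..k}"] assms(1)
      by (simp add: mdiff_Suc right_diff_distrib sum_subtractf)
  qed
qed

lemma hardy_lin:
  assumes U: "space M = UNIV"
    and lin: "\<And>I w (g :: 'i \<Rightarrow> 'a \<Rightarrow> complex). finite I \<Longrightarrow> (\<And>i. i \<in> I \<Longrightarrow> g i \<in> \<A>) \<Longrightarrow>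
      (\<lambda>c. \<Sum>i\<in>I. w i * g i c) \<in> \<A>"
    and S: "finite (S :: 'i set)"
  shows "(\<And>i. i \<in> S \<Longrightarrow> hardy \<A> m (f i)) \<Longrightarrow> hardy \<A> m (\<lambda>x. \<Sum>i\<in>S. w i * f i x)"
proof (induction m arbitrary: f)
  case 0
  then show ?case by (auto intro!: bm_sum bm_cmult)
next
  case (Suc m)
  have f: "bm (f i)" if "i \<in> S" for i using hardy_bm[OF Suc.prems[OF that]] .
  let ?F = "\<lambda>x. \<Sum>i\<in>S. w i * f i x"
  have F: "bm ?F" using f by (intro bm_sum bm_cmult)
  show ?case unfolding hardy.simps
  proof (intro conjI ballI)
    fix n x assume nx: "n \<in> {1..N}" "x \<in> space \<mu>"
    have "coordE M N {1..n} ?F (x(n := c)) = (\<Sum>i\<in>S. w i * coordE M N {1..n} (f i) (x(n := c)))" for c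
      using nx U f upd_in_space[of x c n] by (subst coordE_sum) (auto simp: coordE_cmult intro: bm_cmult)
    then have "(\<lambda>c. coordE M N {1..n} ?F (x(n := c))) = (\<lambda>c. \<Sum>i\<in>S. w i * coordE M N {1..n} (f i) (x(n := c)))"
      by (simp add: fun_eq_iff)
    also have "\<dots> \<in> \<A>" using Suc.prems nx by (intro lin S) auto
    finally show "(\<lambda>c. coordE M N {1..n} ?F (x(n := c))) \<in> \<A>" .
  next
    have "hardy \<A> m (\<lambda>x. \<Sum>i\<in>S. w i * mdiff 0 (f i) x)" using Suc.prems by (intro Suc.IH) auto
    then show "hardy \<A> m (mdiff 0 ?F)"
      by (rule hardy_cong[OF U]) (auto intro!: bm_mdiff F mdiff_sum[symmetric] f)
  next
    fix n c assume nc: "n \<in> {1..N}" "c \<in> space M"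
    have "hardy \<A> m (\<lambda>x. \<Sum>i\<in>S. w i * mdiff n (f i) (x(n := c)))"
      using Suc.prems nc by (intro Suc.IH) (auto simp del: fun_upd_apply)
    then show "hardy \<A> m (\<lambda>x. mdiff n ?F (x(n := c)))"
    proof (rule hardy_cong[OF U])
      show "bm (\<lambda>x. mdiff n ?F (x(n := c)))" using nc by (intro bm_upd bm_mdiff F) auto
      show "(\<Sum>i\<in>S. w i * mdiff n (f i) (x(n := c))) = mdiff n ?F (x(n := c))" if "x \<in> space \<mu>" for x
        using nc that f by (intro mdiff_sum[symmetric] upd_in_space) auto
    qed
  qed (rule F)
qed

end

section \<open>Analytic trigonometric polynomials and admissible characters\<close>

definition analytic_polys :: "(real \<Rightarrow> complex) set" where
  "analytic_polys = range (\<lambda>p c. poly p (cis c))"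

lemma analytic_polys_half_power:
  "g \<in> analytic_polys \<Longrightarrow> sqrt (cmod (\<integral>c. g c \<partial>torus)) \<le> (\<integral>c. sqrt (cmod (g c)) \<partial>torus)"
  using half_power_torus by (auto simp: analytic_polys_def)

lemma analytic_polys_lin:
  assumes "finite I" "\<And>i. i \<in> I \<Longrightarrow> g i \<in> analytic_polys"
  shows "(\<lambda>c. \<Sum>i\<in>I. w i * g i c) \<in> analytic_polys"
proof -
  obtain p where p: "\<And>i. i \<in> I \<Longrightarrow> g i = (\<lambda>c. poly (p i) (cis c))"
    using assms(2) unfolding analytic_polys_def image_iff by metis
  have "(\<lambda>c. \<Sum>i\<in>I. w i * g i c) = (\<lambda>c. poly (\<Sum>i\<in>I. smult (w i) (p i)) (cis c))"
    by (simp add: poly_sum p fun_eq_iff)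
  then show ?thesis by (auto simp: analytic_polys_def)
qed

definition echar :: "int \<Rightarrow> real \<Rightarrow> complex" where
  "echar k c = exp (\<i> * of_real (of_int k * c))"

lemma echar_0 [simp]: "echar 0 c = 1"
  by (simp add: echar_def)

lemma norm_echar [simp]: "cmod (echar k c) = 1"
  by (simp add: echar_def)

lemma integral_echar: "(\<integral>c. echar k c \<partial>torus) = (if k = 0 then 1 else 0)"
  unfolding echar_def by (rule integral_torus_exp)

lemma bounded_meas_torus: "continuous_on UNIV g \<Longrightarrow> (\<And>c. norm (g c) \<le> K) \<Longrightarrow> bounded_meas torus g"
  using borel_measurable_continuous_onI[of g]
  by (auto simp: bounded_meas_def cong: measurable_cong_sets)

lemma bm_echar: "bounded_meas torus (echar k)"
  by (rule bounded_meas_torus[where K = 1]) (auto simp: echar_def[abs_def] intro!: continuous_intros)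

lemma echar_nonneg: "0 \<le> k \<Longrightarrow> echar k c = cis c ^ nat k"
  by (simp add: echar_def cis_conv_exp exp_of_nat_mult[symmetric] mult_ac)

lemma echar_analytic: "0 \<le> k \<Longrightarrow> (\<lambda>c. z * echar k c) \<in> analytic_polys"
  unfolding analytic_polys_def
  by (rule image_eqI[of _ _ "monom z (nat k)"]) (simp_all add: poly_monom echar_nonneg)

lemma torus_char_prodf: "torus_char N n = prodf N (\<lambda>j. echar (n j))"
proof
  fix t
  have "\<i> * complex_of_real (\<Sum>j\<in>{1..N}. real_of_int (n j) * t j) =
      (\<Sum>j\<in>{1..N}. \<i> * complex_of_real (real_of_int (n j) * t j))"
    by (simp only: of_real_sum sum_distrib_left)
  then show "torus_char N n t = prodf N (\<lambda>j. echar (n j)) t"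
    by (simp only: torus_char_def prodf_def echar_def exp_sum[OF finite_atLeastAtMost])
qed

interpretation torus: prob_space torus
  by (rule prob_space_torus)

lemma coordinate_space_torus: "coordinate_space torus"
  by unfold_locales

text \<open>Deleting the last nonzero entry lowers by one both the size of the support and the
  number of later entries counted at each remaining index, so the two cases of
  \<open>admissible\<close> correspond. The deleted entry has no later ones, hence is positive in
  either case.\<close>

lemma admissible_drop_last:
  assumes adm: "admissible (Suc m) N n" and l: "l \<in> {1..N}" "n l \<noteq> 0" and last: "\<And>j. l < j \<Longrightarrow> n j = 0"
  shows "0 < n l" "admissible m N (n(l := 0))"
proof -
  define S where "S = {j \<in> {1..N}. n j \<noteq> 0}"
  define S' where "S' = {j \<in> {1..N}. (n(l := 0)) j \<noteq> 0}"
  have lS: "l \<in> S" "finite S" using l by (auto simp: S_def)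
  have S': "S' = S - {l}" by (auto simp: S_def S'_def)
  have c: "card S = Suc (card S')" unfolding S' by (rule card.remove[OF lS(2,1)])
  have lt: "j < l" if "j \<in> S'" for j
    using that last[of j] unfolding S'_def by (cases j l rule: linorder_cases) auto
  have a1: "\<And>i. card S \<ge> Suc m \<Longrightarrow> i \<in> S \<Longrightarrow> card {j \<in> S. i < j} < Suc m \<Longrightarrow> n i > 0"
    and a2: "\<And>j. card S < Suc m \<Longrightarrow> n j \<ge> 0" and a3: "\<And>j. j \<notin> {1..N} \<Longrightarrow> n j = 0"
    using adm unfolding admissible_def Let_def S_def by auto
  show "0 < n l"
  proof (cases "card S \<ge> Suc m")
    case True
    have e: "{j \<in> S. l < j} = {}" using last by (auto simp: S_def)
    show ?thesis by (rule a1[OF True lS(1)]) (simp only: e card.empty zero_less_Suc)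
  next
    case False
    then show ?thesis using a2[of l] l by simp
  qed
  show "admissible m N (n(l := 0))"
    unfolding admissible_def Let_def S'_def[symmetric]
  proof (intro conjI allI impI ballI)
    fix j assume "j \<notin> {1..N}"
    then show "(n(l := 0)) j = 0" using a3 by simp
  next
    fix i assume i: "m \<le> card S'" "i \<in> S'" "card {j \<in> S'. i < j} < m"
    have "{j \<in> S. i < j} = insert l {j \<in> S'. i < j}" using lt[OF i(2)] lS by (auto simp: S')
    then have "card {j \<in> S. i < j} < Suc m" using i lS by (simp add: S' card_insert_if)
    then have "n i > 0" using i c by (intro a1) (auto simp: S')
    then show "0 < (n(l := 0)) i" using i by (auto simp: S')
  next
    fix j assume "card S' < m"
    then show "0 \<le> (n(l := 0)) j" using a2[of j] c by simp
  qed
qed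

lemma admissible_zero: "admissible m N (\<lambda>_. 0)"
  by (auto simp: admissible_def)

context
  fixes N :: nat
begin

interpretation T: coordinate_space torus N
  by (rule coordinate_space_torus)

lemma bm_torus_char: "T.bm (torus_char N n)"
  unfolding torus_char_prodf by (intro T.bm_prodf bm_echar)

lemma coordE_torus_char:
  assumes l: "l \<le> N" and x: "x \<in> space T.\<mu>"
  shows "coordE torus N {1..l} (torus_char N n) x = (if \<forall>j\<in>{1..N}. l < j \<longrightarrow> n j = 0 then torus_char N n x else 0)"
proof -
  have "coordE torus N {1..l} (torus_char N n) x =
      (\<Prod>j\<in>{1..N}. if j \<in> {1..l} then echar (n j) (x j) else if n j = 0 then 1 else 0)"
    unfolding torus_char_prodf using l x
    by (subst T.coordE_prodf) (auto intro: bm_echar simp: integral_echar intro!: prod.cong)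
  also have "\<dots> = (if \<forall>j\<in>{1..N}. l < j \<longrightarrow> n j = 0 then torus_char N n x else 0)"
  proof (cases "\<forall>j\<in>{1..N}. l < j \<longrightarrow> n j = 0")
    case True
    have "(if j \<in> {1..l} then echar (n j) (x j) else if n j = 0 then 1 else 0) = echar (n j) (x j)"
      if "j \<in> {1..N}" for j
      using bspec[OF True that] that by (cases "j \<le> l") auto
    then have "(\<Prod>j\<in>{1..N}. if j \<in> {1..l} then echar (n j) (x j) else if n j = 0 then 1 else 0) = torus_char N n x"
      unfolding torus_char_prodf prodf_def by (intro prod.cong refl)
    then show ?thesis by (simp only: if_P[OF True])
  next
    case False
    then obtain j where "j \<in> {1..N}" "l < j" "n j \<noteq> 0" by blast
    then have "(\<Prod>j\<in>{1..N}. if j \<in> {1..l} then echar (n j) (x j) else if n j = 0 then 1 else 0) = 0"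
      by (intro prod_zero bexI[of _ j]) auto
    then show ?thesis using False by (simp only: if_False)
  qed
  finally show ?thesis .
qed

lemma torus_char_upd:
  assumes "l \<in> {1..N}"
  shows "torus_char N n (x(l := c)) = torus_char N (n(l := 0)) x * echar (n l) c"
proof -
  have "torus_char N n (x(l := c)) = echar (n l) c * (\<Prod>j\<in>{1..N} - {l}. echar (n j) (x j))"
    unfolding torus_char_prodf prodf_def using assms by (subst prod.remove[of _ l]) (auto intro!: prod.cong)
  also have "(\<Prod>j\<in>{1..N} - {l}. echar (n j) (x j)) = torus_char N (n(l := 0)) x"
    unfolding torus_char_prodf prodf_def using assms
    by (subst (2) prod.remove[of _ l]) (auto intro!: prod.cong)
  finally show ?thesis by (simp only: mult.commute)
qed

lemma mdiff_torus_char: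
  assumes l: "l \<in> {1..N}" and x: "x \<in> space T.\<mu>"
  shows "T.mdiff l (torus_char N n) x =
    (if n l \<noteq> 0 \<and> (\<forall>j\<in>{1..N}. l < j \<longrightarrow> n j = 0) then torus_char N n x else 0)"
proof -
  obtain k where k: "l = Suc k" using l by (cases l) auto
  have "(\<forall>j\<in>{1..N}. k < j \<longrightarrow> n j = 0) \<longleftrightarrow> n l = 0 \<and> (\<forall>j\<in>{1..N}. l < j \<longrightarrow> n j = 0)"
  proof -
    have "k < j \<longleftrightarrow> j = l \<or> l < j" for j using k by auto
    then show ?thesis using l by auto
  qed
  then show ?thesis using l x k by (auto simp: T.mdiff_Suc coordE_torus_char)
qed

lemma hardy_zero: "T.hardy analytic_polys m (\<lambda>_. 0)"
proof -
  have "T.hardy analytic_polys m (\<lambda>x. \<Sum>i\<in>({} :: nat set). 0 * 0)"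
    by (intro T.hardy_lin analytic_polys_lin) auto
  then show ?thesis by simp
qed

text \<open>For \<open>l\<close> in \<open>{1..N}\<close>, \<open>mdiff l\<close> keeps the
  character if \<open>l\<close> is its last nonzero index and kills it otherwise. Freezing that
  coordinate leaves a constant of modulus 1 times the character with entry \<open>l\<close> deleted,
  which is admissible at one order less.\<close>

lemma hardy_torus_char:
  "admissible m N n \<Longrightarrow> T.hardy analytic_polys m (torus_char N n)"
proof (induction m arbitrary: n)
  case 0
  then show ?case by (simp add: bm_torus_char)
next
  case (Suc m)
  have out: "n j = 0" if "j \<notin> {1..N}" for j using Suc.prems that by (auto simp: admissible_def)
  show ?case unfolding T.hardy.simps
  proof (intro conjI ballI)
    fix l x assume lx: "l \<in> {1..N}" "x \<in> space T.\<mu>"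
    have sp: "x(l := c) \<in> space T.\<mu>" for c using T.upd_in_space[OF lx(2) _ lx(1)] by simp
    show "(\<lambda>c. coordE torus N {1..l} (torus_char N n) (x(l := c))) \<in> analytic_polys"
    proof (cases "\<forall>j\<in>{1..N}. l < j \<longrightarrow> n j = 0")
      case True
      have "0 \<le> n l"
      proof (cases "n l = 0")
        case False
        then show ?thesis using admissible_drop_last(1)[OF Suc.prems lx(1)] True out by fastforce
      qed simp
      then have "(\<lambda>c. torus_char N (n(l := 0)) x * echar (n l) c) \<in> analytic_polys" by (rule echar_analytic)
      moreover have "(\<lambda>c. coordE torus N {1..l} (torus_char N n) (x(l := c))) =
          (\<lambda>c. torus_char N (n(l := 0)) x * echar (n l) c)"
        using True lx sp by (intro ext) (simp add: coordE_torus_char torus_char_upd del: fun_upd_apply)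
      ultimately show ?thesis by simp
    next
      case False
      have "(\<lambda>c. coordE torus N {1..l} (torus_char N n) (x(l := c))) = (\<lambda>c. 0 * echar 0 c)"
        using False lx sp by (intro ext) (auto simp: coordE_torus_char simp del: fun_upd_apply)
      then show ?thesis using echar_analytic[of 0 0] by simp
    qed
  next
    have e: "T.mdiff 0 (torus_char N n) x = (if \<forall>j\<in>{1..N}. n j = 0 then torus_char N n x else 0)"
      if "x \<in> space T.\<mu>" for x
      using coordE_torus_char[of 0 x n] that by (simp add: T.mdiff_def)
    show "T.hardy analytic_polys m (T.mdiff 0 (torus_char N n))"
    proof (cases "\<forall>j\<in>{1..N}. n j = 0")
      case True
      then have "n j = 0" for j using out by (cases "j \<in> {1..N}") auto
      then have "n = (\<lambda>_. 0)" by auto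
      then have "T.hardy analytic_polys m (torus_char N n)" by (simp add: Suc.IH admissible_zero)
      then show ?thesis
        by (rule T.hardy_cong[rotated]) (use True in \<open>auto simp: e intro!: T.bm_mdiff bm_torus_char\<close>)
    next
      case False
      show ?thesis
        by (rule T.hardy_cong[OF _ hardy_zero]) (use False in \<open>auto simp: e intro!: T.bm_mdiff bm_torus_char\<close>)
    qed
  next
    fix l and c :: real assume l: "l \<in> {1..N}"
    have b: "T.bm (\<lambda>x. T.mdiff l (torus_char N n) (x(l := c)))"
      using l by (intro T.bm_upd T.bm_mdiff bm_torus_char) auto
    have sp: "x(l := c) \<in> space T.\<mu>" if "x \<in> space T.\<mu>" for x using T.upd_in_space[OF that _ l] by simp
    show "T.hardy analytic_polys m (\<lambda>x. T.mdiff l (torus_char N n) (x(l := c)))"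
    proof (cases "n l \<noteq> 0 \<and> (\<forall>j\<in>{1..N}. l < j \<longrightarrow> n j = 0)")
      case True
      then have "admissible m N (n(l := 0))" using out by (intro admissible_drop_last(2)[OF Suc.prems l]) fastforce+
      then have "T.hardy analytic_polys m (\<lambda>x. \<Sum>i\<in>{0::nat}. echar (n l) c * torus_char N (n(l := 0)) x)"
        by (intro T.hardy_lin analytic_polys_lin Suc.IH) (auto simp del: fun_upd_apply)
      then show ?thesis
        by (rule T.hardy_cong[rotated])
          (use True l sp b in \<open>auto simp: mdiff_torus_char torus_char_upd simp del: fun_upd_apply\<close>)
    next
      case False
      show ?thesis
        by (rule T.hardy_cong[OF _ hardy_zero]) (use False l sp b in \<open>auto simp: mdiff_torus_char simp del: fun_upd_apply\<close>)
    qed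
  qed (rule bm_torus_char)
qed

text \<open>Polynomials with admissible frequencies satisfy \<open>hardy\<close> by linearity. The
  closed span is reached by approximation, with errors that vanish at fixed
  \<open>N\<close>.\<close>

lemma H1norm_le_L1norm_torus:
  assumes m: "m \<ge> 1" and f: "f \<in> H1last m N"
  shows "H1norm torus N m f \<le> 240 ^ m * L1norm torus N f"
proof (rule ennreal_le_epsilon_mult[where K = "240 ^ m + real T.op_const"])
  fix e :: real assume e: "0 < e"
  have fi: "integrable T.\<mu> f" using f by (simp add: H1last_def prodM_def)
  obtain S c where S: "finite S" "S \<subseteq> {n. admissible m N n}"
    "L1norm torus N (\<lambda>t. f t - (\<Sum>n\<in>S. c n * torus_char N n t)) < ennreal e"
    using f e unfolding H1last_def by blast
  define g where "g t = (\<Sum>n\<in>S. c n * torus_char N n t)" for t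
  have hg: "T.hardy analytic_polys m g" unfolding g_def[abs_def]
    using S by (intro T.hardy_lin analytic_polys_lin hardy_torus_char) auto
  have bg: "T.bm g" using hg by (rule T.hardy_bm)
  have gi: "integrable T.\<mu> g" using bg by (rule T.integrable_bm)
  have d: "L1norm torus N (\<lambda>x. f x - g x) \<le> ennreal e" using S(3) by (simp add: g_def)
  have lower: "H1norm torus N m g \<le> 240 ^ m * L1norm torus N g"
    unfolding T.H1norm_Hnorm[OF m] T.L1norm_Hnorm[OF bg]
    using hg by (intro T.norm_lower[of analytic_polys] analytic_polys_half_power analytic_polys_lin) auto
  have "H1norm torus N m f \<le> H1norm torus N m g + of_nat T.op_const * L1norm torus N (\<lambda>x. f x - g x)"
    by (rule T.H1norm_perturbation[OF m fi gi])
  also have "\<dots> \<le> 240 ^ m * (L1norm torus N f + L1norm torus N (\<lambda>x. g x - f x))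
      + of_nat T.op_const * L1norm torus N (\<lambda>x. f x - g x)"
    by (intro add_mono order_trans[OF lower] mult_left_mono T.L1norm_triangle fi gi) auto
  also have "\<dots> \<le> 240 ^ m * (L1norm torus N f + ennreal e) + of_nat T.op_const * ennreal e"
    unfolding T.L1norm_minus_commute[of g f] by (intro add_mono mult_left_mono d order_refl) auto
  also have "\<dots> = 240 ^ m * L1norm torus N f + (240 ^ m + of_nat T.op_const) * ennreal e"
    by (simp add: distrib_left distrib_right add.assoc)
  also have "240 ^ m + of_nat T.op_const = ennreal (240 ^ m + real T.op_const)"
    by (simp add: ennreal_power[symmetric] ennreal_of_nat_eq_real_of_nat)
  finally show "H1norm torus N m f \<le> 240 ^ m * L1norm torus N f + ennreal (240 ^ m + real T.op_const) * ennreal e" .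
qed simp

end

subsection \<open>Unboundedness\<close>

text \<open>The Riesz-type product \<open>\<Prod>\<^sub>j (1 + r(x\<^sub>j)) \<Prod>\<^sub>j s(x\<^sub>j)\<close> is a single \<open>m\<close>-fold difference,
  but its \<open>(q + 1)\<close>-st chaos \<open>(\<Sum>\<^sub>j r(x\<^sub>j)) \<Prod>\<^sub>j s(x\<^sub>j)\<close> has norm of order \<open>sqrt k\<close>.\<close>

locale riesz_test = coordinate_space M N for M :: "'a measure" and N +
  fixes k q :: nat and r :: "'a \<Rightarrow> real" and s :: "'a \<Rightarrow> complex" and K :: real
  assumes N: "N = k + q" and k: "1 \<le> k"
    and rm: "r \<in> borel_measurable M" and rK: "\<And>c. c \<in> space M \<Longrightarrow> \<bar>r c\<bar> \<le> K"
    and r1: "\<And>c. c \<in> space M \<Longrightarrow> - 1 \<le> r c" and r0: "(\<integral>c. r c \<partial>M) = 0"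
    and bs: "bounded_meas M s" and s1: "\<And>c. c \<in> space M \<Longrightarrow> cmod (s c) \<le> 1" and s0: "(\<integral>c. s c \<partial>M) = 0"
begin

definition factor :: "nat \<Rightarrow> 'a \<Rightarrow> complex" where
  "factor j c = (if j \<le> k then 1 + complex_of_real (r c) else s c)"

definition part_factor :: "nat \<Rightarrow> nat \<Rightarrow> 'a \<Rightarrow> complex" where
  "part_factor i j c = (if j = i then complex_of_real (r c) else if j \<le> k then 1 else s c)"

definition chaos :: "(nat \<Rightarrow> 'a) \<Rightarrow> complex" where
  "chaos x = (\<Sum>i\<in>{1..k}. prodf N (part_factor i) x)"

lemma br: "bounded_meas M r"
  using rm rK by (auto simp: bounded_meas_def)

lemma bcr: "bounded_meas M (\<lambda>c. complex_of_real (r c))"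
  using br by (auto simp: bounded_meas_def)

lemma bfactor: "bounded_meas M (factor j)"
  unfolding factor_def[abs_def] using bcr bs by (cases "j \<le> k") (auto intro!: bm_add bm_const)

lemma bpart_factor: "bounded_meas M (part_factor i j)"
  unfolding part_factor_def[abs_def] using bcr bs
  by (cases "j = i"; cases "j \<le> k") (auto intro!: bm_const)

lemma integral_factor: "(\<integral>c. factor j c \<partial>M) = (if j \<le> k then 1 else 0)"
proof (cases "j \<le> k")
  case True
  have "(\<integral>c. 1 + complex_of_real (r c) \<partial>M) = 1 + (\<integral>c. complex_of_real (r c) \<partial>M)"
    using integrable_bounded_meas[OF bcr] by (simp add: prob_space)
  then show ?thesis using True r0 by (simp add: factor_def integral_complex_of_real)
qed (simp add: factor_def s0)

lemma bm_riesz: "bm (prodf N factor)"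
  by (intro bm_prodf bfactor)

lemma bm_chaos: "bm chaos"
  unfolding chaos_def[abs_def] by (intro bm_sum bm_prodf bpart_factor)

lemma free_coords_top:
  assumes m: "1 \<le> m" "m \<le> q"
  shows "free_coords True m {Suc (N - m)..N} = {1..N - m}"
proof -
  let ?A = "{Suc (N - m)..N}"
  have "?A \<subseteq> {1..N}" "?A \<noteq> {}" "card ?A = m" using m N by auto
  moreover have "Min ?A = Suc (N - m)" using m N by (intro Min_eqI) auto
  ultimately show ?thesis using free_coords_Min[of ?A] by (simp add: atLeastLessThanSuc_atLeastAtMost)
qed

text \<open>If \<open>A\<close> misses one of the last \<open>m\<close> indices, the factor there is
  \<open>s\<close>, as \<open>m \<le> q\<close>, and has mean zero. That index cannot be free
  either: all \<open>m\<close> elements of \<open>A\<close> would have to lie above it, where fewer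
  than \<open>m\<close> indices remain.\<close>

lemma altE_riesz:
  assumes A: "A \<subseteq> {1..N}" "card A \<le> m" and m: "1 \<le> m" "m \<le> q" and x: "x \<in> space \<mu>"
  shows "altE (free_coords True m A) A (prodf N factor) x = (if A = {Suc (N - m)..N} then prodf N factor x else 0)"
proof -
  let ?C = "free_coords True m A"
  have AC: "A \<inter> ?C = {}" by (auto simp: free_coords_def)
  have e: "altE ?C A (prodf N factor) x = (\<Prod>j\<in>{1..N}. if j \<in> A then factor j (x j) - (\<integral>c. factor j c \<partial>M)
      else if j \<in> ?C then factor j (x j) else (\<integral>c. factor j c \<partial>M))"
    by (intro altE_prodf A AC free_coords_subset bfactor x)
  show ?thesis
  proof (cases "A = {Suc (N - m)..N}")
    case True
    have "card A = m" using True m N by simp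
    have C: "?C = {1..N - m}" unfolding True by (rule free_coords_top[OF m])
    have "altE ?C A (prodf N factor) x = prodf N factor x"
      unfolding e unfolding C prodf_def using True m N by (intro prod.cong refl) (auto simp: integral_factor)
    then show ?thesis using True by simp
  next
    case False
    have fA: "finite A" using A finite_subset by blast
    have "\<not> {Suc (N - m)..N} \<subseteq> A"
    proof
      assume sub: "{Suc (N - m)..N} \<subseteq> A"
      have "card {Suc (N - m)..N} = m" using m N by simp
      then show False using False card_seteq[OF fA sub] A by simp
    qed
    then obtain j where "j \<in> {Suc (N - m)..N}" and j': "j \<notin> A" by blast
    then have j: "Suc (N - m) \<le> j" "j \<le> N" "j \<notin> A" by auto
    have "j \<notin> ?C"
    proof
      assume "j \<in> ?C"
      then have c: "card A = m" "\<forall>a\<in>A. j < a" by (auto simp: free_coords_def split: if_splits)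
      have "A \<subseteq> {Suc j..N}"
      proof
        fix a assume "a \<in> A"
        then show "a \<in> {Suc j..N}" using bspec[OF c(2)] subsetD[OF A(1)] by (simp add: Suc_le_eq)
      qed
      then have "card A \<le> N - j" using card_mono[of "{Suc j..N}" A] by simp
      then show False using c j m by simp
    qed
    then have "altE ?C A (prodf N factor) x = 0"
      unfolding e using j m N by (intro prod_zero bexI[of _ j]) (auto simp: integral_factor)
    then show ?thesis using False by simp
  qed
qed

text \<open>As \<open>r\<close> is at least -1, the factors \<open>1 + r\<close> are nonnegative
  with integral 1, while the factors \<open>s\<close> have modulus at most 1.\<close>

lemma L1norm_riesz: "L1norm M N (prodf N factor) \<le> 1"
proof -
  let ?h = "\<lambda>j c. if j \<le> k then 1 + r c else 1"
  have h: "cmod (factor j c) \<le> ?h j c" "0 \<le> ?h j c" if "c \<in> space M" for j c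
  proof -
    have "cmod (1 + complex_of_real (r c)) = \<bar>1 + r c\<bar>"
      by (metis norm_of_real of_real_1 of_real_add)
    then show "cmod (factor j c) \<le> ?h j c" "0 \<le> ?h j c" using r1[OF that] s1[OF that] by (auto simp: factor_def)
  qed
  have bh: "bounded_meas M (?h j)" for j using br by (cases "j \<le> k") (auto intro!: bm_add bm_const)
  have "cmod (prodf N factor x) \<le> (\<Prod>j\<in>{1..N}. ?h j (x j))" if "x \<in> space \<mu>" for x
    unfolding prodf_def prod_norm[symmetric] using h coord_in_space[OF that] by (intro prod_mono) auto
  then have "L1norm M N (prodf N factor) \<le> (\<integral>\<^sup>+x. ennreal (\<Prod>j\<in>{1..N}. ?h j (x j)) \<partial>\<mu>)"
    unfolding L1norm_def prodM_eq by (intro nn_integral_mono ennreal_leI) auto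
  also have "\<dots> = ennreal (\<integral>x. (\<Prod>j\<in>{1..N}. ?h j (x j)) \<partial>\<mu>)"
  proof (rule nn_integral_eq_integral)
    show "integrable \<mu> (\<lambda>x. \<Prod>j\<in>{1..N}. ?h j (x j))"
      by (intro integrable_bm bm_prod bm_compose[OF bh] measurable_component_singleton) auto
    show "AE x in \<mu>. 0 \<le> (\<Prod>j\<in>{1..N}. ?h j (x j))"
      using h(2) coord_in_space by (intro AE_I2 prod_nonneg) blast
  qed
  also have "(\<integral>x. (\<Prod>j\<in>{1..N}. ?h j (x j)) \<partial>\<mu>) = (\<Prod>j\<in>{1..N}. \<integral>c. ?h j c \<partial>M)"
    by (intro PS.product_integral_prod integrable_bounded_meas bh) auto
  also have "\<dots> = 1"
  proof (intro prod.neutral ballI)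
    fix j
    show "(\<integral>c. ?h j c \<partial>M) = 1" using r0 integrable_bounded_meas[OF br] by (cases "j \<le> k") (auto simp: prob_space)
  qed
  finally show ?thesis by simp
qed

lemma H1norm_riesz:
  assumes m: "1 \<le> m" "m \<le> q"
  shows "H1norm M N m (prodf N factor) \<le> 1"
proof -
  have top: "{Suc (N - m)..N} \<in> {A. A \<subseteq> {1..N} \<and> card A \<le> m}" using m N by auto
  have "sqfun True m (prodf N factor) x = (cmod (prodf N factor x))\<^sup>2" if x: "x \<in> space \<mu>" for x
  proof -
    have "sqfun True m (prodf N factor) x = (\<Sum>A | A \<subseteq> {1..N} \<and> card A \<le> m.
        if A = {Suc (N - m)..N} then (cmod (prodf N factor x))\<^sup>2 else 0)"
      unfolding sqfun_def using m x by (intro sum.cong refl) (simp add: altE_riesz)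
    also have "\<dots> = (cmod (prodf N factor x))\<^sup>2"
      using top by (subst sum.delta) (auto intro: finite_subsets_card)
    finally show ?thesis .
  qed
  then have "H1norm M N m (prodf N factor) = L1norm M N (prodf N factor)"
    unfolding H1norm_eq[OF m(1)] L1norm_def prodM_eq by (intro nn_integral_cong) simp
  then show ?thesis using L1norm_riesz by simp
qed

text \<open>A surviving set contains the last \<open>q\<close> indices, because \<open>s\<close> has
  mean zero, and hence exactly one index \<open>i\<close> up to \<open>k\<close>. The other factors
  \<open>1 + r\<close> contribute their mean 1.\<close>

lemma projPk_riesz:
  assumes x: "x \<in> space \<mu>"
  shows "projPk M N (Suc q) (prodf N factor) x = chaos x"
proof -
  let ?top = "{Suc k..N}"
  have ct: "card ?top = q" using N by simp
  have e: "altE {} A (prodf N factor) x = (\<Prod>j\<in>{1..N}. if j \<in> A then factor j (x j) - (\<integral>c. factor j c \<partial>M)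
      else (\<integral>c. factor j c \<partial>M))" if "A \<subseteq> {1..N}" for A
    using altE_prodf[OF that empty_subsetI Int_empty_right bfactor x] by (simp only: empty_iff if_False)
  have zero: "altE {} A (prodf N factor) x = 0" if "A \<subseteq> {1..N}" "\<not> ?top \<subseteq> A" for A
  proof -
    obtain j where "j \<in> ?top" "j \<notin> A" using \<open>\<not> ?top \<subseteq> A\<close> by blast
    then show ?thesis unfolding e[OF that(1)] by (intro prod_zero bexI[of _ j]) (auto simp: integral_factor)
  qed
  have val: "altE {} (insert i ?top) (prodf N factor) x = prodf N (part_factor i) x" if i: "i \<in> {1..k}" for i
  proof -
    have "insert i ?top \<subseteq> {1..N}" using i N by auto
    from e[OF this] show ?thesis unfolding prodf_def using i N
      by (simp only:) (intro prod.cong refl, auto simp: integral_factor factor_def part_factor_def)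
  qed
  have img: "{A. A \<subseteq> {1..N} \<and> card A = Suc q \<and> ?top \<subseteq> A} = (\<lambda>i. insert i ?top) ` {1..k}"
  proof (intro set_eqI iffI)
    fix A assume "A \<in> {A. A \<subseteq> {1..N} \<and> card A = Suc q \<and> ?top \<subseteq> A}"
    then have A: "A \<subseteq> {1..N}" "card A = Suc q" "?top \<subseteq> A" by auto
    then have "card (A - ?top) = 1" using ct finite_subset[OF A(1)] by (subst card_Diff_subset) auto
    then obtain i where i: "A - ?top = {i}" by (rule card_1_singletonE)
    then have "A = insert i ?top" "i \<in> {1..N}" "i \<notin> ?top" using A by auto
    then show "A \<in> (\<lambda>i. insert i ?top) ` {1..k}" by (intro image_eqI[of _ _ i]) auto
  next
    fix A assume "A \<in> (\<lambda>i. insert i ?top) ` {1..k}"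
    then obtain i where i: "i \<in> {1..k}" "A = insert i ?top" by auto
    then show "A \<in> {A. A \<subseteq> {1..N} \<and> card A = Suc q \<and> ?top \<subseteq> A}" using N ct by auto
  qed
  have inj: "inj_on (\<lambda>i. insert i ?top) {1..k}" by (auto simp: inj_on_def)
  have "projPk M N (Suc q) (prodf N factor) x =
      (\<Sum>A | A \<subseteq> {1..N} \<and> card A = Suc q \<and> ?top \<subseteq> A. altE {} A (prodf N factor) x)"
    unfolding projPk_altE by (intro sum.mono_neutral_right finite_subsets_card) (auto intro: zero)
  also have "\<dots> = (\<Sum>i\<in>{1..k}. altE {} (insert i ?top) (prodf N factor) x)"
    unfolding img by (subst sum.reindex[OF inj]) simp
  finally show ?thesis using val by (simp add: chaos_def)
qed

lemma integral_part_factor_top: "k < j \<Longrightarrow> i \<le> k \<Longrightarrow> (\<integral>c. part_factor i j c \<partial>M) = 0"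
  by (simp add: part_factor_def s0)

text \<open>A single term of the square function, that of the last \<open>m\<close> indices, already
  reproduces the whole function.\<close>

lemma H1norm_chaos:
  assumes m: "1 \<le> m" "m \<le> q"
  shows "L1norm M N chaos \<le> H1norm M N m chaos"
  unfolding H1norm_eq[OF m(1)] L1norm_def prodM_eq
proof (intro nn_integral_mono ennreal_leI)
  fix x assume x: "x \<in> space \<mu>"
  let ?A = "{Suc (N - m)..N}"
  have A: "?A \<subseteq> {1..N}" "card ?A = m" using m N by auto
  note C = free_coords_top[OF m]
  have "altE {1..N - m} ?A (prodf N (part_factor i)) x = prodf N (part_factor i) x" if "i \<in> {1..k}" for i
  proof -
    have "altE {1..N - m} ?A (prodf N (part_factor i)) x =
      (\<Prod>j\<in>{1..N}. if j \<in> ?A then part_factor i j (x j) - (\<integral>c. part_factor i j c \<partial>M)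
        else if j \<in> {1..N - m} then part_factor i j (x j) else (\<integral>c. part_factor i j c \<partial>M))"
      using A m N by (intro altE_prodf bpart_factor x) auto
    also have "\<dots> = prodf N (part_factor i) x"
      unfolding prodf_def using that m N by (intro prod.cong refl) (auto simp: integral_part_factor_top)
    finally show ?thesis .
  qed
  moreover have "altE {1..N - m} ?A chaos x = (\<Sum>i\<in>{1..k}. altE {1..N - m} ?A (prodf N (part_factor i)) x)"
    unfolding chaos_def[abs_def] using A by (intro altE_sum bm_prodf bpart_factor x) auto
  ultimately have "altE (free_coords True m ?A) ?A chaos x = chaos x" by (simp add: C chaos_def)
  then have "(cmod (chaos x))\<^sup>2 = (cmod (altE (free_coords True m ?A) ?A chaos x))\<^sup>2" by simp
  also have "\<dots> \<le> sqfun True m chaos x"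
    unfolding sqfun_def using A by (intro member_le_sum finite_subsets_card) auto
  finally show "cmod (chaos x) \<le> sqrt (sqfun True m chaos x)" by (rule real_le_rsqrt)
qed

text \<open>Duality with a bounded test function. Each of the \<open>k\<close> summands pairs to
  \<open>\<i> * \<sigma> / sqrt k * \<tau> ^ q\<close>, so together they reach order
  \<open>sqrt k\<close>, while the test function stays below \<open>exp (K^2 / 2)\<close> for every
  \<open>k\<close>.\<close>

lemma L1norm_chaos:
  "ennreal (sqrt k * (\<integral>c. (r c)\<^sup>2 \<partial>M) * (\<integral>c. (cmod (s c))\<^sup>2 \<partial>M) ^ q * exp (- K\<^sup>2 / 2)) \<le> L1norm M N chaos"
proof -
  define \<sigma> where "\<sigma> = (\<integral>c. (r c)\<^sup>2 \<partial>M)"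
  define \<tau> where "\<tau> = (\<integral>c. (cmod (s c))\<^sup>2 \<partial>M)"
  \<comment> \<open>The imaginary unit removes the first-order term from the modulus: its square is
    \<open>1 + r^2 / k\<close>, so a product of \<open>k\<close> such factors stays bounded.\<close>
  define \<psi> where "\<psi> j c = (if j \<le> k then 1 + \<i> * complex_of_real (r c / sqrt k) else cnj (s c))" for j :: nat and c
  have kp: "0 < real k" using k by simp
  have "cnj \<in> borel_measurable borel" by (intro borel_measurable_continuous_onI continuous_intros)
  from measurable_compose[OF bm_measurable[OF bs] this]
  have bcs: "bounded_meas M (\<lambda>c. cnj (s c))" using s1 unfolding bounded_meas_def by auto
  have brk: "bounded_meas M (\<lambda>c. \<i> * complex_of_real (r c / sqrt k))"
    using bm_cmult[OF bcr, of "\<i> / sqrt k"] by simp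
  have b\<psi>: "bounded_meas M (\<psi> j)" for j
    unfolding \<psi>_def[abs_def] using bcs brk by (cases "j \<le> k") (auto intro!: bm_add bm_const)
  have n\<psi>: "cmod (\<psi> j c) \<le> (if j \<le> k then exp (K\<^sup>2 / (2 * k)) else 1)" if c: "c \<in> space M" for j c
  proof (cases "j \<le> k")
    case True
    have "(cmod (\<psi> j c))\<^sup>2 = 1 + (r c)\<^sup>2 / k"
      using True kp by (simp add: \<psi>_def cmod_power2 power_divide)
    also have "\<dots> \<le> 1 + K\<^sup>2 / k"
      using rK[OF c] kp by (intro add_left_mono divide_right_mono) (auto simp: abs_le_square_iff[symmetric])
    also have "\<dots> \<le> exp (K\<^sup>2 / k)" by (rule exp_ge_add_one_self)
    also have "\<dots> = (exp (K\<^sup>2 / (2 * k)))\<^sup>2" by (simp add: exp_double[symmetric])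
    finally have "cmod (\<psi> j c) \<le> exp (K\<^sup>2 / (2 * k))" by (rule power2_le_imp_le) simp
    then show ?thesis using True by (simp only: if_True)
  next
    case False
    then show ?thesis using s1[OF c] by (simp add: \<psi>_def)
  qed
  have n\<phi>: "cmod (prodf N \<psi> x) \<le> exp (K\<^sup>2 / 2)" if x: "x \<in> space \<mu>" for x
  proof -
    have "cmod (prodf N \<psi> x) \<le> (\<Prod>j\<in>{1..N}. if j \<le> k then exp (K\<^sup>2 / (2 * k)) else 1)"
      unfolding prodf_def prod_norm[symmetric] using n\<psi> coord_in_space[OF x] by (intro prod_mono) auto
    also have "\<dots> = (\<Prod>j\<in>{1..k}. exp (K\<^sup>2 / (2 * k)))"
      using N by (intro prod.mono_neutral_cong_right) auto
    also have "\<dots> = exp (K\<^sup>2 / 2)" using kp by (simp add: exp_of_nat_mult[symmetric])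
    finally show ?thesis .
  qed
  have int\<psi>: "(\<integral>c. 1 + \<i> * complex_of_real (r c / sqrt k) \<partial>M) = 1"
  proof -
    have "(\<integral>c. \<i> * complex_of_real (r c / sqrt k) \<partial>M) = 0"
      using r0 by (simp only: integral_mult_right_zero integral_complex_of_real) simp
    then show ?thesis using integrable_bounded_meas[OF brk] by (simp add: prob_space del: of_real_divide)
  qed
  have intr: "(\<integral>c. complex_of_real (r c) * (1 + \<i> * complex_of_real (r c / sqrt k)) \<partial>M) = \<i> * \<sigma> / sqrt k"
  proof -
    have b2: "bounded_meas M (\<lambda>c. complex_of_real ((r c)\<^sup>2))" using bm_mult[OF bcr bcr] by (simp add: power2_eq_square)
    have "(\<lambda>c. complex_of_real (r c) * (1 + \<i> * complex_of_real (r c / sqrt k))) =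
        (\<lambda>c. complex_of_real (r c) + (\<i> / sqrt k) * complex_of_real ((r c)\<^sup>2))"
      by (simp add: fun_eq_iff algebra_simps power2_eq_square)
    then have "(\<integral>c. complex_of_real (r c) * (1 + \<i> * complex_of_real (r c / sqrt k)) \<partial>M) =
        (\<integral>c. complex_of_real (r c) \<partial>M) + (\<integral>c. (\<i> / sqrt k) * complex_of_real ((r c)\<^sup>2) \<partial>M)"
      using integrable_bounded_meas[OF bcr] integrable_bounded_meas[OF bm_cmult[OF b2]]
      by (simp only:) (rule Bochner_Integration.integral_add)
    also have "\<dots> = (\<i> / sqrt k) * complex_of_real \<sigma>"
      unfolding \<sigma>_def by (simp only: integral_mult_right_zero integral_complex_of_real r0) simp
    finally show ?thesis by simp
  qed
  have ints: "(\<integral>c. s c * cnj (s c) \<partial>M) = complex_of_real \<tau>"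
    unfolding \<tau>_def integral_complex_of_real[symmetric] by (intro Bochner_Integration.integral_cong refl) (simp only: complex_norm_square)
  have tm: "(\<integral>x. prodf N (part_factor i) x * prodf N \<psi> x \<partial>\<mu>) = \<i> * \<sigma> / sqrt k * complex_of_real \<tau> ^ q"
    if i: "i \<in> {1..k}" for i
  proof -
    have "(\<integral>x. prodf N (part_factor i) x * prodf N \<psi> x \<partial>\<mu>) = (\<integral>x. prodf N (\<lambda>j c. part_factor i j c * \<psi> j c) x \<partial>\<mu>)"
      by (simp add: prodf_def prod.distrib)
    also have "\<dots> = (\<Prod>j\<in>{1..N}. \<integral>c. part_factor i j c * \<psi> j c \<partial>M)"
      by (intro integral_prodf bm_mult bpart_factor b\<psi>)
    also have "\<dots> = (\<Prod>j\<in>{1..N}. if j = i then \<i> * \<sigma> / sqrt k else if j \<le> k then 1 else complex_of_real \<tau>)"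
      using i by (intro prod.cong refl) (auto simp: part_factor_def \<psi>_def int\<psi> intr ints simp del: of_real_divide)
    also have "\<dots> = (\<Prod>j\<in>{1..k}. if j = i then \<i> * \<sigma> / sqrt k else if j \<le> k then 1 else complex_of_real \<tau>)
       * (\<Prod>j\<in>{Suc k..N}. if j = i then \<i> * \<sigma> / sqrt k else if j \<le> k then 1 else complex_of_real \<tau>)"
    proof -
      have "{1..N} = {1..k} \<union> {Suc k..N}" using N by auto
      then show ?thesis by (simp only:) (rule prod.union_disjoint, auto)
    qed
    also have "(\<Prod>j\<in>{1..k}. if j = i then \<i> * \<sigma> / sqrt k else if j \<le> k then 1 else complex_of_real \<tau>) =
        (\<Prod>j\<in>{1..k}. if j = i then \<i> * \<sigma> / sqrt k else 1)" by (intro prod.cong) auto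
    also have "\<dots> = \<i> * \<sigma> / sqrt k" using i by (subst prod.delta) auto
    also have "(\<Prod>j\<in>{Suc k..N}. if j = i then \<i> * \<sigma> / sqrt k else if j \<le> k then 1 else complex_of_real \<tau>) =
        (\<Prod>j\<in>{Suc k..N}. complex_of_real \<tau>)" using i by (intro prod.cong) auto
    also have "\<dots> = complex_of_real \<tau> ^ q" using N by simp
    finally show ?thesis .
  qed
  have "(\<integral>x. chaos x * prodf N \<psi> x \<partial>\<mu>) = (\<Sum>i\<in>{1..k}. \<integral>x. prodf N (part_factor i) x * prodf N \<psi> x \<partial>\<mu>)"
    unfolding chaos_def sum_distrib_right
    by (intro Bochner_Integration.integral_sum integrable_bm bm_mult bm_prodf bpart_factor b\<psi>)
  also have "\<dots> = of_nat k * (\<i> * \<sigma> / sqrt k * complex_of_real \<tau> ^ q)" by (simp add: tm)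
  finally have I: "cmod (\<integral>x. chaos x * prodf N \<psi> x \<partial>\<mu>) = k * (\<sigma> / sqrt k * \<tau> ^ q)"
    by (simp add: norm_mult norm_divide norm_power \<sigma>_def \<tau>_def)
  have "k * (\<sigma> / sqrt k * \<tau> ^ q) = sqrt k * \<sigma> * \<tau> ^ q"
    using kp by (simp add: field_simps real_div_sqrt) 
  then have "ennreal (sqrt k * \<sigma> * \<tau> ^ q) \<le> (\<integral>\<^sup>+x. ennreal (cmod (chaos x * prodf N \<psi> x)) \<partial>\<mu>)"
    using integral_norm_bound_ennreal[OF integrable_bm[OF bm_mult[OF bm_chaos bm_prodf[of \<psi>]]]] b\<psi> I by simp
  also have "\<dots> \<le> (\<integral>\<^sup>+x. ennreal (exp (K\<^sup>2 / 2)) * ennreal (cmod (chaos x)) \<partial>\<mu>)"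
  proof (intro nn_integral_mono)
    fix x assume "x \<in> space \<mu>"
    then have "cmod (chaos x * prodf N \<psi> x) \<le> exp (K\<^sup>2 / 2) * cmod (chaos x)"
      using mult_right_mono[OF n\<phi>, of x "cmod (chaos x)"] by (simp add: norm_mult mult.commute)
    then show "ennreal (cmod (chaos x * prodf N \<psi> x)) \<le> ennreal (exp (K\<^sup>2 / 2)) * ennreal (cmod (chaos x))"
      by (simp add: ennreal_mult[symmetric] ennreal_leI)
  qed
  also have "\<dots> = ennreal (exp (K\<^sup>2 / 2)) * L1norm M N chaos"
    unfolding L1norm_def prodM_eq using bm_measurable[OF bm_chaos] by (intro nn_integral_cmult) auto
  finally have "ennreal (exp (- K\<^sup>2 / 2)) * ennreal (sqrt k * \<sigma> * \<tau> ^ q) \<le>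
      ennreal (exp (- K\<^sup>2 / 2)) * (ennreal (exp (K\<^sup>2 / 2)) * L1norm M N chaos)" by (rule mult_left_mono) simp
  also have "\<dots> = L1norm M N chaos"
    by (simp add: mult.assoc[symmetric] ennreal_mult[symmetric] exp_add[symmetric])
  finally show ?thesis
    by (simp add: \<sigma>_def \<tau>_def ennreal_mult[symmetric] mult_ac zero_le_mult_iff)
qed

lemma riesz_lower:
  defines "b \<equiv> sqrt k * (\<integral>c. (r c)\<^sup>2 \<partial>M) * (\<integral>c. (cmod (s c))\<^sup>2 \<partial>M) ^ q * exp (- K\<^sup>2 / 2)"
  shows "ennreal b \<le> L1norm M N (projPk M N (Suc q) (prodf N factor))"
    and "1 \<le> m \<Longrightarrow> m \<le> q \<Longrightarrow> ennreal b \<le> H1norm M N m (projPk M N (Suc q) (prodf N factor))"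
proof -
  have "L1norm M N (projPk M N (Suc q) (prodf N factor)) = L1norm M N chaos"
    unfolding L1norm_def prodM_eq by (intro nn_integral_cong) (simp add: projPk_riesz)
  then show "ennreal b \<le> L1norm M N (projPk M N (Suc q) (prodf N factor))"
    using L1norm_chaos by (simp add: b_def)
  assume m: "1 \<le> m" "m \<le> q"
  have "sqfun True m (projPk M N (Suc q) (prodf N factor)) x = sqfun True m chaos x" if "x \<in> space \<mu>" for x
    unfolding sqfun_def using that
    by (intro sum.cong refl arg_cong[where f = "\<lambda>z. (cmod z)\<^sup>2"] altE_cong free_coords_subset bm_measurable
        bm_projPk bm_riesz bm_chaos projPk_riesz) auto
  then have "H1norm M N m (projPk M N (Suc q) (prodf N factor)) = H1norm M N m chaos"
    unfolding H1norm_eq[OF m(1)] by (intro nn_integral_cong) simp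
  then show "ennreal b \<le> H1norm M N m (projPk M N (Suc q) (prodf N factor))"
    using L1norm_chaos H1norm_chaos[OF m] by (simp add: b_def)
qed

end

section \<open>Choice of test functions on general spaces and on the torus\<close>

text \<open>Cut at the mean: a function that lies almost everywhere on one side of its mean equals
  it almost everywhere.\<close>

lemma (in prob_space) nonconstant_split:
  fixes g :: "'a \<Rightarrow> real"
  assumes g: "g \<in> borel_measurable M" and g2: "integrable M (\<lambda>x. (g x)\<^sup>2)" and nc: "\<not> (\<exists>c. AE x in M. g x = c)"
  obtains B where "B \<in> events" "0 < prob B" "prob B < 1"
proof -
  have gi: "integrable M g" using square_integrable_imp_integrable[OF g g2] .
  define e where "e = expectation g"
  define B where "B = {x \<in> space M. g x \<le> e}"
  have B: "B \<in> events" unfolding B_def using g by measurable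
  have "prob B \<noteq> 1"
  proof
    assume "prob B = 1"
    then have ae: "AE x in M. 0 \<le> e - g x" using prob_eq_1[OF B] by (auto simp: B_def)
    have "(\<integral>x. e - g x \<partial>M) = 0" using gi by (simp add: e_def prob_space)
    then have "AE x in M. e - g x = 0" using integral_nonneg_eq_0_iff_AE[OF _ ae] gi by simp
    then have "AE x in M. g x = e" by auto
    then show False using nc by blast
  qed
  moreover have "prob B \<noteq> 0"
  proof
    assume "prob B = 0"
    then have "AE x in M. x \<notin> B" using prob_eq_0[OF B] by simp
    then have "AE x in M. 0 < g x - e" using AE_space by eventually_elim (auto simp: B_def)
    moreover from this have ae: "AE x in M. 0 \<le> g x - e" by (auto elim: eventually_mono)
    moreover have "(\<integral>x. g x - e \<partial>M) = 0" using gi by (simp add: e_def prob_space)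
    ultimately have "AE x in M. g x - e = 0" using integral_nonneg_eq_0_iff_AE[OF _ ae] gi by simp
    then have "AE x in M. g x = e" by auto
    then show False using nc by blast
  qed
  ultimately show ?thesis using that[OF B] prob_le_1[of B] measure_nonneg[of M B] by linarith
qed

lemma sqrt_unbounded:
  fixes b C :: real
  assumes b: "0 < b"
  obtains k :: nat where "1 \<le> k" "\<not> ennreal (sqrt k * b) \<le> ennreal C"
proof -
  obtain k :: nat where k: "(\<bar>C\<bar> / b + 1)\<^sup>2 < k" using reals_Archimedean2 by blast
  have "\<bar>C\<bar> / b + 1 < sqrt k" using k b by (intro real_less_rsqrt) auto
  then have "\<bar>C\<bar> < sqrt k * b" using b by (simp add: field_simps)
  then have "ennreal C < ennreal (sqrt k * b)" using b by (intro ennreal_lessI) auto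
  moreover have "1 \<le> k"
  proof (rule ccontr)
    assume "\<not> 1 \<le> k"
    then have "k = 0" by simp
    then show False using k by simp
  qed
  ultimately show ?thesis using that by (simp add: not_le)
qed

lemma projPk_unbounded_H1:
  fixes M :: "'a measure" and g :: "'a \<Rightarrow> real"
  assumes "prob_space M" and g: "g \<in> borel_measurable M" "integrable M (\<lambda>x. (g x)\<^sup>2)" "\<not> (\<exists>c. AE x in M. g x = c)"
    and m: "1 \<le> m" "m \<le> q"
    and bd: "\<And>N f. integrable (prodM M N) f \<Longrightarrow> H1norm M N m (projPk M N (Suc q) f) \<le> ennreal C * H1norm M N m f"
  shows False
proof -
  interpret prob_space M by fact
  obtain B where B: "B \<in> events" "0 < prob B" "prob B < 1" using nonconstant_split[OF g] .
  define p where "p = prob B"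
  have p: "0 < p" "p < 1" using B by (auto simp: p_def)
  \<comment> \<open>One event supplies both functions: \<open>1 + r\<close> is its indicator
    normalized to mean 1, hence nonnegative, and \<open>s\<close> is its centred indicator.\<close>
  define r where "r x = indicator B x / p - 1" for x :: 'a
  define s where "s x = complex_of_real (indicator B x - p)" for x :: 'a
  define K where "K = 1 / p + 1"
  have Bi: "integrable M (indicator B :: 'a \<Rightarrow> real)"
    using B(1) by (intro integrable_real_indicator) (auto simp: less_top[symmetric])
  have Bint: "(\<integral>x. indicator B x \<partial>M) = p" using B by (simp add: p_def)
  have r2: "(\<lambda>x. (r x)\<^sup>2) = (\<lambda>x. indicator B x * (1 / p\<^sup>2 - 2 / p) + 1)"
  proof
    fix x
    show "(r x)\<^sup>2 = indicator B x * (1 / p\<^sup>2 - 2 / p) + 1"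
      by (cases "x \<in> B") (simp_all add: r_def power2_diff power_divide)
  qed
  have "(\<integral>x. (r x)\<^sup>2 \<partial>M) = p * (1 / p\<^sup>2 - 2 / p) + 1" unfolding r2 using Bi Bint by (simp add: prob_space)
  also have "\<dots> = 1 / p - 1" using p by (simp add: field_simps power2_eq_square)
  also have "\<dots> > 0" using p by simp
  finally have \<sigma>: "0 < (\<integral>x. (r x)\<^sup>2 \<partial>M)" .
  have s2: "(\<lambda>x. (cmod (s x))\<^sup>2) = (\<lambda>x. indicator B x * (1 - 2 * p) + p\<^sup>2)"
    unfolding s_def norm_of_real by (auto simp: indicator_def power2_eq_square algebra_simps)
  have "(\<integral>x. (cmod (s x))\<^sup>2 \<partial>M) = p * (1 - 2 * p) + p\<^sup>2" unfolding s2 using Bi Bint by (simp add: prob_space)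
  also have "\<dots> = p * (1 - p)" by (simp add: algebra_simps power2_eq_square)
  finally have \<tau>: "0 < (\<integral>x. (cmod (s x))\<^sup>2 \<partial>M)" using p by simp
  define b where "b = (\<integral>x. (r x)\<^sup>2 \<partial>M) * (\<integral>x. (cmod (s x))\<^sup>2 \<partial>M) ^ q * exp (- K\<^sup>2 / 2)"
  have "0 < b" unfolding b_def using \<sigma> \<tau> by simp
  then obtain k :: nat where kC: "1 \<le> k" "\<not> ennreal (sqrt k * b) \<le> ennreal C" by (rule sqrt_unbounded)
  interpret riesz_test M "k + q" k q r s K
  proof unfold_locales
    show "1 \<le> k" by (rule kC)
    show "r \<in> borel_measurable M" unfolding r_def[abs_def] using B by measurable
    show "\<bar>r c\<bar> \<le> K" for c using p by (auto simp: r_def K_def indicator_def)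
    show "- 1 \<le> r c" for c using p by (auto simp: r_def indicator_def)
    show "(\<integral>c. r c \<partial>M) = 0" unfolding r_def using Bi Bint p by (simp add: prob_space)
    have "s \<in> borel_measurable M" unfolding s_def[abs_def] using B by measurable
    moreover have s1: "cmod (s c) \<le> 1" for c unfolding s_def norm_of_real using p by (auto simp: indicator_def)
    ultimately show "bounded_meas M s" by (auto simp: bounded_meas_def)
    show "cmod (s c) \<le> 1" for c by (rule s1)
    show "(\<integral>c. s c \<partial>M) = 0" unfolding s_def using Bi Bint by (simp add: prob_space del: of_real_diff)
  qed simp
  have "ennreal (sqrt k * b) \<le> H1norm M (k + q) m (projPk M (k + q) (Suc q) (prodf (k + q) factor))"
    using riesz_lower(2)[OF m] by (simp add: b_def mult.assoc)
  also have "\<dots> \<le> ennreal C * H1norm M (k + q) m (prodf (k + q) factor)"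
    by (intro bd) (use integrable_bm[OF bm_riesz] in \<open>simp add: prodM_eq\<close>)
  also have "\<dots> \<le> ennreal C * 1" by (intro mult_left_mono H1norm_riesz m) simp
  finally show False using kC by simp
qed

lemma integral_torus_cos: "(\<integral>t. cos (of_int j * t) \<partial>torus) = (if j = 0 then 1 else 0)"
proof -
  have "(\<lambda>t. cos (of_int j * t)) = (\<lambda>t. Re (echar j t))"
    by (simp add: echar_def Re_exp fun_eq_iff)
  then have "(\<integral>t. cos (of_int j * t) \<partial>torus) = Re (\<integral>t. echar j t \<partial>torus)"
    by (simp only:) (rule integral_Re[OF torus.integrable_bounded_meas[OF bm_echar]])
  then show ?thesis by (simp add: integral_echar)
qed

text \<open>The cosine keeps \<open>1 + r\<close> nonnegative with frequencies -1, 0 and 1 only, and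
  \<open>echar 1\<close> puts the positive frequency 1 at each of the last \<open>q\<close> indices,
  as the analytic space demands.\<close>

lemma riesz_test_torus:
  assumes "1 \<le> k"
  shows "riesz_test torus (k + q) k q cos (echar 1) 1"
proof unfold_locales
    show "(\<integral>c. cos c \<partial>torus) = 0" using integral_torus_cos[of 1] by simp
    show "(cos :: real \<Rightarrow> real) \<in> borel_measurable torus"
      using borel_measurable_continuous_onI[of "cos :: real \<Rightarrow> real"] by (simp add: continuous_intros cong: measurable_cong_sets)
qed (use assms in \<open>auto simp: bm_echar integral_echar\<close>)

lemma integral_cos_sq_torus: "(\<integral>t. (cos t)\<^sup>2 \<partial>torus) = 1 / 2"
proof -
  have "bounded_meas torus (\<lambda>t. cos (of_int 2 * t) :: real)"
    by (rule bounded_meas_torus[where K = 1]) (auto intro!: continuous_intros)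
  then have i: "integrable torus (\<lambda>t. cos (of_int 2 * t) :: real)" by (rule torus.integrable_bounded_meas)
  have "(\<integral>t. (cos t)\<^sup>2 \<partial>torus) = (\<integral>t. (1 + cos (of_int 2 * t)) / 2 \<partial>torus)"
    by (intro Bochner_Integration.integral_cong refl) (simp add: cos_double_cos)
  also have "\<dots> = (1 + (\<integral>t. cos (of_int 2 * t) \<partial>torus)) / 2"
    using i torus.prob_space by (simp del: of_int_numeral)
  finally show ?thesis unfolding integral_torus_cos by simp
qed

lemma H1last_prodM_integrable: "f \<in> H1last m N \<Longrightarrow> integrable (Pi\<^sub>M {1..N} (\<lambda>_. torus)) f"
  by (simp add: H1last_def prodM_def)

lemma trig_poly_in_H1last:
  assumes S: "finite S" "S \<subseteq> {n. admissible m N n}" and f: "\<And>t. f t = (\<Sum>n\<in>S. c n * torus_char N n t)"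
  shows "f \<in> H1last m N"
proof -
  interpret T: coordinate_space torus N by (rule coordinate_space_torus)
  have "T.bm (\<lambda>t. \<Sum>n\<in>S. c n * torus_char N n t)" by (intro bm_sum bm_cmult bm_torus_char)
  then have "integrable T.\<mu> f" using f T.integrable_bm by (simp cong: Bochner_Integration.integrable_cong)
  moreover have "L1norm torus N (\<lambda>t. f t - (\<Sum>n\<in>S. c n * torus_char N n t)) = 0" by (simp add: L1norm_def f)
  ultimately show ?thesis unfolding H1last_def prodM_def using S by (auto intro!: exI[of _ S] exI[of _ c])
qed

lemma cos_echar: "1 + complex_of_real (cos t) = (\<Sum>a\<in>{-1, 0, 1}. (if a = 0 then 1 else 1 / 2) * echar a t)"
proof -
  have "complex_of_real (cos t) = (echar 1 t + echar (-1) t) / 2"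
    by (simp add: echar_def complex_eq_iff Re_exp Im_exp)
  then show ?thesis by (simp add: field_simps)
qed

text \<open>In the expanded product every character has frequency 1 at the last \<open>q\<close>
  indices. As \<open>m \<le> q\<close>, its last \<open>m\<close> nonzero entries are among these,
  so the negative frequencies further left do no harm.\<close>

lemma riesz_in_H1last:
  assumes k: "1 \<le> k" and m: "1 \<le> m" "m \<le> q"
  shows "prodf (k + q) (riesz_test.factor k cos (echar 1)) \<in> H1last m (k + q)"
proof -
  interpret riesz_test torus "k + q" k q cos "echar 1" 1 by (rule riesz_test_torus[OF k])
  let ?N = "k + q"
  define A :: "nat \<Rightarrow> int set" where "A j = (if j \<le> k then {-1, 0, 1} else {1})" for j
  define w :: "nat \<Rightarrow> int \<Rightarrow> complex" where "w j a = (if j \<le> k \<and> a \<noteq> 0 then 1 / 2 else 1)" for j a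
  \<comment> \<open>Members of \<open>P\<close> are \<open>undefined\<close> outside
    \<open>{1..?N}\<close>, whereas \<open>admissible\<close> asks for 0 there.\<close>
  define ext :: "(nat \<Rightarrow> int) \<Rightarrow> nat \<Rightarrow> int" where "ext \<phi> = (\<lambda>j. if j \<in> {1..?N} then \<phi> j else 0)" for \<phi>
  define P where "P = PiE {1..?N} A"
  have finP: "finite P" unfolding P_def by (intro finite_PiE) (auto simp: A_def)
  have inj: "inj_on ext P"
  proof (rule inj_onI)
    fix \<phi> \<psi> assume "\<phi> \<in> P" "\<psi> \<in> P" "ext \<phi> = ext \<psi>"
    then show "\<phi> = \<psi>" unfolding P_def
      by (intro PiE_ext[of \<phi> "{1..?N}" A \<psi>]) (auto simp: ext_def fun_eq_iff split: if_splits)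
  qed
  have factor_sum: "factor j t = (\<Sum>a\<in>A j. w j a * echar a t)" for j t
    unfolding factor_def A_def w_def using cos_echar[of t] by (cases "j \<le> k") (auto simp: if_distrib cong: if_cong)
  show ?thesis
  proof (rule trig_poly_in_H1last[where S = "ext ` P" and c = "\<lambda>n. \<Prod>j\<in>{1..?N}. w j (n j)"])
    show "finite (ext ` P)" using finP by simp
    show "ext ` P \<subseteq> {n. admissible m ?N n}"
    proof clarify
      fix \<phi> assume \<phi>: "\<phi> \<in> P"
      have top: "ext \<phi> j = 1" if "j \<in> {Suc k..?N}" for j
        using PiE_mem[OF \<phi>[unfolded P_def], of j] that by (simp add: A_def ext_def)
      let ?S = "{j \<in> {1..?N}. ext \<phi> j \<noteq> 0}"
      have sub: "{Suc k..?N} \<subseteq> ?S" using top by auto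
      have "card {Suc k..?N} = q" by simp
      then have cS: "q \<le> card ?S" using card_mono[OF _ sub] by simp
      show "admissible m ?N (ext \<phi>)" unfolding admissible_def Let_def
      proof (intro conjI allI impI ballI)
        show "ext \<phi> j = 0" if "j \<notin> {1..?N}" for j using that by (auto simp: ext_def)
        show "0 < ext \<phi> i" if i: "i \<in> ?S" "card {j \<in> ?S. i < j} < m" for i
        proof (cases "i \<le> k")
          case True
          then have "{Suc k..?N} \<subseteq> {j \<in> ?S. i < j}" using sub by auto
          then have "q \<le> card {j \<in> ?S. i < j}" using card_mono[of "{j \<in> ?S. i < j}" "{Suc k..?N}"] by simp
          then show ?thesis using i m by simp
        next
          case False
          then show ?thesis using top[of i] i by simp
        qed
        show "0 \<le> ext \<phi> j" if "card ?S < m" for j using that cS m by simp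
      qed
    qed
    fix t
    have "prodf ?N factor t = (\<Prod>j\<in>{1..?N}. \<Sum>a\<in>A j. w j a * echar a (t j))"
      by (simp add: prodf_def factor_sum)
    also have "\<dots> = (\<Sum>\<phi>\<in>P. \<Prod>j\<in>{1..?N}. w j (\<phi> j) * echar (\<phi> j) (t j))"
      unfolding P_def by (rule prod_sum_PiE) (auto simp: A_def)
    also have "\<dots> = (\<Sum>\<phi>\<in>P. (\<Prod>j\<in>{1..?N}. w j (ext \<phi> j)) * torus_char ?N (ext \<phi>) t)"
      unfolding torus_char_prodf prodf_def prod.distrib[symmetric]
      by (intro sum.cong prod.cong refl) (simp add: ext_def)
    also have "\<dots> = (\<Sum>n\<in>ext ` P. (\<Prod>j\<in>{1..?N}. w j (n j)) * torus_char ?N n t)"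
      by (simp add: sum.reindex[OF inj])
    finally show "prodf ?N factor t = (\<Sum>n\<in>ext ` P. (\<Prod>j\<in>{1..?N}. w j (n j)) * torus_char ?N n t)" .
  qed
qed

lemma projPk_unbounded_H1last:
  assumes m: "1 \<le> m" "m \<le> q"
    and bd: "\<And>N f. f \<in> H1last m N \<Longrightarrow> L1norm torus N (projPk torus N (Suc q) f) \<le> ennreal C * L1norm torus N f"
  shows False
proof -
  define b where "b = 1 / 2 * exp (- 1 / 2 :: real)"
  have "0 < b" by (simp add: b_def)
  then obtain k :: nat where kC: "1 \<le> k" "\<not> ennreal (sqrt k * b) \<le> ennreal C" by (rule sqrt_unbounded)
  interpret riesz_test torus "k + q" k q cos "echar 1" 1 by (rule riesz_test_torus[OF kC(1)])
  have "ennreal (sqrt k * b) \<le> L1norm torus (k + q) (projPk torus (k + q) (Suc q) (prodf (k + q) factor))"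
    using riesz_lower(1) by (simp add: b_def integral_cos_sq_torus torus.prob_space[simplified])
  also have "\<dots> \<le> ennreal C * L1norm torus (k + q) (prodf (k + q) factor)"
    by (intro bd riesz_in_H1last kC m)
  also have "\<dots> \<le> ennreal C * 1" by (intro mult_left_mono L1norm_riesz) simp
  finally show False using kC by simp
qed

section \<open>The norm equivalence and the range of bounded chaos projections\<close>

theorem theorem5p2:
  fixes m :: nat
  assumes m: "m \<ge> 1"
  shows
    "(\<exists>c C :: real. 0 < c \<and> c \<le> C \<and>
        (\<forall>N f. f \<in> H1last m N \<longrightarrow>
           ennreal c * H1norm torus N m f \<le> L1norm torus N f \<and>
           L1norm torus N f \<le> ennreal C * H1norm torus N m f))
   \<and>
    (\<forall>(M :: 'a measure) (m' :: nat).
       prob_space M \<longrightarrow>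
       (\<exists>g :: 'a \<Rightarrow> real. g \<in> borel_measurable M \<and> integrable M (\<lambda>x. (g x)\<^sup>2) \<and>
          \<not> (\<exists>c. AE x in M. g x = c)) \<longrightarrow>
       ((m' \<le> m \<longleftrightarrow>
           (\<exists>C :: real. \<forall>N f. integrable (prodM M N) f \<longrightarrow>
              H1norm M N m (projPk M N m' f) \<le> ennreal C * H1norm M N m f))
        \<and>
        (m' \<le> m \<longleftrightarrow>
           (\<exists>C :: real. \<forall>N f. f \<in> H1last m N \<longrightarrow>
              L1norm torus N (projPk torus N m' f) \<le> ennreal C * L1norm torus N f))))"
proof (intro conjI allI impI)
  have upper: "L1norm torus N f \<le> 64 ^ m * H1norm torus N m f" if "integrable (Pi\<^sub>M {1..N} (\<lambda>_. torus)) f" for N f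
    by (rule coordinate_space.L1norm_upper[OF coordinate_space_torus m that])
  have p: "(64::ennreal) ^ m = ennreal (64 ^ m)" "(240::ennreal) ^ m = ennreal (240 ^ m)" "(16::ennreal) ^ m = ennreal (16 ^ m)"
    by (simp_all add: ennreal_power[symmetric])
  show "\<exists>c C :: real. 0 < c \<and> c \<le> C \<and> (\<forall>N f. f \<in> H1last m N \<longrightarrow>
      ennreal c * H1norm torus N m f \<le> L1norm torus N f \<and> L1norm torus N f \<le> ennreal C * H1norm torus N m f)"
  proof (rule exI[of _ "1 / 240 ^ m"], rule exI[of _ "64 ^ m"], intro conjI allI impI)
    have "(1::real) / 240 ^ m \<le> 1" by simp
    also have "1 \<le> (64::real) ^ m" by simp
    finally show "(1::real) / 240 ^ m \<le> 64 ^ m" .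
    fix N f assume f: "f \<in> H1last m N"
    have "ennreal (1 / 240 ^ m) * H1norm torus N m f \<le> ennreal (1 / 240 ^ m) * (240 ^ m * L1norm torus N f)"
      by (intro mult_left_mono H1norm_le_L1norm_torus m f) simp
    also have "\<dots> = L1norm torus N f" unfolding p by (simp add: mult.assoc[symmetric] ennreal_mult[symmetric])
    finally show "ennreal (1 / 240 ^ m) * H1norm torus N m f \<le> L1norm torus N f" .
    show "L1norm torus N f \<le> ennreal (64 ^ m) * H1norm torus N m f"
      using upper[OF H1last_prodM_integrable[OF f]] by (simp add: p)
  qed simp
  fix M :: "'a measure" and m' :: nat
  assume "prob_space M" and ex: "\<exists>g :: 'a \<Rightarrow> real. g \<in> borel_measurable M \<and> integrable M (\<lambda>x. (g x)\<^sup>2) \<and>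
          \<not> (\<exists>c. AE x in M. g x = c)"
  then obtain g :: "'a \<Rightarrow> real" where g: "g \<in> borel_measurable M" "integrable M (\<lambda>x. (g x)\<^sup>2)"
    "\<not> (\<exists>c. AE x in M. g x = c)" by blast
  have cs: "coordinate_space M" using \<open>prob_space M\<close> by (simp add: coordinate_space_def)
  show "m' \<le> m \<longleftrightarrow> (\<exists>C :: real. \<forall>N f. integrable (prodM M N) f \<longrightarrow>
      H1norm M N m (projPk M N m' f) \<le> ennreal C * H1norm M N m f)"
  proof
    assume m': "m' \<le> m"
    show "\<exists>C :: real. \<forall>N f. integrable (prodM M N) f \<longrightarrow> H1norm M N m (projPk M N m' f) \<le> ennreal C * H1norm M N m f"
      using coordinate_space.H1norm_projPk[OF cs m m']
      by (intro exI[of _ "16 ^ m"]) (simp add: prodM_def p)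
  next
    assume "\<exists>C :: real. \<forall>N f. integrable (prodM M N) f \<longrightarrow> H1norm M N m (projPk M N m' f) \<le> ennreal C * H1norm M N m f"
    then obtain C :: real where C: "\<And>N f. integrable (prodM M N) f \<Longrightarrow>
        H1norm M N m (projPk M N m' f) \<le> ennreal C * H1norm M N m f" by blast
    show "m' \<le> m"
    proof (rule ccontr)
      assume "\<not> m' \<le> m"
      \<comment> \<open>Taking \<open>m' - 1\<close> factors \<open>s\<close>, of which there are
        then at least \<open>m\<close>, leaves the chaos of order \<open>m'\<close> exactly one
        further difference among the first \<open>k\<close> coordinates.\<close>
      then obtain q where q: "m' = Suc q" "m \<le> q" by (cases m') auto
      show False
        by (rule projPk_unbounded_H1[OF \<open>prob_space M\<close> g m q(2)]) (rule C[unfolded q(1)])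
    qed
  qed
  show "m' \<le> m \<longleftrightarrow> (\<exists>C :: real. \<forall>N f. f \<in> H1last m N \<longrightarrow>
      L1norm torus N (projPk torus N m' f) \<le> ennreal C * L1norm torus N f)"
  proof
    assume m': "m' \<le> m"
    have "L1norm torus N (projPk torus N m' f) \<le> ennreal (64 ^ m * (16 ^ m * 240 ^ m)) * L1norm torus N f"
      if f: "f \<in> H1last m N" for N f
    proof -
      note fi = H1last_prodM_integrable[OF f]
      \<comment> \<open>The upper bound treats the projected function merely as an integrable one;
        analyticity enters only through \<open>f\<close>, in the last estimate of the chain.\<close>
      have "L1norm torus N (projPk torus N m' f) \<le> 64 ^ m * H1norm torus N m (projPk torus N m' f)"
        by (intro upper coordinate_space.integrable_projPk coordinate_space_torus fi)
      also have "\<dots> \<le> 64 ^ m * (16 ^ m * H1norm torus N m f)"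
        by (intro mult_left_mono coordinate_space.H1norm_projPk coordinate_space_torus m m' fi) simp
      also have "\<dots> \<le> 64 ^ m * (16 ^ m * (240 ^ m * L1norm torus N f))"
        by (intro mult_left_mono H1norm_le_L1norm_torus m f) simp_all
      also have "\<dots> = ennreal (64 ^ m * (16 ^ m * 240 ^ m)) * L1norm torus N f"
        unfolding p by (simp add: mult.assoc ennreal_mult)
      finally show ?thesis .
    qed
    then show "\<exists>C :: real. \<forall>N f. f \<in> H1last m N \<longrightarrow>
        L1norm torus N (projPk torus N m' f) \<le> ennreal C * L1norm torus N f" by blast
  next
    assume "\<exists>C :: real. \<forall>N f. f \<in> H1last m N \<longrightarrow>
        L1norm torus N (projPk torus N m' f) \<le> ennreal C * L1norm torus N f"
    then obtain C :: real where C: "\<And>N f. f \<in> H1last m N \<Longrightarrow>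
        L1norm torus N (projPk torus N m' f) \<le> ennreal C * L1norm torus N f" by blast
    show "m' \<le> m"
    proof (rule ccontr)
      assume "\<not> m' \<le> m"
      then obtain q where q: "m' = Suc q" "m \<le> q" by (cases m') auto
      show False by (rule projPk_unbounded_H1last[OF m q(2)]) (rule C[unfolded q(1)])
    qed
  qed
qed

end
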